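(* Let $1\le m\le n-2$ and let all notation be as in the context. For each $\underline{\alpha}\in\mathbb{N}^s$ with $\alpha_{r+1}=\cdots=\alpha_s=0$ and $\underline{\alpha}\cdot\underline{\sigma}\le d_{m+1}-d_m$, recursively construct forms $h_{\underline{\alpha}}\in S$ of bidegree $(d_{m+1}-\underline{\alpha}\cdot\underline{\sigma},\ \sum_{i=1}^r\alpha_i+1)$ as follows. Set $h_{\underline{0}}=g_{m+1}$. For $\underline{\alpha}\ne\underline{0}$, choose any $i$ such that $\alpha_i>0$, and assume $h_{(\alpha_1,\dots,\alpha_i-1,\dots,\alpha_s)}$ has been constructed. Write $$h_{(\alpha_1,\dots,\alpha_i-1,\dots,\alpha_s)}=a_1p^i_1+\cdots+a_{m+1}p^i_{m+1}$$ for some (bihomogeneous) $a_1,\dots,a_{m+1}\in S$ (this is possible since the $x$-degree of $h_{(\alpha_1,\dots,\alpha_i-1,\dots,\alpha_s)}$ is at least $d_m+\sigma_i$), and set $h_{\underline{\alpha}}=a_1q^i_1+\cdots+a_{m+1}q^i_{m+1}$. Then the images of the $h_{\underline{\alpha}}$ in $\mathcal{R}(E)$ are uniquely determined (independent of the choices made), and they form the $x$-degree $\ge d_m$ part of a minimal generating set of $\mathcal{K}_{m+1}\mathcal{R}(E)$.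
   Context: Let $\Bbbk$ be a field, $R=\Bbbk[x_0,x_1]$ with the standard grading, $\mathfrak{m}=(x_0,x_1)$, $\mathbb{N}=\{0,1,2,\dots\}$. For a finitely generated $R$-module $E$, the Rees algebra $\mathcal{R}(E)$ is the symmetric algebra of $E$ modulo its $R$-torsion. Let $I\subset R$ be a height two ideal minimally generated by $n$ forms $f_1,\dots,f_n$ of degree $d$, with graded free (Hilbert-Burch) resolution $0\to\bigoplus_{i=1}^{n-1}R(-d_i)\xrightarrow{\varphi}R^n\to I(d)\to0$, $1\le d_1\le\cdots\le d_{n-1}$. Let $S=R[T_1,\dots,T_n]$, bigraded by $\deg x_i=(1,0)$, $\deg T_i=(0,1)$; the first degree is called $x$-degree. Let $[g_1\ \cdots\ g_{n-1}]=[T_1\ \cdots\ T_n]\varphi$, so $g_i\in S$ has bidegree $(d_i,1)$. For $1\le m\le n-1$ let $\varphi_m$ be the matrix of the first $m$ columns of $\varphi$, $E_m=\operatorname{coker}\varphi_m$, and let $\mathcal{K}_m$ be the kernel of the surjection $S\to\mathcal{R}(E_m)$ induced by $R^n\to E_m$. Fix $m$; set $s=n-m$, $E=E_m$ (a torsionfree module of rank $s$ generated in degree 0), $F=E^{**}$ where $-^*=\operatorname{Hom}_R(-,R)$. $F$ is graded free; fix $F\cong\bigoplus_{i=1}^sR(\sigma_i)$ with $\sigma_1\ge\cdots\ge\sigma_s\ge0$. Let $r$ be the integer with $1\le r\le s$ and $\sigma_r>0=\sigma_{r+1}=\cdots=\sigma_s$. For $\underline{\alpha}\in\mathbb{N}^s$,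 $\underline{\alpha}\cdot\underline{\sigma}=\sum_i\alpha_i\sigma_i$. Let $\xi:R^n\twoheadrightarrow E\hookrightarrow F$ be the composite map, viewed as an $s\times n$ matrix. $\mathcal{K}_{m+1}\mathcal{R}(E)$ denotes the image of $\mathcal{K}_{m+1}$ in $\mathcal{R}(E)=S/\mathcal{K}_m$. For $1\le i\le s$, let $\xi_i$ be the $i$th row of $\xi$ and $\xi^i$ the matrix obtained by deleting the $i$th row from $\xi$. Let $\rho^i=[\rho^i_1\ \cdots\ \rho^i_{m+1}]$ be an $n\times(m+1)$ matrix whose (homogeneous) columns generate the kernel of $\xi^i$ (a free module of rank $m+1$). Set $p^i_j=\xi_i\rho^i_j\in R$ and $q^i_j=[T_1\ \cdots\ T_n]\rho^i_j\in S$. *)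

theory Defs
  imports
    "HOL-Algebra.QuotRing"
    "HOL-Algebra.Module"
    "HOL-Library.Poly_Mapping"
    "HOL-Library.Extended_Nat"
    "HOL-Analysis.Finite_Cartesian_Product"
begin


section \<open>Polynomial rings\<close>

text \<open>
  Polynomials over \<open>'a\<close> in variables indexed by \<open>'v\<close>: finitely supported maps from
  exponents to coefficients, with the ring structure of \<^theory>\<open>HOL-Library.Poly_Mapping\<close>.
  The ring \<open>R = k[x0,x1]\<close> is \<open>(2,'k) mpol\<close> and \<open>S = R[T_1,...,T_n]\<close> is
  \<open>('n,(2,'k) mpol) mpol\<close>, with \<open>n = CARD('n)\<close>.
\<close>

type_synonym ('v, 'a) mpol = "('v \<Rightarrow>\<^sub>0 nat) \<Rightarrow>\<^sub>0 'a"

definition pvar :: "'v \<Rightarrow> ('v, 'a::comm_ring_1) mpol" where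
  "pvar v = Poly_Mapping.single (Poly_Mapping.single v 1) 1"

definition pconst :: "'a::comm_ring_1 \<Rightarrow> ('v, 'a) mpol" where
  "pconst c = Poly_Mapping.single 0 c"

definition psubst :: "('v \<Rightarrow> ('w, 'a::comm_ring_1) mpol) \<Rightarrow> ('v, 'a) mpol \<Rightarrow> ('w, 'a) mpol" where
  "psubst b F = (\<Sum>t\<in>Poly_Mapping.keys F. pconst (Poly_Mapping.lookup F t) *
     (\<Prod>v\<in>Poly_Mapping.keys t. b v ^ Poly_Mapping.lookup t v))"

text \<open>The subring of polynomials that involve only variables from \<open>V\<close>.\<close>

definition poly_ring :: "'v set \<Rightarrow> ('v, 'a::comm_ring_1) mpol ring" where
  "poly_ring V = \<lparr>carrier = {F. \<forall>t\<in>Poly_Mapping.keys F. Poly_Mapping.keys t \<subseteq> V},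
     monoid.mult = (*), one = 1, zero = 0, add = (+)\<rparr>"

definition mdeg :: "('v \<Rightarrow>\<^sub>0 nat) \<Rightarrow> nat" where
  "mdeg t = (\<Sum>v\<in>Poly_Mapping.keys t. Poly_Mapping.lookup t v)"

text \<open>Degrees are integers, so that \<open>forms a = {0}\<close> for negative \<open>a\<close>.\<close>

definition forms :: "int \<Rightarrow> ('v, 'a::zero) mpol set" where
  "forms a = {F. \<forall>t\<in>Poly_Mapping.keys F. int (mdeg t) = a}"

definition biforms :: "int \<Rightarrow> nat \<Rightarrow> ('w, ('v, 'a::zero) mpol) mpol set" where
  "biforms a b = {F. \<forall>t\<in>Poly_Mapping.keys F. mdeg t = b \<and> Poly_Mapping.lookup F t \<in> forms a}"

section \<open>Height and minimal generating sets of ideals\<close>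

definition prime_height :: "('a, 'b) ring_scheme \<Rightarrow> 'a set \<Rightarrow> enat" where
  "prime_height A P = Sup {enat k |k. \<exists>C. (\<forall>i\<le>k. primeideal (C i) A) \<and>
     (\<forall>i<k. C i \<subset> C (Suc i)) \<and> C k = P}"

definition ideal_height :: "('a, 'b) ring_scheme \<Rightarrow> 'a set \<Rightarrow> enat" where
  "ideal_height A I = Inf {prime_height A P |P. primeideal P A \<and> I \<subseteq> P}"

definition minimal_generating_set :: "('a, 'b) ring_scheme \<Rightarrow> 'a set \<Rightarrow> 'a set \<Rightarrow> bool" where
  "minimal_generating_set A I G \<longleftrightarrow>
     G \<subseteq> carrier A \<and> Idl\<^bsub>A\<^esub> G = I \<and> (\<forall>H. H \<subset> G \<longrightarrow> Idl\<^bsub>A\<^esub> H \<noteq> I)"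

section \<open>Modules\<close>

text \<open>
  The fields \<^const>\<open>monoid.mult\<close> and \<^const>\<open>one\<close> of a module record play no role; they are
  left undefined where the module is not itself a ring.
\<close>

definition vec_module :: "('a::comm_ring_1, 'a ^ 'n) module" where
  "vec_module = \<lparr>carrier = UNIV, monoid.mult = undefined, one = undefined,
     zero = 0, add = (+), smult = (*s)\<rparr>"

definition free_module :: "nat \<Rightarrow> ('a::comm_ring_1, nat \<Rightarrow> 'a) module" where
  "free_module s = \<lparr>carrier = {1..s} \<rightarrow>\<^sub>E UNIV, monoid.mult = undefined, one = undefined,
     zero = (\<lambda>i\<in>{1..s}. 0), add = (\<lambda>u v. \<lambda>i\<in>{1..s}. u i + v i),
     smult = (\<lambda>c u. \<lambda>i\<in>{1..s}. c * u i)\<rparr>"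

definition quot_module :: "('a, 'b) module \<Rightarrow> 'b set \<Rightarrow> ('a, 'b set) module" where
  "quot_module M N = \<lparr>carrier = a_rcosets\<^bsub>M\<^esub> N, monoid.mult = undefined, one = undefined,
     zero = N, add = set_add M,
     smult = (\<lambda>c X. \<Union>x\<in>X. N +>\<^bsub>M\<^esub> (c \<odot>\<^bsub>M\<^esub> x))\<rparr>"

definition linear_maps :: "'a ring \<Rightarrow> ('a, 'b) module \<Rightarrow> ('a, 'c) module \<Rightarrow> ('b \<Rightarrow> 'c) set" where
  "linear_maps A M N = {\<psi> \<in> carrier M \<rightarrow>\<^sub>E carrier N.
     (\<forall>x\<in>carrier M. \<forall>y\<in>carrier M. \<psi> (x \<oplus>\<^bsub>M\<^esub> y) = \<psi> x \<oplus>\<^bsub>N\<^esub> \<psi> y) \<and>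
     (\<forall>c\<in>carrier A. \<forall>x\<in>carrier M. \<psi> (c \<odot>\<^bsub>M\<^esub> x) = c \<odot>\<^bsub>N\<^esub> \<psi> x)}"

definition self_module :: "'a ring \<Rightarrow> ('a, 'a) module" where
  "self_module A = ring.extend A \<lparr>smult = monoid.mult A\<rparr>"

definition dual_module :: "'a ring \<Rightarrow> ('a, 'b) module \<Rightarrow> ('a, 'b \<Rightarrow> 'a) module" where
  "dual_module A M = \<lparr>carrier = linear_maps A M (self_module A),
     monoid.mult = undefined, one = undefined,
     zero = (\<lambda>x\<in>carrier M. \<zero>\<^bsub>A\<^esub>),
     add = (\<lambda>\<psi> \<eta>. \<lambda>x\<in>carrier M. \<psi> x \<oplus>\<^bsub>A\<^esub> \<eta> x),
     smult = (\<lambda>c \<psi>. \<lambda>x\<in>carrier M. c \<otimes>\<^bsub>A\<^esub> \<psi> x)\<rparr>"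

definition bidual_map :: "'a ring \<Rightarrow> ('a, 'b) module \<Rightarrow> 'b \<Rightarrow> ('b \<Rightarrow> 'a) \<Rightarrow> 'a" where
  "bidual_map A M x = (\<lambda>\<psi>\<in>carrier (dual_module A M). \<psi> x)"

text \<open>
  A grading of a module is given by its graded pieces \<open>gr :: int \<Rightarrow> 'b set\<close>.  The degree \<open>a\<close>
  piece of the dual consists of the linear forms that raise degrees by \<open>a\<close>, and
  \<open>shift_grading s \<sigma>\<close> is the grading of the direct sum of the \<open>R(\<sigma> i)\<close>, \<open>1 \<le> i \<le> s\<close>.
\<close>

definition vec_grading :: "int \<Rightarrow> (('v, 'k::comm_ring_1) mpol ^ 'n) set" where
  "vec_grading a = {w. \<forall>j. w $ j \<in> forms a}"

definition quot_grading :: "('a, 'b) module \<Rightarrow> 'b set \<Rightarrow> (int \<Rightarrow> 'b set) \<Rightarrow> int \<Rightarrow> 'b set set" where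
  "quot_grading M N gr a = (\<lambda>x. N +>\<^bsub>M\<^esub> x) ` gr a"

definition dual_grading ::
  "(('v, 'k::comm_ring_1) mpol, 'b) module \<Rightarrow> (int \<Rightarrow> 'b set) \<Rightarrow> int \<Rightarrow> ('b \<Rightarrow> ('v, 'k) mpol) set" where
  "dual_grading M gr a = {\<psi> \<in> carrier (dual_module (poly_ring UNIV) M).
     \<forall>e. \<forall>x\<in>gr e. \<psi> x \<in> forms (e + a)}"

definition shift_grading ::
  "nat \<Rightarrow> (nat \<Rightarrow> nat) \<Rightarrow> int \<Rightarrow> (nat \<Rightarrow> ('v, 'k::comm_ring_1) mpol) set" where
  "shift_grading s \<sigma> a = {u \<in> {1..s} \<rightarrow>\<^sub>E UNIV. \<forall>i\<in>{1..s}. u i \<in> forms (a + int (\<sigma> i))}"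

definition graded_iso :: "'a ring \<Rightarrow> ('a, 'b) module \<Rightarrow> (int \<Rightarrow> 'b set) \<Rightarrow>
    ('a, 'c) module \<Rightarrow> (int \<Rightarrow> 'c set) \<Rightarrow> ('b \<Rightarrow> 'c) \<Rightarrow> bool" where
  "graded_iso A M gM N gN \<Theta> \<longleftrightarrow> \<Theta> \<in> linear_maps A M N \<and>
     bij_betw \<Theta> (carrier M) (carrier N) \<and> (\<forall>a. \<Theta> ` gM a = gN a)"

section \<open>Symmetric algebra and Rees algebra\<close>

text \<open>
  The symmetric algebra of a module: one variable for each element of the module, modulo the
  relations that make the map from the module to the algebra linear.
\<close>

definition sym_relations :: "('a::comm_ring_1, 'b) module \<Rightarrow> ('b, 'a) mpol set" where
  "sym_relations M =
     {pvar (x \<oplus>\<^bsub>M\<^esub> y) - pvar x - pvar y |x y. x \<in> carrier M \<and> y \<in> carrier M} \<union>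
     {pvar (c \<odot>\<^bsub>M\<^esub> x) - pconst c * pvar x |c x. x \<in> carrier M}"

definition sym_ideal :: "('a::comm_ring_1, 'b) module \<Rightarrow> ('b, 'a) mpol set" where
  "sym_ideal M = Idl\<^bsub>poly_ring (carrier M)\<^esub> (sym_relations M)"

definition Sym :: "('a::comm_ring_1, 'b) module \<Rightarrow> ('b, 'a) mpol set ring" where
  "Sym M = poly_ring (carrier M) Quot sym_ideal M"

definition sym_class :: "('a::comm_ring_1, 'b) module \<Rightarrow> ('b, 'a) mpol \<Rightarrow> ('b, 'a) mpol set" where
  "sym_class M F = sym_ideal M +>\<^bsub>poly_ring (carrier M)\<^esub> F"

text \<open>Torsion with respect to the ring of scalars, which will be the domain \<open>R\<close>.\<close>

definition sym_torsion :: "('a::comm_ring_1, 'b) module \<Rightarrow> ('b, 'a) mpol set set" where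
  "sym_torsion M = {y \<in> carrier (Sym M).
     \<exists>c. c \<noteq> 0 \<and> sym_class M (pconst c) \<otimes>\<^bsub>Sym M\<^esub> y = \<zero>\<^bsub>Sym M\<^esub>}"

definition Rees :: "('a::comm_ring_1, 'b) module \<Rightarrow> ('b, 'a) mpol set set ring" where
  "Rees M = Sym M Quot sym_torsion M"

section \<open>The modules \<open>E\<^sub>m\<close> and the ideals \<open>\<K>\<^sub>m\<close>\<close>

text \<open>
  A matrix with \<open>n\<close> rows is given by its columns \<open>\<phi> 1, \<phi> 2, \<dots>\<close>, vectors in \<open>R ^ 'n\<close>.
\<close>

definition colspan :: "(nat \<Rightarrow> 'a::comm_ring_1 ^ 'n) \<Rightarrow> nat \<Rightarrow> ('a ^ 'n) set" where
  "colspan \<phi> m = {\<Sum>i=1..m. c i *s \<phi> i |c. True}"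

definition coker :: "(nat \<Rightarrow> 'a::comm_ring_1 ^ 'n) \<Rightarrow> nat \<Rightarrow> ('a, ('a ^ 'n) set) module" where
  "coker \<phi> m = quot_module vec_module (colspan \<phi> m)"

definition coker_class :: "(nat \<Rightarrow> 'a::comm_ring_1 ^ 'n) \<Rightarrow> nat \<Rightarrow> 'a ^ 'n \<Rightarrow> ('a ^ 'n) set" where
  "coker_class \<phi> m v = colspan \<phi> m +>\<^bsub>vec_module\<^esub> v"

definition coker_grading ::
  "(nat \<Rightarrow> ('v, 'k::comm_ring_1) mpol ^ 'n) \<Rightarrow> nat \<Rightarrow> int \<Rightarrow> (('v, 'k) mpol ^ 'n) set set" where
  "coker_grading \<phi> m = quot_grading vec_module (colspan \<phi> m) vec_grading"

definition rees_map :: "(nat \<Rightarrow> 'a::comm_ring_1 ^ 'n) \<Rightarrow> nat \<Rightarrow> ('n, 'a) mpol \<Rightarrow>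
    (('a ^ 'n) set, 'a) mpol set set" where
  "rees_map \<phi> m F = sym_torsion (coker \<phi> m) +>\<^bsub>Sym (coker \<phi> m)\<^esub>
     sym_class (coker \<phi> m) (psubst (\<lambda>j. pvar (coker_class \<phi> m (axis j 1))) F)"

definition reesK :: "(nat \<Rightarrow> 'a::comm_ring_1 ^ 'n) \<Rightarrow> nat \<Rightarrow> ('n, 'a) mpol set" where
  "reesK \<phi> m = a_kernel (poly_ring UNIV) (Rees (coker \<phi> m)) (rees_map \<phi> m)"

definition dotT :: "'a::comm_ring_1 ^ 'n \<Rightarrow> ('n, 'a) mpol" where
  "dotT v = (\<Sum>j\<in>UNIV. pvar j * pconst (v $ j))"

section \<open>The double dual of \<open>E\<^sub>m\<close>\<close>

definition double_dual :: "(nat \<Rightarrow> ('v, 'k::comm_ring_1) mpol ^ 'n) \<Rightarrow> nat \<Rightarrow>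
    (('v, 'k) mpol, ((('v, 'k) mpol ^ 'n) set \<Rightarrow> ('v, 'k) mpol) \<Rightarrow> ('v, 'k) mpol) module" where
  "double_dual \<phi> m =
     dual_module (poly_ring UNIV) (dual_module (poly_ring UNIV) (coker \<phi> m))"

definition double_dual_grading :: "(nat \<Rightarrow> ('v, 'k::comm_ring_1) mpol ^ 'n) \<Rightarrow> nat \<Rightarrow>
    int \<Rightarrow> (((('v, 'k) mpol ^ 'n) set \<Rightarrow> ('v, 'k) mpol) \<Rightarrow> ('v, 'k) mpol) set" where
  "double_dual_grading \<phi> m =
     dual_grading (dual_module (poly_ring UNIV) (coker \<phi> m))
       (dual_grading (coker \<phi> m) (coker_grading \<phi> m))"

text \<open>
  The matrix of the composite of \<open>R\<^sup>n \<rightarrow> E \<rightarrow> E\<^sup>*\<^sup>*\<close> with coordinates \<open>\<Theta>\<close> on the double dual;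
  \<open>xi_row \<phi> m \<Theta> i\<close> is its row \<open>i\<close>.
\<close>

definition xi_row :: "(nat \<Rightarrow> ('v, 'k::comm_ring_1) mpol ^ 'n) \<Rightarrow> nat \<Rightarrow>
    ((((('v, 'k) mpol ^ 'n) set \<Rightarrow> ('v, 'k) mpol) \<Rightarrow> ('v, 'k) mpol) \<Rightarrow> nat \<Rightarrow> ('v, 'k) mpol) \<Rightarrow>
    nat \<Rightarrow> ('v, 'k) mpol ^ 'n" where
  "xi_row \<phi> m \<Theta> i = (\<chi> j. \<Theta> (bidual_map (poly_ring UNIV) (coker \<phi> m)
     (coker_class \<phi> m (axis j 1))) i)"

definition row_times :: "'a::comm_ring_1 ^ 'n \<Rightarrow> 'a ^ 'n \<Rightarrow> 'a" where
  "row_times u v = (\<Sum>k\<in>UNIV. u $ k * v $ k)"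

section \<open>The recursive construction\<close>

text \<open>A multi-index in \<open>\<nat>\<^sup>s\<close> is a function that vanishes outside \<open>{1..s}\<close>.\<close>

definition weight :: "nat \<Rightarrow> (nat \<Rightarrow> nat) \<Rightarrow> (nat \<Rightarrow> nat) \<Rightarrow> nat" where
  "weight s \<sigma> \<alpha> = (\<Sum>i=1..s. \<alpha> i * \<sigma> i)"

definition multi_indices :: "nat \<Rightarrow> nat \<Rightarrow> (nat \<Rightarrow> nat) \<Rightarrow> nat \<Rightarrow> (nat \<Rightarrow> nat) set" where
  "multi_indices s r \<sigma> D = {\<alpha>. (\<forall>i. i \<notin> {1..s} \<longrightarrow> \<alpha> i = 0) \<and>
     (\<forall>i\<in>{r+1..s}. \<alpha> i = 0) \<and> weight s \<sigma> \<alpha> \<le> D}"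

text \<open>
  The ways to write a form \<open>h\<close> of bidegree \<open>(D,b)\<close> as a combination of \<open>p 1, \<dots>, p M\<close> (of degrees
  \<open>c 1, \<dots>, c M\<close>), with bihomogeneous coefficients such that every summand has bidegree \<open>(D,b)\<close>.
\<close>

definition decompositions :: "int \<Rightarrow> nat \<Rightarrow> nat \<Rightarrow> (nat \<Rightarrow> nat) \<Rightarrow> (nat \<Rightarrow> ('v, 'k::comm_ring_1) mpol) \<Rightarrow>
    ('w, ('v, 'k) mpol) mpol \<Rightarrow> (nat \<Rightarrow> ('w, ('v, 'k) mpol) mpol) set" where
  "decompositions D b M c p h = {a. (\<forall>j\<in>{1..M}. a j \<in> biforms (D - int (c j)) b) \<and>
     h = (\<Sum>j=1..M. a j * pconst (p j))}"

text \<open>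
  \<open>constructed \<dots> \<alpha> h\<close> holds if some sequence of choices in the recursion leads to \<open>h\<close> as the
  form attached to \<open>\<alpha>\<close>.  Here \<open>X\<close> is the set of admissible multi-indices, \<open>D\<close> the \<open>x\<close>-degree of the
  initial form \<open>h0\<close>, and \<open>c i j\<close> is the degree of \<open>p i j\<close>.
\<close>

inductive constructed :: "(nat \<Rightarrow> nat) set \<Rightarrow> nat \<Rightarrow> (nat \<Rightarrow> nat) \<Rightarrow> nat \<Rightarrow> nat \<Rightarrow> (nat \<Rightarrow> nat \<Rightarrow> nat) \<Rightarrow>
    (nat \<Rightarrow> nat \<Rightarrow> ('v, 'k::comm_ring_1) mpol) \<Rightarrow> (nat \<Rightarrow> nat \<Rightarrow> ('w, ('v, 'k) mpol) mpol) \<Rightarrow>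
    ('w, ('v, 'k) mpol) mpol \<Rightarrow> (nat \<Rightarrow> nat) \<Rightarrow> ('w, ('v, 'k) mpol) mpol \<Rightarrow> bool"
  for X s \<sigma> D M c p q h0 where
  initial: "constructed X s \<sigma> D M c p q h0 (\<lambda>_. 0) h0"
| step: "\<lbrakk>\<alpha> \<in> X; i \<in> {1..s}; \<alpha> i > 0;
     constructed X s \<sigma> D M c p q h0 (\<alpha>(i := \<alpha> i - 1)) h;
     a \<in> decompositions (int D - int (weight s \<sigma> (\<alpha>(i := \<alpha> i - 1))))
       ((\<Sum>l=1..s. (\<alpha>(i := \<alpha> i - 1)) l) + 1) M (c i) (p i) h\<rbrakk>
   \<Longrightarrow> constructed X s \<sigma> D M c p q h0 \<alpha> (\<Sum>j=1..M. a j * q i j)"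

end

theory Submission
  imports Defs "HOL-Computational_Algebra.Polynomial_Factorial" "HOL-Analysis.Cartesian_Space"
begin

text \<open>
  Let \<open>A = R[t\<^sub>1, \<dots>, t\<^sub>s]\<close> be the symmetric algebra of \<open>F = E\<^sup>*\<^sup>*\<close>, in which \<open>t\<^sub>l\<close> has bidegree \<open>(-\<sigma>\<^sub>l, 1)\<close>,
  and let \<open>\<psi> : S \<rightarrow> A\<close> send \<open>T\<^sub>j\<close> to \<open>\<Sum>\<^sub>l \<xi>\<^sub>l\<^sub>j t\<^sub>l\<close>.  The kernel of \<open>\<psi>\<close> is \<open>\<K>\<^sub>m\<close> (\<open>\<psi>_eq_0_iff\<close>), so \<open>\<psi>\<close> identifies
  \<open>\<R>(E)\<close> with a subring of \<open>A\<close>.  Put \<open>\<gamma> = \<psi>(g\<^sub>m\<^sub>+\<^sub>1)\<close>, a linear form.  Since the columns of \<open>\<rho>\<^sup>i\<close> are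
  annihilated by all rows of \<open>\<xi>\<close> but the \<open>i\<close>-th, \<open>\<psi>\<close> maps \<open>q\<^sup>i\<^sub>j\<close> to \<open>p\<^sup>i\<^sub>j t\<^sub>i\<close>.  Each step of the recursion is
  therefore multiplication by a variable: whatever the choices, \<open>\<psi>(h\<^sub>\<alpha>) = \<gamma> t\<^sup>\<alpha>\<close>
  (\<open>constructed_properties\<close>).

  The other claims describe \<open>\<K>\<^sub>m\<^sub>+\<^sub>1 \<R>(E)\<close> inside \<open>A\<close> in high \<open>x\<close>-degrees.

  \<^item> \<open>F/E\<close> vanishes in degrees \<open>\<ge> d\<^sub>m - 1\<close> (\<open>high_degree_in_module\<close>).  It is the first local cohomology of
    \<open>E\<close>, which embeds into the second local cohomology of \<open>\<Oplus>\<^sub>i\<^sub>\<le>\<^sub>m R(-d\<^sub>i)\<close>.  Consequently the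
    decompositions demanded by the recursion exist (\<open>scalar_decomposition\<close>), and \<open>\<R>(E)\<close> agrees with
    \<open>A\<close> in \<open>x\<close>-degrees \<open>\<ge> d\<^sub>m - 1\<close> (\<open>high_degree_in_range\<close>).

  \<^item> \<open>\<gamma>\<close> is primitive, because its coordinates generate an ideal that contains powers of both
    variables; so \<open>\<K>\<^sub>m\<^sub>+\<^sub>1 \<R>(E) = \<gamma> A \<inter> \<R>(E)\<close> (\<open>reesK_Suc_iff\<close>).

  \<^item> In \<open>x\<close>-degrees \<open>\<ge> d\<^sub>m\<close>, and modulo multiples by elements of positive degree, \<open>\<gamma> A\<close> is spanned over the
    field by the \<open>\<gamma> t\<^sup>\<alpha>\<close> with \<open>\<alpha>\<close> supported in \<open>{1..r}\<close>: scalars of positive degree split off, and a variable of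
    degree zero is a generator of \<open>E\<close> up to the other variables (\<open>high_degree_lift\<close>).  These
    elements are independent because all generators of \<open>E\<close> vanish in \<open>k[t\<^sub>1, \<dots>, t\<^sub>r]\<close>
    (\<open>independent_modulo_J\<close>).  By the graded Nakayama lemma they extend to a minimal generating set
    (\<open>minimal_generators_of_high_degree\<close>).

  All of this rests on a common power \<open>x\<^sup>K\<close> of each variable that multiplies \<open>F\<close> into \<open>E\<close>.  As \<open>I\<close> has
  height two it contains powers of both variables (\<open>variable_power_in_height_two_ideal\<close>), and an
  element of \<open>I\<close> splits the resolution (\<open>splitting\<close>), which yields the multiplication into \<open>E\<close>
  (\<open>ideal_times_double_dual\<close>) and a functional with value \<open>x\<^sup>K\<close> at the column \<open>\<phi>\<^sub>m\<^sub>+\<^sub>1\<close>.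
\<close>

section \<open>Polynomial arithmetic\<close>

alias lookup = Poly_Mapping.lookup
alias keys = Poly_Mapping.keys
alias single = Poly_Mapping.single

text \<open>Submodules of the ring over itself are its ideals.\<close>

interpretation idl: module "(*) :: 'a::comm_ring_1 \<Rightarrow> 'a \<Rightarrow> 'a"
  by unfold_locales (simp_all add: algebra_simps)

(* As a rewrite rule this is the reverse of associativity. *)
declare idl.scale_scale [simp del]

lemma sum_terms: "(\<Sum>t\<in>keys F. single t (lookup F t)) = F"
  by (rule poly_mapping_eqI)
    (simp add: lookup_sum lookup_single when_def sum.delta in_keys_iff)

lemma mpol_induct [case_names monom add]:
  fixes F :: "'t \<Rightarrow>\<^sub>0 'a::comm_monoid_add"
  assumes "\<And>t c. P (single t c)" "\<And>F G. P F \<Longrightarrow> P G \<Longrightarrow> P (F + G)"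
  shows "P F"
proof -
  have P0: "P 0" using assms(1)[of undefined 0] by simp
  have "P (\<Sum>t\<in>A. single t (lookup F t))" if "finite A" for A
    using that by induction (simp_all add: P0 assms)
  from this[OF finite_keys[of F]] show ?thesis by (simp add: sum_terms)
qed

lemma mpol_induct_on [consumes 1, case_names zero monom add]:
  fixes F :: "'t \<Rightarrow>\<^sub>0 'a::comm_monoid_add"
  assumes "keys F \<subseteq> A" "P 0" "\<And>t c. t \<in> A \<Longrightarrow> t \<in> keys F \<Longrightarrow> c = lookup F t \<Longrightarrow> P (single t c)"
    "\<And>F G. P F \<Longrightarrow> P G \<Longrightarrow> P (F + G)"
  shows "P F"
proof -
  have "P (\<Sum>t\<in>B. single t (lookup F t))" if "finite B" "B \<subseteq> keys F" for B
    using that assms(1) by induction (auto simp: assms(2) intro!: assms(3,4))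
  from this[OF finite_keys[of F] order_refl] show ?thesis by (simp add: sum_terms)
qed

lemma mpol_induct2 [case_names monom add]:
  fixes F :: "'t \<Rightarrow>\<^sub>0 'u \<Rightarrow>\<^sub>0 'a::comm_monoid_add"
  assumes "\<And>t u c. P (single t (single u c))" "\<And>F G. P F \<Longrightarrow> P G \<Longrightarrow> P (F + G)"
  shows "P F"
proof (induction F rule: mpol_induct)
  case (monom t c)
  show ?case
    by (induction c rule: mpol_induct) (simp_all add: assms single_add)
qed (rule assms)

lemma pconst_add: "pconst (a + b) = pconst a + pconst b"
  and pconst_mult: "pconst (a * b) = pconst a * pconst b"
  and pconst_0 [simp]: "pconst 0 = 0"
  and pconst_1 [simp]: "pconst 1 = 1"
  by (simp_all add: pconst_def single_add mult_single)

lemma pconst_sum: "pconst (sum f A) = (\<Sum>x\<in>A. pconst (f x))"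
  by (induction A rule: infinite_finite_induct) (simp_all add: pconst_add)

lemma pconst_power: "pconst (a ^ n) = pconst a ^ n"
  by (induction n) (simp_all add: pconst_mult)

lemma lookup_pconst_mult: "lookup (pconst c * F) t = c * lookup F t"
proof (induction F rule: mpol_induct)
  case (monom s d)
  then show ?case by (simp add: pconst_def mult_single lookup_single when_def)
qed (simp_all add: distrib_left lookup_add)

lemma pconst_inj: "pconst a = pconst b \<longleftrightarrow> a = b"
  by (metis lookup_single_eq pconst_def)

definition eval_monom :: "('v \<Rightarrow> 'r::comm_ring_1) \<Rightarrow> ('v \<Rightarrow>\<^sub>0 nat) \<Rightarrow> 'r" where
  "eval_monom b t = (\<Prod>v\<in>keys t. b v ^ lookup t v)"

lemma eval_monom_superset:
  "finite A \<Longrightarrow> keys t \<subseteq> A \<Longrightarrow> eval_monom b t = (\<Prod>v\<in>A. b v ^ lookup t v)"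
  unfolding eval_monom_def by (rule prod.mono_neutral_left) (auto simp: in_keys_iff)

lemma eval_monom_0 [simp]: "eval_monom b 0 = 1"
  by (simp add: eval_monom_def)

lemma eval_monom_add: "eval_monom b (t + u) = eval_monom b t * eval_monom b u"
  using keys_add[of t u]
  by (subst (1 2 3) eval_monom_superset[where A = "keys t \<union> keys u"])
    (auto simp: lookup_add power_add prod.distrib)

lemma eval_monom_single: "eval_monom b (single v n) = b v ^ n"
  by (cases "n = 0") (simp_all add: eval_monom_def)

lemma keys_add_nat: "keys (t + u :: 'v \<Rightarrow>\<^sub>0 nat) = keys t \<union> keys u"
  by (auto simp: in_keys_iff lookup_add)

lemma psubst_alt: "psubst b F = (\<Sum>t\<in>keys F. pconst (lookup F t) * eval_monom b t)"
  by (simp add: psubst_def eval_monom_def)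

lemma psubst_superset:
  "finite A \<Longrightarrow> keys F \<subseteq> A \<Longrightarrow> psubst b F = (\<Sum>t\<in>A. pconst (lookup F t) * eval_monom b t)"
  unfolding psubst_alt by (rule sum.mono_neutral_left) (auto simp: in_keys_iff)

lemma psubst_0 [simp]: "psubst b 0 = 0"
  by (simp add: psubst_def)

lemma psubst_single: "psubst b (single t c) = pconst c * eval_monom b t"
  by (cases "c = 0") (simp_all add: psubst_alt)

lemma psubst_add: "psubst b (F + G) = psubst b F + psubst b G"
  using keys_add[of F G]
  by (subst (1 2 3) psubst_superset[where A = "keys F \<union> keys G"])
    (auto simp: lookup_add pconst_add distrib_right sum.distrib)

lemma psubst_mult: "psubst b (F * G) = psubst b F * psubst b G"
proof (induction F rule: mpol_induct)
  case (monom t c)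
  show ?case
  proof (induction G rule: mpol_induct)
    case (monom u d)
    then show ?case
      by (simp only: mult_single psubst_single eval_monom_add pconst_mult mult_ac)
  qed (simp add: psubst_add distrib_left)
qed (simp add: psubst_add distrib_right)

lemma psubst_pconst [simp]: "psubst b (pconst c) = pconst c"
  by (subst (1) pconst_def) (simp add: psubst_single)

lemma psubst_pvar [simp]: "psubst b (pvar v) = b v"
  by (simp add: pvar_def psubst_single eval_monom_single)

lemma psubst_1 [simp]: "psubst b 1 = 1"
  using psubst_pconst[of b 1] by simp

lemma psubst_uminus: "psubst b (- F) = - psubst b F"
  by (metis add.inverse_unique add.right_inverse psubst_0 psubst_add)

lemma psubst_diff: "psubst b (F - G) = psubst b F - psubst b G"
  using psubst_add[of b F "- G"] by (simp add: psubst_uminus)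

lemma psubst_sum: "psubst b (sum f A) = (\<Sum>x\<in>A. psubst b (f x))"
  by (induction A rule: infinite_finite_induct) (simp_all add: psubst_add)

lemma psubst_power: "psubst b (F ^ n) = psubst b F ^ n"
  by (induction n) (simp_all add: psubst_mult)

lemma pvar_power: "pvar v ^ n = single (single v n) 1"
  by (induction n) (simp_all add: pvar_def mult_single flip: single_add)

lemma eval_monom_pvar: "eval_monom pvar t = single t (1::'a::comm_ring_1)"
proof -
  have "(\<Prod>v\<in>A. single (single v (lookup t v)) 1) = single (\<Sum>v\<in>A. single v (lookup t v)) (1::'a)"
    if "finite A" for A
    using that by induction (simp_all add: mult_single)
  from this[OF finite_keys[of t]] show ?thesis
    by (simp add: eval_monom_def pvar_power sum_terms)
qed

lemma single_eq_pconst_eval: "single t c = pconst c * eval_monom pvar t"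
  by (simp add: eval_monom_pvar pconst_def mult_single)

lemma psubst_pvar_id [simp]: "psubst pvar F = F"
proof (induction F rule: mpol_induct)
  case (monom t c)
  show ?case by (subst psubst_single) (rule single_eq_pconst_eval[symmetric])
qed (simp add: psubst_add)

lemma subspace_eval_monom_diff:
  assumes J: "idl.subspace J" and b: "\<And>v. v \<in> keys t \<Longrightarrow> b v - b' v \<in> J"
  shows "eval_monom b t - eval_monom b' t \<in> J"
proof -
  have pow: "x ^ n - y ^ n \<in> J" if "x - y \<in> J" for x y and n :: nat
    using power_diff_sumr2[of x n y] idl.subspace_scale[OF J that, of "\<Sum>i<n. y ^ (n - Suc i) * x ^ i"]
    by (simp add: mult.commute)
  have "finite A \<Longrightarrow> A \<subseteq> keys t \<Longrightarrow>
    (\<Prod>v\<in>A. b v ^ lookup t v) - (\<Prod>v\<in>A. b' v ^ lookup t v) \<in> J" for A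
  proof (induction A rule: finite_induct)
    case empty
    then show ?case by (simp add: idl.subspace_0[OF J])
  next
    case (insert v A)
    define x y X Y where "x = b v ^ lookup t v" and "y = b' v ^ lookup t v"
      and "X = (\<Prod>v\<in>A. b v ^ lookup t v)" and "Y = (\<Prod>v\<in>A. b' v ^ lookup t v)"
    have "x * (X - Y) + Y * (x - y) \<in> J"
      using insert by (intro idl.subspace_add[OF J] idl.subspace_scale[OF J])
        (auto simp: x_def y_def X_def Y_def intro!: pow b)
    moreover have "x * (X - Y) + Y * (x - y) = x * X - y * Y" by (simp add: algebra_simps)
    ultimately show ?case
      using insert by (simp add: x_def y_def X_def Y_def)
  qed
  then show ?thesis by (simp add: eval_monom_def)
qed

text \<open>
  Monomial by monomial, the difference of two products telescopes.  The lemma turns an inverse of a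
  substitution up to an ideal into a description of its kernel.
\<close>

lemma subspace_psubst_diff:
  assumes J: "idl.subspace J" and b: "\<And>t v. t \<in> keys F \<Longrightarrow> v \<in> keys t \<Longrightarrow> b v - b' v \<in> J"
  shows "psubst b F - psubst b' F \<in> J"
proof -
  have "psubst b F - psubst b' F =
      (\<Sum>t\<in>keys F. pconst (lookup F t) * (eval_monom b t - eval_monom b' t))"
    by (simp add: psubst_alt sum_subtractf right_diff_distrib)
  also have "\<dots> \<in> J"
    by (intro idl.subspace_sum[OF J] idl.subspace_scale[OF J] subspace_eval_monom_diff[OF J] b)
  finally show ?thesis .
qed

lemma psubst_psubst: "psubst b (psubst b' F) = psubst (\<lambda>v. psubst b (b' v)) F"
proof (induction F rule: mpol_induct)
  case (monom t c)
  have "psubst b (eval_monom b' t) = eval_monom (\<lambda>v. psubst b (b' v)) t"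
  proof -
    have "finite A \<Longrightarrow> psubst b (\<Prod>v\<in>A. b' v ^ lookup t v) = (\<Prod>v\<in>A. psubst b (b' v) ^ lookup t v)" for A
      by (induction A rule: finite_induct) (simp_all add: psubst_mult psubst_power)
    then show ?thesis by (simp add: eval_monom_def)
  qed
  then show ?case by (simp add: psubst_single psubst_mult)
qed (simp add: psubst_add)

section \<open>Gradings\<close>

definition wt :: "('v \<Rightarrow> nat) \<Rightarrow> ('v \<Rightarrow>\<^sub>0 nat) \<Rightarrow> nat" where
  "wt \<sigma> t = (\<Sum>v\<in>keys t. lookup t v * \<sigma> v)"

lemma wt_superset: "finite A \<Longrightarrow> keys t \<subseteq> A \<Longrightarrow> wt \<sigma> t = (\<Sum>v\<in>A. lookup t v * \<sigma> v)"
  unfolding wt_def by (rule sum.mono_neutral_left) (auto simp: in_keys_iff)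

lemma wt_add: "wt \<sigma> (t + u) = wt \<sigma> t + wt \<sigma> u"
  by (subst (1 2 3) wt_superset[where A = "keys t \<union> keys u"])
    (auto simp: keys_add_nat lookup_add algebra_simps sum.distrib)

lemma wt_0 [simp]: "wt \<sigma> 0 = 0" by (simp add: wt_def)

lemma wt_single [simp]: "wt \<sigma> (single v n) = n * \<sigma> v"
  by (cases "n = 0") (simp_all add: wt_def)

lemma mdeg_eq_wt: "mdeg t = wt (\<lambda>_. 1) t" by (simp add: mdeg_def wt_def)

lemma mdeg_add: "mdeg (t + u) = mdeg t + mdeg u"
  and mdeg_0 [simp]: "mdeg 0 = 0"
  and mdeg_single [simp]: "mdeg (single v n) = n"
  by (simp_all add: mdeg_eq_wt wt_add)

lemma mdeg_eq_0_iff [simp]: "mdeg t = 0 \<longleftrightarrow> t = 0"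
proof
  assume "mdeg t = 0"
  then have "lookup t v = 0" for v by (auto simp: mdeg_def in_keys_iff)
  then show "t = 0" by (intro poly_mapping_eqI) simp
qed simp

lemma wt_const_0 [simp]: "wt (\<lambda>_. 0) t = 0"
  by (simp add: wt_def)

lemma split_off_variable:
  fixes t :: "'v \<Rightarrow>\<^sub>0 nat"
  assumes "v \<in> keys t"
  obtains u where "t = single v 1 + u" "keys u \<subseteq> keys t"
proof
  show t: "t = single v 1 + (t - single v 1)"
    using assms by (intro poly_mapping_eqI) (auto simp: lookup_add lookup_minus lookup_single when_def in_keys_iff)
  show "keys (t - single v 1) \<subseteq> keys t"
    by (subst (2) t) (auto simp: keys_add_nat)
qed

lemma forms_0 [simp]: "0 \<in> forms a"
  and forms_add: "F \<in> forms a \<Longrightarrow> G \<in> forms a \<Longrightarrow> F + G \<in> forms a"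
  using keys_add[of F G] by (auto simp: forms_def)

lemma forms_uminus: "F \<in> forms a \<Longrightarrow> - F \<in> forms a" for F :: "('v,'a::ab_group_add) mpol"
  by (auto simp: forms_def in_keys_iff)

lemma forms_diff: "F \<in> forms a \<Longrightarrow> G \<in> forms a \<Longrightarrow> F - G \<in> forms a" for F :: "('v,'a::ab_group_add) mpol"
  using forms_add[of F a "- G"] forms_uminus[of G a] by simp

lemma forms_sum: "(\<And>x. x \<in> A \<Longrightarrow> f x \<in> forms a) \<Longrightarrow> sum f A \<in> forms a"
  by (induction A rule: infinite_finite_induct) (simp_all add: forms_add)

lemma forms_mult: "F \<in> forms a \<Longrightarrow> G \<in> forms b \<Longrightarrow> F * G \<in> forms (a + b)"
  using keys_mult[of F G] by (fastforce simp: forms_def mdeg_add)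

lemma forms_mult': "F \<in> forms a \<Longrightarrow> G \<in> forms b \<Longrightarrow> c = a + b \<Longrightarrow> F * G \<in> forms c"
  using forms_mult by blast

lemma forms_1 [simp]: "(1 :: ('v,'a::comm_ring_1) mpol) \<in> forms 0"
  by (simp add: forms_def)

lemma forms_pvar: "pvar v \<in> forms 1"
  by (simp add: forms_def pvar_def)

lemma forms_pvar_power: "pvar v ^ n \<in> forms (int n)"
  by (simp add: forms_def pvar_power)

lemma forms_single: "single t c \<in> forms a" if "int (mdeg t) = a"
  using that by (simp add: forms_def)

lemma forms_neg: "F \<in> forms a \<Longrightarrow> a < 0 \<Longrightarrow> F = 0"
  by (rule ccontr) (use keys_eq_empty in \<open>fastforce simp: forms_def\<close>)

lemma forms_zero_pconst: "F \<in> forms 0 \<Longrightarrow> F = pconst (lookup F 0)"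
  unfolding pconst_def
  by (rule poly_mapping_eqI) (auto simp: forms_def lookup_single when_def in_keys_iff)

definition hcomp :: "int \<Rightarrow> ('v, 'a::comm_ring_1) mpol \<Rightarrow> ('v, 'a) mpol" where
  "hcomp a F = (\<Sum>t | t \<in> keys F \<and> int (mdeg t) = a. single t (lookup F t))"

lemma lookup_hcomp: "lookup (hcomp a F) t = (if int (mdeg t) = a then lookup F t else 0)"
  unfolding hcomp_def
  by (simp add: lookup_sum lookup_single when_def in_keys_iff)

lemma hcomp_add: "hcomp a (F + G) = hcomp a F + hcomp a G"
  by (rule poly_mapping_eqI) (simp add: lookup_hcomp lookup_add)

lemma hcomp_0 [simp]: "hcomp a 0 = 0"
  by (rule poly_mapping_eqI) (simp add: lookup_hcomp)

lemma hcomp_sum: "hcomp a (sum f A) = (\<Sum>x\<in>A. hcomp a (f x))"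
  by (induction A rule: infinite_finite_induct) (simp_all add: hcomp_add)

lemma hcomp_forms: "hcomp a F \<in> forms a"
  by (auto simp: forms_def in_keys_iff lookup_hcomp split: if_splits)

lemma hcomp_of_form: "F \<in> forms b \<Longrightarrow> hcomp a F = (if a = b then F else 0)"
  by (rule poly_mapping_eqI) (auto simp: lookup_hcomp forms_def in_keys_iff)

lemma hcomp_mult: "F \<in> forms a \<Longrightarrow> hcomp c (F * G) = F * hcomp (c - a) G"
proof (induction G rule: mpol_induct)
  case (monom t d)
  have 1: "single t d \<in> forms (int (mdeg t))" by (rule forms_single) simp
  have 2: "F * single t d \<in> forms (a + int (mdeg t))" by (rule forms_mult[OF monom 1])
  show ?case using hcomp_of_form[OF 1] hcomp_of_form[OF 2] by auto
qed (simp add: hcomp_add distrib_left)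

text \<open>
  The bigrading of the symmetric algebra of \<open>\<Oplus>\<^sub>v R(\<sigma> v)\<close>, in which the variable \<open>v\<close> has bidegree
  \<open>(-\<sigma> v, 1)\<close>.  With \<open>\<sigma> = 0\<close> it is the bigrading of \<open>S\<close>.
\<close>

definition hforms :: "('v \<Rightarrow> nat) \<Rightarrow> int \<Rightarrow> nat \<Rightarrow> ('v, ('x, 'a::zero) mpol) mpol set" where
  "hforms \<sigma> a b = {F. \<forall>t\<in>keys F. mdeg t = b \<and> lookup F t \<in> forms (a + int (wt \<sigma> t))}"

lemma hforms_iff_lookup: "F \<in> hforms \<sigma> a b \<longleftrightarrow>
  (\<forall>t. (lookup F t \<noteq> 0 \<longrightarrow> mdeg t = b) \<and> lookup F t \<in> forms (a + int (wt \<sigma> t)))"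
  unfolding hforms_def by (auto simp: in_keys_iff)

lemma biforms_eq_hforms: "biforms a b = hforms (\<lambda>_. 0) a b"
  by (simp add: biforms_def hforms_def)

lemma hforms_0 [simp]: "0 \<in> hforms \<sigma> a b"
  by (simp add: hforms_def)

lemma hforms_add: "F \<in> hforms \<sigma> a b \<Longrightarrow> G \<in> hforms \<sigma> a b \<Longrightarrow> F + G \<in> hforms \<sigma> a b"
  by (simp add: hforms_iff_lookup lookup_add forms_add) (metis add.right_neutral)

lemma hforms_sum: "(\<And>x. x \<in> A \<Longrightarrow> f x \<in> hforms \<sigma> a b) \<Longrightarrow> sum f A \<in> hforms \<sigma> a b"
  by (induction A rule: infinite_finite_induct) (simp_all add: hforms_add)

lemma hforms_single:
  assumes "c \<in> forms (a + int (wt \<sigma> t))" "mdeg t = b"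
  shows "single t c \<in> hforms \<sigma> a b"
  using assms by (simp add: hforms_def)

lemma hforms_pconst: "c \<in> forms a \<Longrightarrow> pconst c \<in> hforms \<sigma> a 0"
  unfolding pconst_def by (rule hforms_single) simp_all

lemma hforms_pvar: "a = - int (\<sigma> v) \<Longrightarrow> pvar v \<in> hforms \<sigma> a 1"
  unfolding pvar_def by (rule hforms_single) simp_all

lemma hforms_mult:
  assumes F: "F \<in> hforms \<sigma> a b" and G: "G \<in> hforms \<sigma> a' b'"
  shows "F * G \<in> hforms \<sigma> (a + a') (b + b')"
proof -
  have FG: "F * G = (\<Sum>t\<in>keys F. \<Sum>u\<in>keys G. single (t + u) (lookup F t * lookup G u))"
    by (subst (1) sum_terms[of F, symmetric], subst (1) sum_terms[of G, symmetric])
      (simp add: sum_product mult_single)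
  show ?thesis
    unfolding FG using F G
    by (intro hforms_sum hforms_single)
      (auto simp: hforms_def mdeg_add wt_add intro!: forms_mult')
qed

lemma hforms_mult':
  "F \<in> hforms \<sigma> a b \<Longrightarrow> G \<in> hforms \<sigma> a' b' \<Longrightarrow> c = a + a' \<Longrightarrow> d = b + b' \<Longrightarrow> F * G \<in> hforms \<sigma> c d"
  using hforms_mult by blast

definition bicomp :: "('v \<Rightarrow> nat) \<Rightarrow> int \<Rightarrow> nat \<Rightarrow> ('v, ('x, 'a::comm_ring_1) mpol) mpol \<Rightarrow>
    ('v, ('x, 'a) mpol) mpol" where
  "bicomp \<sigma> a b F = (\<Sum>t | t \<in> keys F \<and> mdeg t = b. single t (hcomp (a + int (wt \<sigma> t)) (lookup F t)))"

lemma lookup_bicomp: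
  "lookup (bicomp \<sigma> a b F) t = (if mdeg t = b then hcomp (a + int (wt \<sigma> t)) (lookup F t) else 0)"
  unfolding bicomp_def
  by (simp add: lookup_sum lookup_single when_def in_keys_iff)

lemma bicomp_add: "bicomp \<sigma> a b (F + G) = bicomp \<sigma> a b F + bicomp \<sigma> a b G"
  by (rule poly_mapping_eqI) (simp add: lookup_bicomp lookup_add hcomp_add)

lemma bicomp_0 [simp]: "bicomp \<sigma> a b 0 = 0"
  by (rule poly_mapping_eqI) (simp add: lookup_bicomp)

lemma bicomp_hforms: "bicomp \<sigma> a b F \<in> hforms \<sigma> a b"
  by (auto simp: hforms_iff_lookup lookup_bicomp hcomp_forms)

lemma bicomp_of_hform:
  assumes "F \<in> hforms \<sigma> a b"
  shows "bicomp \<sigma> a' b' F = (if a' = a \<and> b' = b then F else 0)"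
proof (rule poly_mapping_eqI)
  fix t
  have "hcomp (a' + int (wt \<sigma> t)) (lookup F t) = (if a' = a then lookup F t else 0)"
    using assms hcomp_of_form[of "lookup F t" "a + int (wt \<sigma> t)"] by (simp add: hforms_iff_lookup)
  then show "lookup (bicomp \<sigma> a' b' F) t = lookup (if a' = a \<and> b' = b then F else 0) t"
    using assms by (auto simp: lookup_bicomp hforms_iff_lookup)
qed

lemma bicomp_diff: "bicomp \<sigma> a b (F - G) = bicomp \<sigma> a b F - bicomp \<sigma> a b G"
  using bicomp_add[of \<sigma> a b "F - G" G] by simp

lemma term_hform: "single t (single u c) \<in> hforms \<sigma> (int (mdeg u) - int (wt \<sigma> t)) (mdeg t)"
  by (rule hforms_single) (auto intro: forms_single)

text \<open>
  The case distinction is forced by subtraction on natural numbers: below \<open>b1\<close> the product has no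
  component.
\<close>

lemma bicomp_mult:
  assumes H: "H \<in> hforms \<sigma> a1 b1"
  shows "bicomp \<sigma> a b (H * F) = (if b1 \<le> b then H * bicomp \<sigma> (a - a1) (b - b1) F else 0)"
proof (induction F rule: mpol_induct2)
  case (monom t u c)
  note T = term_hform[of t u c \<sigma>]
  show ?case
    using bicomp_of_hform[OF T] bicomp_of_hform[OF hforms_mult[OF H T]] by auto
qed (auto simp: bicomp_add distrib_left)

lemma sum_bicomp: "\<exists>D. finite D \<and> F = (\<Sum>(a,b)\<in>D. bicomp \<sigma> a b F)"
proof -
  define D where "D = (\<Union>t\<in>keys F. (\<lambda>u. (int (mdeg u) - int (wt \<sigma> t), mdeg t)) ` keys (lookup F t))"
  have "lookup (lookup F t) u = lookup (lookup (\<Sum>(a,b)\<in>D. bicomp \<sigma> a b F) t) u" for t u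
  proof (cases "lookup (lookup F t) u = 0")
    case True
    have "lookup (lookup (bicomp \<sigma> a b F) t) u = 0" for a b
      using True by (simp add: lookup_bicomp lookup_hcomp)
    then show ?thesis using True by (simp add: lookup_sum case_prod_beta)
  next
    case False
    define z where "z = (int (mdeg u) - int (wt \<sigma> t), mdeg t)"
    have z: "z \<in> D"
    proof -
      have "lookup F t \<noteq> 0" using False by auto
      then show ?thesis
        unfolding D_def z_def using False by (intro UN_I[of t] imageI) (simp_all add: in_keys_iff)
    qed
    have D: "finite D" by (simp add: D_def)
    have "lookup (lookup (\<Sum>(a,b)\<in>D. bicomp \<sigma> a b F) t) u =
        (\<Sum>x\<in>D. lookup (lookup (bicomp \<sigma> (fst x) (snd x) F) t) u)"
      by (simp add: lookup_sum case_prod_beta)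
    also have "\<dots> = (\<Sum>x\<in>D. if x = z then lookup (lookup F t) u else 0)"
      by (rule sum.cong) (auto simp: lookup_bicomp lookup_hcomp z_def)
    also have "\<dots> = lookup (lookup F t) u" using z D by simp
    finally show ?thesis by simp
  qed
  then have "F = (\<Sum>(a,b)\<in>D. bicomp \<sigma> a b F)"
    by (intro poly_mapping_eqI)
  moreover have "finite D" by (simp add: D_def)
  ultimately show ?thesis by blast
qed

text \<open>
  Membership in an ideal can thus be checked on homogeneous components.
\<close>

lemma bicomp_closed:
  assumes "\<And>a b. bicomp \<sigma> a b F \<in> J" "0 \<in> J" "\<And>x y. x \<in> J \<Longrightarrow> y \<in> J \<Longrightarrow> x + y \<in> J"
  shows "F \<in> J"
proof -
  obtain D where D: "finite D" "F = (\<Sum>(a,b)\<in>D. bicomp \<sigma> a b F)"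
    using sum_bicomp by blast
  have "(\<Sum>(a,b)\<in>D. bicomp \<sigma> a b F) \<in> J"
    using D(1) by induction (auto intro: assms)
  then show ?thesis using D(2) by simp
qed

text \<open>
  The shift \<open>k b\<close> covers the substitutions that multiply every variable by a scalar of degree \<open>k\<close>.
\<close>

lemma bicomp_commute_shift:
  assumes add: "\<And>F G. \<psi> (F + G) = \<psi> F + \<psi> G"
    and hom: "\<And>a b F. F \<in> hforms \<sigma> a b \<Longrightarrow> \<psi> F \<in> hforms \<tau> (a + k * int b) b"
  shows "bicomp \<tau> (a + k * int b) b (\<psi> F) = \<psi> (bicomp \<sigma> a b F)"
proof (induction F rule: mpol_induct2)
  case (monom t u c)
  have 0: "\<psi> 0 = 0" using add[of 0 0] by simp
  note T = term_hform[of t u c \<sigma>]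
  show ?case
    using bicomp_of_hform[OF T] bicomp_of_hform[OF hom[OF T]] 0 by auto
qed (simp add: bicomp_add add)

lemma bicomp_commute:
  assumes "\<And>F G. \<psi> (F + G) = \<psi> F + \<psi> G"
    and "\<And>a b F. F \<in> hforms \<sigma> a b \<Longrightarrow> \<psi> F \<in> hforms \<tau> a b"
  shows "bicomp \<tau> a b (\<psi> F) = \<psi> (bicomp \<sigma> a b F)"
  using bicomp_commute_shift[of \<psi> \<sigma> \<tau> 0] assms by simp

section \<open>Ideals of polynomial rings\<close>

lemma poly_ring_simps [simp]:
  "carrier (poly_ring UNIV) = UNIV" "\<zero>\<^bsub>poly_ring V\<^esub> = 0" "\<one>\<^bsub>poly_ring V\<^esub> = 1"
  "x \<oplus>\<^bsub>poly_ring V\<^esub> y = x + y" "x \<otimes>\<^bsub>poly_ring V\<^esub> y = x * y"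
  by (simp_all add: poly_ring_def)

lemma ring_poly_ring [simp, intro]: "ring (poly_ring V)"
  and cring_poly_ring: "cring (poly_ring V)"
proof -
  let ?C = "carrier (poly_ring V)"
  have C: "?C = {F. \<forall>t\<in>keys F. keys t \<subseteq> V}" by (simp add: poly_ring_def)
  have add: "F + G \<in> ?C" if "F \<in> ?C" "G \<in> ?C" for F G
    using that keys_add[of F G] by (fastforce simp: C)
  have mult: "F * G \<in> ?C" if "F \<in> ?C" "G \<in> ?C" for F G
    using that keys_mult[of F G] by (fastforce simp: C keys_add_nat)
  have uminus: "- F \<in> ?C" if "F \<in> ?C" for F
    using that by (simp add: C in_keys_iff)
  have inv: "\<exists>G\<in>?C. G + F = 0" if "F \<in> ?C" for F
    using uminus[OF that] by (intro bexI[of _ "- F"]) simp_all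
  have one: "1 \<in> ?C" "0 \<in> ?C" by (auto simp: C)
  show "cring (poly_ring V)"
  proof (intro cringI abelian_groupI comm_monoidI)
    fix F assume "F \<in> ?C"
    then show "\<exists>G\<in>?C. G \<oplus>\<^bsub>poly_ring V\<^esub> F = \<zero>\<^bsub>poly_ring V\<^esub>"
      using inv by (simp add: poly_ring_def)
  qed (simp_all add: add mult one, simp_all only: ac_simps distrib_left distrib_right)
  then show "ring (poly_ring V)" by (rule cring.axioms)
qed

lemma idealI_poly_ring:
  assumes "J \<subseteq> carrier (poly_ring V)" "0 \<in> J"
    "\<And>x y. x \<in> J \<Longrightarrow> y \<in> J \<Longrightarrow> x + y \<in> J"
    "\<And>r x. r \<in> carrier (poly_ring V) \<Longrightarrow> x \<in> J \<Longrightarrow> r * x \<in> J"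
  shows "ideal J (poly_ring V)"
proof (rule idealI)
  interpret cring "poly_ring V" by (rule cring_poly_ring)
  show "x \<otimes>\<^bsub>poly_ring V\<^esub> a \<in> J" "a \<otimes>\<^bsub>poly_ring V\<^esub> x \<in> J"
    if "a \<in> J" "x \<in> carrier (poly_ring V)" for a x
    using assms(4)[OF that(2,1)] by (simp_all add: mult.commute)
  show "subgroup J (add_monoid (poly_ring V))"
  proof (rule add.subgroupI)
    fix a assume a: "a \<in> J"
    have "(\<ominus>\<^bsub>poly_ring V\<^esub> \<one>\<^bsub>poly_ring V\<^esub>) * a \<in> J"
      by (rule assms(4)[OF a_inv_closed[OF one_closed] a])
    moreover have "(\<ominus>\<^bsub>poly_ring V\<^esub> \<one>\<^bsub>poly_ring V\<^esub>) * a = \<ominus>\<^bsub>poly_ring V\<^esub> a"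
      using l_minus[OF one_closed, of a] subsetD[OF assms(1) a] by simp
    ultimately show "\<ominus>\<^bsub>poly_ring V\<^esub> a \<in> J" by simp
  qed (use assms in auto)
qed auto

lemma ideal_poly_ring_iff: "ideal J (poly_ring UNIV) \<longleftrightarrow> idl.subspace J"
proof
  assume "ideal J (poly_ring UNIV)"
  then interpret ideal J "poly_ring UNIV" .
  show "idl.subspace J"
    using additive_subgroup.a_closed[OF is_additive_subgroup] I_l_closed
      additive_subgroup.zero_closed[OF is_additive_subgroup]
    by (auto intro!: idl.subspaceI)
next
  assume J: "idl.subspace J"
  show "ideal J (poly_ring UNIV)"
    by (rule idealI_poly_ring)
      (use idl.subspace_0[OF J] idl.subspace_add[OF J] idl.subspace_scale[OF J] in auto)
qed

lemma genideal_poly_ring: "Idl\<^bsub>poly_ring UNIV\<^esub> G = idl.span G"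
proof (rule antisym)
  interpret ring "poly_ring UNIV" by (rule ring_poly_ring)
  show "Idl\<^bsub>poly_ring UNIV\<^esub> G \<subseteq> idl.span G"
    by (rule genideal_minimal) (auto simp: ideal_poly_ring_iff idl.span_base)
  have "idl.subspace (Idl\<^bsub>poly_ring UNIV\<^esub> G)"
    using genideal_ideal[of G] by (simp flip: ideal_poly_ring_iff)
  then show "idl.span G \<subseteq> Idl\<^bsub>poly_ring UNIV\<^esub> G"
    using genideal_self[of G] by (intro idl.span_minimal) auto
qed

lemma primeideal_poly_ring_iff: "primeideal P (poly_ring UNIV) \<longleftrightarrow>
  idl.subspace P \<and> P \<noteq> UNIV \<and> (\<forall>a b. a * b \<in> P \<longrightarrow> a \<in> P \<or> b \<in> P)"
proof
  assume "primeideal P (poly_ring UNIV)"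
  then interpret primeideal P "poly_ring UNIV" .
  show "idl.subspace P \<and> P \<noteq> UNIV \<and> (\<forall>a b. a * b \<in> P \<longrightarrow> a \<in> P \<or> b \<in> P)"
    using I_notcarr I_prime is_ideal by (auto simp: ideal_poly_ring_iff)
next
  assume "idl.subspace P \<and> P \<noteq> UNIV \<and> (\<forall>a b. a * b \<in> P \<longrightarrow> a \<in> P \<or> b \<in> P)"
  then show "primeideal P (poly_ring UNIV)"
    by (intro primeidealI) (auto simp: ideal_poly_ring_iff cring_poly_ring)
qed

section \<open>Ideals of height two in two variables\<close>

text \<open>
  The generator of the ideal is not a unit; if it vanishes, any polynomial divides it.  A nonconstant
  common divisor of least degree is irreducible.
\<close>

lemma proper_ideal_has_irreducible_divisor:
  fixes J :: "'k::field poly set"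
  assumes J: "idl.subspace J" and one: "1 \<notin> J"
  obtains \<pi> where "irreducible \<pi>" "\<And>a. a \<in> J \<Longrightarrow> \<pi> dvd a"
proof -
  let ?P = "\<lambda>\<pi>::'k poly. degree \<pi> > 0 \<and> (\<forall>a\<in>J. \<pi> dvd a)"
  have "\<exists>\<pi>. ?P \<pi>"
  proof (cases "J \<subseteq> {0}")
    case True
    then show ?thesis by (intro exI[of _ "[:0,1:]"]) auto
  next
    case False
    define g where "g = arg_min degree (\<lambda>g. g \<in> J \<and> g \<noteq> 0)"
    have g: "g \<in> J" "g \<noteq> 0"
      using False arg_min_natI[of "\<lambda>g. g \<in> J \<and> g \<noteq> 0" _ degree] unfolding g_def by blast+
    have min: "degree g \<le> degree h" if "h \<in> J" "h \<noteq> 0" for h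
      unfolding g_def using that by (intro arg_min_nat_le) auto
    have dvd: "g dvd a" if a: "a \<in> J" for a
    proof (rule ccontr)
      assume "\<not> g dvd a"
      then have nz: "a mod g \<noteq> 0" by auto
      have "a - (a div g) * g \<in> J"
        using a g J by (intro idl.subspace_diff idl.subspace_scale)
      then have "a mod g \<in> J" by (simp add: minus_div_mult_eq_mod)
      then show False using min[OF _ nz] degree_mod_less'[OF g(2) nz] by simp
    qed
    have "degree g > 0"
    proof (rule ccontr)
      assume "\<not> degree g > 0"
      then have "is_unit g" using g(2) by (simp add: is_unit_iff_degree)
      then obtain h where "1 = h * g" by (metis dvdE mult.commute)
      then show False using idl.subspace_scale[OF J g(1), of h] one by simp
    qed
    then show ?thesis using dvd by blast
  qed
  then obtain p0 where p0: "?P p0" by blast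
  define \<pi> where "\<pi> = arg_min degree ?P"
  have \<pi>: "?P \<pi>" unfolding \<pi>_def by (rule arg_min_natI[of ?P, OF p0])
  have min: "degree \<pi> \<le> degree h" if "?P h" for h
    unfolding \<pi>_def by (rule arg_min_nat_le[of ?P, OF that])
  have "irreducible \<pi>"
  proof (rule irreducibleI)
    show "\<pi> \<noteq> 0" using \<pi> by auto
    then show "\<not> is_unit \<pi>" using \<pi> by (simp add: is_unit_iff_degree)
    fix a b assume ab: "\<pi> = a * b"
    then have nz: "a \<noteq> 0" "b \<noteq> 0" using \<open>\<pi> \<noteq> 0\<close> by auto
    show "is_unit a \<or> is_unit b"
    proof (cases "degree a = 0")
      case False
      have "?P a" using False \<pi> ab dvd_mult_left by blast
      from min[OF this] have "degree b = 0" using ab nz by (simp add: degree_mult_eq)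
      then show ?thesis using nz by (simp add: is_unit_iff_degree)
    qed (use nz in \<open>simp add: is_unit_iff_degree\<close>)
  qed
  then show ?thesis using that \<pi> by blast
qed

text \<open>
  Dehomogenization that remembers the degree: the variable other than \<open>x\<^sub>j\<close> becomes \<open>z\<close> and \<open>x\<^sub>j\<close>
  becomes \<open>z x\<close> in \<open>k[x][z]\<close>.  It is injective, and an isomorphism once \<open>z\<close> is inverted.
\<close>

definition dehom :: "2 \<Rightarrow> (2, 'k::field) mpol \<Rightarrow> 'k poly poly" where
  "dehom j F = (\<Sum>t\<in>keys F. monom (monom (lookup F t) (lookup t j)) (mdeg t))"

lemma dehom_superset: "finite A \<Longrightarrow> keys F \<subseteq> A \<Longrightarrow>
    dehom j F = (\<Sum>t\<in>A. monom (monom (lookup F t) (lookup t j)) (mdeg t))"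
  unfolding dehom_def by (rule sum.mono_neutral_left) (auto simp: in_keys_iff)

lemma dehom_add: "dehom j (F + G) = dehom j F + dehom j G"
  using keys_add[of F G]
  by (subst (1 2 3) dehom_superset[where A = "keys F \<union> keys G"])
    (auto simp: lookup_add sum.distrib simp flip: add_monom)

lemma dehom_single: "dehom j (single t c) = monom (monom c (lookup t j)) (mdeg t)"
  by (cases "c = 0") (simp_all add: dehom_def)

lemma dehom_mult: "dehom j (F * G) = dehom j F * dehom j G"
proof (induction F rule: mpol_induct)
  case (monom t c)
  show ?case
  proof (induction G rule: mpol_induct)
    case (monom u d)
    show ?case by (simp add: mult_single dehom_single lookup_add mdeg_add mult_monom)
  qed (simp add: dehom_add distrib_left)
qed (simp add: dehom_add distrib_right)

lemma mdeg_2: "i \<noteq> j \<Longrightarrow> mdeg t = lookup t i + lookup t j" for t :: "2 \<Rightarrow>\<^sub>0 nat"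
proof -
  assume ij: "i \<noteq> j"
  have U: "(UNIV :: 2 set) = {i, j}" using ij by (metis (full_types) UNIV_eq_I exhaust_2 insert_iff)
  show ?thesis unfolding mdeg_eq_wt by (subst wt_superset[OF finite subset_UNIV]) (use ij in \<open>simp add: U\<close>)
qed

lemma coeff_dehom:
  assumes "i \<noteq> j"
  shows "coeff (coeff (dehom j F) (mdeg t)) (lookup t j) = lookup F t"
proof (induction F rule: mpol_induct)
  case (monom u c)
  have "u = t \<longleftrightarrow> mdeg u = mdeg t \<and> lookup u j = lookup t j"
  proof
    assume *: "mdeg u = mdeg t \<and> lookup u j = lookup t j"
    have "lookup u v = lookup t v" for v
      using * assms mdeg_2[OF assms, of t] mdeg_2[OF assms, of u] exhaust_2[of v] exhaust_2[of i] exhaust_2[of j]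
      by auto
    then show "u = t" by (intro poly_mapping_eqI)
  qed simp
  then show ?case by (auto simp: dehom_single lookup_single when_def)
qed (simp add: dehom_add lookup_add)

lemma dehom_inj:
  assumes "i \<noteq> j" "dehom j F = dehom j G"
  shows "F = G"
  by (rule poly_mapping_eqI) (metis assms coeff_dehom)

lemma dehom_pvar_power:
  assumes "i \<noteq> j"
  shows "dehom j (pvar i ^ n) = monom 1 n"
  using assms by (simp add: pvar_power dehom_single lookup_single monom_0 when_def one_pCons)

lemma dehom_surj:
  fixes V :: "'k::field poly poly"
  assumes "i \<noteq> j"
  obtains n F where "dehom j F = monom 1 n * V"
proof -
  let ?Q = "\<lambda>V::'k poly poly. \<exists>n F. dehom j F = monom 1 n * V"
  have add: "?Q (V + W)" if "?Q V" "?Q W" for V W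
  proof -
    from that obtain n F m G where *: "dehom j F = monom 1 n * V" "dehom j G = monom 1 m * W" by blast
    have "dehom j (pvar i ^ m * F + pvar i ^ n * G) = monom 1 (m + n) * (V + W)"
      unfolding dehom_add dehom_mult dehom_pvar_power[OF assms] *
      by (simp add: mult_monom distrib_left add.commute flip: mult.assoc)
    then show ?thesis by blast
  qed
  have 0: "?Q 0" by (intro exI[of _ "0::nat"] exI[of _ "0::(2,'k) mpol"]) (simp add: dehom_def)
  have sum: "finite A \<Longrightarrow> (\<And>x. x \<in> A \<Longrightarrow> ?Q (f x)) \<Longrightarrow> ?Q (sum f A)" for f and A :: "nat set"
  proof (induction A rule: finite_induct)
    case (insert x A)
    have "?Q (f x)" "?Q (sum f A)" using insert.IH insert.prems by blast+
    from add[OF this] show ?case by (simp only: sum.insert[OF insert.hyps])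
  qed (simp only: sum.empty 0)
  have mon: "?Q (monom (monom c e) d)" for c e d
    by (intro exI[of _ e] exI[of _ "single (single i d + single j e) c"])
      (use assms in \<open>simp add: dehom_single lookup_add lookup_single mdeg_add mult_monom add.commute when_def\<close>)
  have mon2: "?Q (monom a d)" for a d
  proof -
    have "monom a d = (\<Sum>e\<le>degree a. monom (monom (coeff a e) e) d)"
      by (simp add: poly_as_sum_of_monoms flip: monom_sum)
    then show ?thesis using sum[of "{..degree a}"] mon by simp
  qed
  have "?Q (\<Sum>d\<le>degree V. monom (coeff V d) d)" by (rule sum) (simp_all add: mon2)
  then show ?thesis using that by (auto simp: poly_as_sum_of_monoms)
qed

text \<open>
  The primes pulled back from \<open>k[x]\<close> have height one: a nonzero prime \<open>Q\<close> inside such a \<open>P\<close> contains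
  a homogenization of \<open>\<pi>\<close>, found by cancelling \<open>\<pi>\<close> from an element of \<open>Q\<close> for as long as possible,
  and then all of \<open>P\<close>, because \<open>x\<^sub>i \<notin> P\<close>.
\<close>

lemma dehom_prime_minimal:
  fixes \<pi> :: "'k::field poly"
  assumes ij: "i \<noteq> j" and \<pi>: "irreducible \<pi>"
  defines "P \<equiv> {F. [:\<pi>:] dvd dehom j F}"
  assumes Q: "idl.subspace Q" "Q \<subset> P" "Q \<noteq> {0}" and prime: "\<And>a b. a * b \<in> Q \<Longrightarrow> a \<in> Q \<or> b \<in> Q"
  shows False
proof -
  have \<pi>0: "\<pi> \<noteq> 0" "\<not> is_unit \<pi>" using \<pi> by (auto simp: irreducible_def)
  (* each cancellation of pi lowers the degree of the leading coefficient in z *)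
  let ?\<mu> = "\<lambda>F. degree (lead_coeff (dehom j F))"
  define F where "F = arg_min ?\<mu> (\<lambda>F. F \<in> Q \<and> F \<noteq> 0)"
  have "\<exists>F. F \<in> Q \<and> F \<noteq> 0" using Q idl.subspace_0[OF Q(1)] by blast
  then have F: "F \<in> Q" "F \<noteq> 0"
    using arg_min_natI[of "\<lambda>F. F \<in> Q \<and> F \<noteq> 0" _ ?\<mu>] unfolding F_def by blast+
  have min: "?\<mu> F \<le> ?\<mu> G" if "G \<in> Q" "G \<noteq> 0" for G
    unfolding F_def using that by (intro arg_min_nat_le) auto
  have dehom0: "dehom j 0 = (0 :: 'k poly poly)" by (simp add: dehom_def)
  have nz: "dehom j G \<noteq> 0" if "G \<noteq> 0" for G :: "(2,'k) mpol"
    using dehom_inj[OF ij, of G 0] that by (auto simp: dehom0)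
  have x: "pvar i ^ n \<notin> Q" for n
  proof
    assume "pvar i ^ n \<in> Q"
    then have "[:\<pi>:] dvd monom 1 n" using Q by (auto simp: P_def dehom_pvar_power[OF ij])
    then have "\<pi> dvd coeff (monom 1 n) n" by (simp only: const_poly_dvd_iff)
    then show False using \<pi>0 by simp
  qed
  obtain N \<pi>' where \<pi>': "dehom j \<pi>' = monom 1 N * [:\<pi>:]" by (rule dehom_surj[OF ij])
  have quot: "\<exists>G M. \<pi>' * G = pvar i ^ M * H \<and> (\<exists>n U. dehom j G = monom 1 n * U \<and> dehom j H = [:\<pi>:] * U)"
    if "H \<in> P" for H
  proof -
    from that obtain U where U: "dehom j H = [:\<pi>:] * U" by (auto simp: P_def elim: dvdE)
    obtain n G where G: "dehom j G = monom 1 n * U" by (rule dehom_surj[OF ij])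
    have "\<pi>' * G = pvar i ^ (N + n) * H"
    proof (rule dehom_inj[OF ij])
      have "dehom j (\<pi>' * G) = (monom 1 N * monom 1 n) * ([:\<pi>:] * U)"
        unfolding dehom_mult \<pi>' G by (simp only: mult_ac)
      also have "monom 1 N * monom 1 n = (monom 1 (N + n) :: 'k poly poly)" by (simp add: mult_monom)
      finally show "dehom j (\<pi>' * G) = dehom j (pvar i ^ (N + n) * H)"
        by (simp only: dehom_mult dehom_pvar_power[OF ij] U)
    qed
    then show ?thesis using U G by blast
  qed
  have "\<pi>' \<in> Q"
  proof (rule ccontr)
    assume "\<pi>' \<notin> Q"
    obtain G M n U where G: "\<pi>' * G = pvar i ^ M * F" "dehom j G = monom 1 n * U" "dehom j F = [:\<pi>:] * U"
      using quot[of F] F Q by blast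
    have "\<pi>' * G \<in> Q" using G(1) idl.subspace_scale[OF Q(1) F(1)] by simp
    then have GQ: "G \<in> Q" using prime \<open>\<pi>' \<notin> Q\<close> by blast
    have U0: "U \<noteq> 0" using G(3) nz[OF F(2)] by auto
    then have "dehom j G \<noteq> 0" using G(2) by (auto simp: monom_eq_0_iff)
    then have "G \<noteq> 0" by (auto simp: dehom0)
    from min[OF GQ this] have "degree (lead_coeff ([:\<pi>:] * U)) \<le> degree (lead_coeff (monom 1 n * U))"
      by (simp only: G)
    then have "degree (\<pi> * lead_coeff U) \<le> degree (lead_coeff U)"
      by (simp only: lead_coeff_mult) (simp add: lead_coeff_monom degree_monom_eq)
    then have "degree \<pi> = 0" using U0 \<pi>0 by (simp add: degree_mult_eq)
    then show False using \<pi>0 by (simp add: is_unit_iff_degree)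
  qed
  have "H \<in> Q" if H: "H \<in> P" for H
  proof -
    obtain G M where "\<pi>' * G = pvar i ^ M * H" using quot[OF H] by blast
    then have "pvar i ^ M * H \<in> Q"
      using idl.subspace_scale[OF Q(1) \<open>\<pi>' \<in> Q\<close>, of G] by (simp add: mult.commute)
    then show ?thesis using prime x by blast
  qed
  then show False using Q by blast
qed

text \<open>
  Otherwise the dehomogenization of the ideal is a proper ideal of \<open>k[x]\<close>, and an irreducible common
  divisor \<open>\<pi>\<close> of its elements defines a prime of height at most one that contains \<open>I\<close>.
\<close>

theorem variable_power_in_height_two_ideal:
  fixes f :: "(2, 'k::field) mpol ^ 'n"
  assumes f: "\<forall>j. f $ j \<in> forms (int d)" and I: "I = idl.span (range (($) f))"
    and height: "ideal_height (poly_ring UNIV) I = 2"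
  obtains n where "pvar i ^ n \<in> I"
proof -
  obtain j :: 2 where ij: "i \<noteq> j" by (metis exhaust_2 zero_neq_one)
  define J where "J = {a :: 'k poly. \<exists>n F. F \<in> I \<and> dehom j F = monom a n}"
  have I': "idl.subspace I" by (simp add: I)
  have J: "idl.subspace J"
  proof (rule idl.subspaceI)
    show "0 \<in> J" using idl.subspace_0[OF I'] by (auto simp: J_def dehom_def intro!: exI[of _ 0])
  next
    fix a b assume "a \<in> J" "b \<in> J"
    then obtain n F m G where *: "F \<in> I" "G \<in> I" "dehom j F = monom a n" "dehom j G = monom b m"
      by (auto simp: J_def)
    have "dehom j (pvar i ^ m * F + pvar i ^ n * G) = monom (a + b) (m + n)"
      using * by (simp add: dehom_add dehom_mult dehom_pvar_power[OF ij] mult_monom add_monom add.commute)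
    moreover have "pvar i ^ m * F + pvar i ^ n * G \<in> I"
      using * by (intro idl.subspace_add[OF I'] idl.subspace_scale[OF I'])
    ultimately show "a + b \<in> J" unfolding J_def by blast
  next
    fix c a assume "a \<in> J"
    then obtain n F where *: "F \<in> I" "dehom j F = monom a n" by (auto simp: J_def)
    obtain m and G :: "(2, 'k) mpol" where G: "dehom j G = monom 1 m * [:c:]" by (rule dehom_surj[OF ij])
    have "dehom j (G * F) = monom (c * a) (m + n)"
      unfolding dehom_mult G * by (simp add: mult_monom flip: monom_0)
    moreover have "G * F \<in> I" using * by (intro idl.subspace_scale[OF I'])
    ultimately show "c * a \<in> J" unfolding J_def by blast
  qed
  show thesis
  proof (cases "1 \<in> J")
    case True
    then obtain n F where *: "F \<in> I" "dehom j F = monom 1 n" by (auto simp: J_def)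
    then have "F = pvar i ^ n" by (intro dehom_inj[OF ij]) (simp add: dehom_pvar_power[OF ij])
    with * that show ?thesis by blast
  next
    case False
    obtain \<pi> where \<pi>: "irreducible \<pi>" "\<And>a. a \<in> J \<Longrightarrow> \<pi> dvd a"
      using proper_ideal_has_irreducible_divisor[OF J False] by blast
    define P where "P = {F. [:\<pi>:] dvd dehom j F}"
    have pr: "prime_elem [:\<pi>:]"
      by (simp add: prime_elem_const_poly_iff field_poly_irreducible_imp_prime \<pi>)
    have P: "idl.subspace P"
      by (rule idl.subspaceI) (auto simp: P_def dehom_add dehom_mult, simp add: dehom_def)
    have "dehom j (1 :: (2, 'k) mpol) = 1"
      using dehom_pvar_power[OF ij, of 0, where 'a='k] by (simp add: monom_0 one_pCons)
    then have "1 \<notin> P"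
      using pr by (simp add: P_def prime_elem_def)
    then have prime: "primeideal P (poly_ring UNIV)"
      unfolding primeideal_poly_ring_iff using P pr
      by (auto simp: P_def dehom_mult prime_elem_dvd_mult_iff)
    have "f $ l \<in> P" for l
    proof -
      have mono: "dehom j (f $ l) = monom (coeff (dehom j (f $ l)) d) d"
      proof (rule poly_eqI)
        fix n
        have "coeff (dehom j (f $ l)) n = 0" if "n \<noteq> d"
        proof -
          have "mdeg t = d" if "t \<in> keys (f $ l)" for t using f that by (auto simp: forms_def)
          then show ?thesis using that by (auto simp: dehom_def coeff_sum)
        qed
        then show "coeff (dehom j (f $ l)) n = coeff (monom (coeff (dehom j (f $ l)) d) d) n" by auto
      qed
      moreover have "f $ l \<in> I" by (auto simp: I intro: idl.span_base)
      ultimately have "coeff (dehom j (f $ l)) d \<in> J" unfolding J_def by blast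
      then have "\<pi> dvd coeff (dehom j (f $ l)) d" by (rule \<pi>(2))
      then have "[:\<pi>:] dvd dehom j (f $ l)" by (subst mono) (auto simp: const_poly_dvd_iff)
      then show ?thesis by (simp add: P_def)
    qed
    then have IP: "I \<subseteq> P" unfolding I by (intro idl.span_minimal P) auto
    have "prime_height (poly_ring UNIV) P \<le> 1"
      unfolding prime_height_def
    proof (rule Sup_least)
      fix e assume "e \<in> {enat k |k. \<exists>C. (\<forall>i\<le>k. primeideal (C i) (poly_ring UNIV)) \<and>
        (\<forall>i<k. C i \<subset> C (Suc i)) \<and> C k = P}"
      then obtain k C where e: "e = enat k" and C: "\<forall>i\<le>k. primeideal (C i) (poly_ring UNIV)"
        "\<forall>i<k. C i \<subset> C (Suc i)" "C k = P" by blast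
      have "\<not> 2 \<le> k"
      proof
        assume "2 \<le> k"
        then obtain k' where k: "k = Suc (Suc k')" by (metis add_2_eq_Suc le_Suc_ex)
        have 0: "primeideal (C k') (poly_ring UNIV)" "C k' \<subset> C (Suc k')"
          and 1: "primeideal (C (Suc k')) (poly_ring UNIV)" "C (Suc k') \<subset> P"
          using C by (auto simp: k)
        have "0 \<in> C k'" using 0(1) by (auto simp: primeideal_poly_ring_iff idl.subspace_0)
        then have "C (Suc k') \<noteq> {0}" using 0(2) by auto
        then show False
          using dehom_prime_minimal[OF ij \<pi>(1), of "C (Suc k')"] 1
          by (auto simp: primeideal_poly_ring_iff P_def)
      qed
      then show "e \<le> 1" by (simp add: e one_enat_def)
    qed
    moreover have "ideal_height (poly_ring UNIV) I \<le> prime_height (poly_ring UNIV) P"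
      unfolding ideal_height_def by (rule Inf_lower) (use prime IP in blast)
    ultimately have "(2::enat) \<le> 1" using height by (metis order_trans)
    then show ?thesis by (simp add: numeral_eq_enat one_enat_def)
  qed
qed

section \<open>Cokernels, symmetric algebras and the ideals of Rees algebras\<close>

lemma ideal_poly_ringD:
  assumes J: "ideal J (poly_ring V)"
  shows "J \<subseteq> carrier (poly_ring V)" "0 \<in> J" "\<And>x y. x \<in> J \<Longrightarrow> y \<in> J \<Longrightarrow> x + y \<in> J"
    "\<And>r x. r \<in> carrier (poly_ring V) \<Longrightarrow> x \<in> J \<Longrightarrow> r * x \<in> J" "\<And>x. x \<in> J \<Longrightarrow> - x \<in> J"
    "\<And>x y. x \<in> J \<Longrightarrow> y \<in> J \<Longrightarrow> x - y \<in> J"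
proof -
  interpret ideal J "poly_ring V" by fact
  show "J \<subseteq> carrier (poly_ring V)" by (rule a_subset)
  show "0 \<in> J" using additive_subgroup.zero_closed[OF is_additive_subgroup] by simp
  show add: "x + y \<in> J" if "x \<in> J" "y \<in> J" for x y
    using additive_subgroup.a_closed[OF is_additive_subgroup that] by simp
  show mult: "r * x \<in> J" if "r \<in> carrier (poly_ring V)" "x \<in> J" for r x
    using I_l_closed[OF that(2,1)] by simp
  have "- 1 \<in> carrier (poly_ring V)" by (auto simp: poly_ring_def)
  from mult[OF this] show uminus: "- x \<in> J" if "x \<in> J" for x using that by simp
  show "x - y \<in> J" if "x \<in> J" "y \<in> J" for x y using add[OF that(1) uminus[OF that(2)]] by simp
qed

lemma rcos_poly_ring_eq_iff:
  assumes J: "ideal J (poly_ring V)"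
  shows "J +>\<^bsub>poly_ring V\<^esub> x = J +>\<^bsub>poly_ring V\<^esub> y \<longleftrightarrow> x - y \<in> J"
proof -
  note D = ideal_poly_ringD[OF J]
  have cos: "J +>\<^bsub>poly_ring V\<^esub> z = {h + z |h. h \<in> J}" for z
    by (auto simp: a_r_coset_def')
  show ?thesis
  proof
    assume "J +>\<^bsub>poly_ring V\<^esub> x = J +>\<^bsub>poly_ring V\<^esub> y"
    moreover have "x \<in> J +>\<^bsub>poly_ring V\<^esub> x" using D(2) by (auto simp: cos intro: exI[of _ 0])
    ultimately obtain h where "h \<in> J" "x = h + y" by (auto simp: cos)
    then show "x - y \<in> J" by simp
  next
    assume xy: "x - y \<in> J"
    have "h + x = (h + (x - y)) + y" "h + y = (h - (x - y)) + x" for h by simp_all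
    then show "J +>\<^bsub>poly_ring V\<^esub> x = J +>\<^bsub>poly_ring V\<^esub> y"
      unfolding cos using D(3)[OF _ xy] D(6)[OF _ xy] by blast
  qed
qed

lemma vec_module_simps [simp]:
  "carrier vec_module = UNIV" "x \<oplus>\<^bsub>vec_module\<^esub> y = x + y" "c \<odot>\<^bsub>vec_module\<^esub> x = c *s x"
  "\<zero>\<^bsub>vec_module\<^esub> = 0"
  by (simp_all add: vec_module_def)

lemma smult_sum_right: "c *s (\<Sum>i\<in>A. v i) = (\<Sum>i\<in>A. c *s v i)"
  for v :: "'i \<Rightarrow> 'a::comm_ring_1 ^ 'n"
  by (simp add: vec_eq_iff sum_distrib_left)

lemma colspan_0 [simp]: "0 \<in> colspan \<phi> m"
  unfolding colspan_def by (auto intro!: exI[of _ "\<lambda>_. 0"])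

lemma colspan_add: "v \<in> colspan \<phi> m \<Longrightarrow> w \<in> colspan \<phi> m \<Longrightarrow> v + w \<in> colspan \<phi> m"
proof -
  have "(\<Sum>i=1..m. b i *s \<phi> i) + (\<Sum>i=1..m. c i *s \<phi> i) = (\<Sum>i=1..m. (b i + c i) *s \<phi> i)" for b c
    by (simp add: vector_sadd_rdistrib sum.distrib)
  then show "v \<in> colspan \<phi> m \<Longrightarrow> w \<in> colspan \<phi> m \<Longrightarrow> v + w \<in> colspan \<phi> m"
    unfolding colspan_def by (clarsimp, metis)
qed

lemma colspan_scale: "v \<in> colspan \<phi> m \<Longrightarrow> c *s v \<in> colspan \<phi> m"
proof -
  have "c *s (\<Sum>i=1..m. b i *s \<phi> i) = (\<Sum>i=1..m. (c * b i) *s \<phi> i)" for b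
    by (simp add: smult_sum_right vector_smult_assoc)
  then show "v \<in> colspan \<phi> m \<Longrightarrow> c *s v \<in> colspan \<phi> m"
    unfolding colspan_def by force
qed

lemma colspan_uminus: "v \<in> colspan \<phi> m \<Longrightarrow> - v \<in> colspan \<phi> m"
  using colspan_scale[of v \<phi> m "- 1"] by (simp add: vector_sneg_minus1)

lemma colspan_diff: "v \<in> colspan \<phi> m \<Longrightarrow> w \<in> colspan \<phi> m \<Longrightarrow> v - w \<in> colspan \<phi> m"
  using colspan_add[of v \<phi> m "- w"] colspan_uminus[of w] by simp

lemma colspan_base: "i \<in> {1..m} \<Longrightarrow> \<phi> i \<in> colspan \<phi> m"
proof -
  assume i: "i \<in> {1..m}"
  have "\<phi> i = (\<Sum>l=1..m. (if l = i then 1 else 0) *s \<phi> l)"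
    using i by (simp add: if_distrib[of "\<lambda>c. c *s _"] sum.delta cong: if_cong)
  then show ?thesis
    unfolding colspan_def by (intro CollectI exI[of _ "\<lambda>l. if l = i then 1 else 0"]) simp
qed

lemma coker_class_alt: "coker_class \<phi> m v = {h + v |h. h \<in> colspan \<phi> m}"
  by (auto simp: coker_class_def a_r_coset_def')

lemma coker_class_eq_iff: "coker_class \<phi> m v = coker_class \<phi> m w \<longleftrightarrow> v - w \<in> colspan \<phi> m"
proof
  assume "coker_class \<phi> m v = coker_class \<phi> m w"
  moreover have "v \<in> coker_class \<phi> m v" unfolding coker_class_alt by (auto intro: exI[of _ 0])
  ultimately obtain h where "h \<in> colspan \<phi> m" "v = h + w" by (auto simp: coker_class_alt)
  then show "v - w \<in> colspan \<phi> m" by simp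
next
  assume vw: "v - w \<in> colspan \<phi> m"
  have "h + v = (h + (v - w)) + w" "h + w = (h - (v - w)) + v" for h by simp_all
  then show "coker_class \<phi> m v = coker_class \<phi> m w"
    unfolding coker_class_alt using colspan_add[OF _ vw] colspan_diff[OF _ vw] by blast
qed

lemma carrier_coker: "carrier (coker \<phi> m) = range (coker_class \<phi> m)"
  by (auto simp: coker_def quot_module_def A_RCOSETS_def' coker_class_def)

lemma coker_class_in_carrier [simp]: "coker_class \<phi> m v \<in> carrier (coker \<phi> m)"
  by (simp add: carrier_coker)

lemma coker_add: "coker_class \<phi> m v \<oplus>\<^bsub>coker \<phi> m\<^esub> coker_class \<phi> m w = coker_class \<phi> m (v + w)"
proof -
  have "coker_class \<phi> m v \<oplus>\<^bsub>coker \<phi> m\<^esub> coker_class \<phi> m w =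
      {a + b |a b. a \<in> coker_class \<phi> m v \<and> b \<in> coker_class \<phi> m w}"
    by (auto simp: coker_def quot_module_def set_add_def')
  also have "\<dots> = coker_class \<phi> m (v + w)"
  proof (intro subset_antisym subsetI)
    fix x assume "x \<in> {a + b |a b. a \<in> coker_class \<phi> m v \<and> b \<in> coker_class \<phi> m w}"
    then obtain h k where "h \<in> colspan \<phi> m" "k \<in> colspan \<phi> m" "x = (h + k) + (v + w)"
      by (auto simp: coker_class_alt algebra_simps)
    then show "x \<in> coker_class \<phi> m (v + w)" unfolding coker_class_alt using colspan_add by blast
  next
    fix x assume "x \<in> coker_class \<phi> m (v + w)"
    then obtain h where h: "h \<in> colspan \<phi> m" "x = (h + v) + (0 + w)"
      by (auto simp: coker_class_alt algebra_simps)
    then show "x \<in> {a + b |a b. a \<in> coker_class \<phi> m v \<and> b \<in> coker_class \<phi> m w}"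
      unfolding coker_class_alt using colspan_0 by blast
  qed
  finally show ?thesis .
qed

lemma coker_smult: "c \<odot>\<^bsub>coker \<phi> m\<^esub> coker_class \<phi> m v = coker_class \<phi> m (c *s v)"
proof -
  have "c \<odot>\<^bsub>coker \<phi> m\<^esub> coker_class \<phi> m v = (\<Union>x\<in>coker_class \<phi> m v. coker_class \<phi> m (c *s x))"
    by (simp add: coker_def quot_module_def coker_class_def)
  also have "\<dots> = (\<Union>x\<in>coker_class \<phi> m v. coker_class \<phi> m (c *s v))"
  proof (rule SUP_cong)
    fix x assume "x \<in> coker_class \<phi> m v"
    then obtain h where "h \<in> colspan \<phi> m" "x = h + v" by (auto simp: coker_class_alt)
    then show "coker_class \<phi> m (c *s x) = coker_class \<phi> m (c *s v)"
      by (simp add: coker_class_eq_iff vector_add_ldistrib colspan_scale)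
  qed simp
  also have "\<dots> = coker_class \<phi> m (c *s v)"
    by (auto simp: coker_class_alt intro: exI[of _ 0])
  finally show ?thesis .
qed

lemma dotT_add: "dotT (v + w) = dotT v + dotT w"
  by (simp add: dotT_def pconst_add distrib_left sum.distrib)

lemma dotT_scale: "dotT (c *s v) = pconst c * dotT v"
  unfolding dotT_def sum_distrib_left
  by (rule sum.cong) (simp_all only: vector_smult_component pconst_mult mult.left_commute)

lemma dotT_0 [simp]: "dotT 0 = 0"
  by (simp add: dotT_def)

lemma dotT_uminus: "dotT (- v) = - dotT v"
  by (metis add.inverse_unique add.right_inverse dotT_0 dotT_add)

lemma dotT_diff: "dotT (v - w) = dotT v - dotT w"
  using dotT_add[of v "- w"] by (simp add: dotT_uminus)

lemma dotT_sum: "dotT (sum v A) = (\<Sum>x\<in>A. dotT (v x))"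
  by (induction A rule: infinite_finite_induct) (simp_all add: dotT_add)

lemma dotT_axis: "dotT (axis j 1) = pvar j"
proof -
  have "dotT (axis j 1) = (\<Sum>i\<in>UNIV. if i = j then pvar j else (0 :: ('a, 'b) mpol))"
    unfolding dotT_def by (rule sum.cong) (auto simp: axis_def)
  then show ?thesis by simp
qed

definition rel_ideal :: "(nat \<Rightarrow> 'a::comm_ring_1 ^ 'n) \<Rightarrow> nat \<Rightarrow> ('n, 'a) mpol set" where
  "rel_ideal \<phi> m = idl.span ((\<lambda>i. dotT (\<phi> i)) ` {1..m})"

lemma subspace_rel_ideal [simp]: "idl.subspace (rel_ideal \<phi> m)"
  by (simp add: rel_ideal_def)

lemma dotT_colspan: "v \<in> colspan \<phi> m \<Longrightarrow> dotT v \<in> rel_ideal \<phi> m"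
  unfolding colspan_def rel_ideal_def
  by (auto simp: dotT_sum dotT_scale intro!: idl.span_sum idl.span_scale intro: idl.span_base[OF imageI])

lemma sym_relations_subset: "sym_relations (coker \<phi> m) \<subseteq> carrier (poly_ring (carrier (coker \<phi> m)))"
proof -
  interpret ring "poly_ring (carrier (coker \<phi> m))" by (rule ring_poly_ring)
  let ?C = "carrier (poly_ring (carrier (coker \<phi> m)))"
  have v: "pvar X \<in> ?C" if "X \<in> carrier (coker \<phi> m)" for X
    using that by (simp add: poly_ring_def pvar_def)
  have c: "pconst c \<in> ?C" for c by (simp add: poly_ring_def pconst_def)
  have um: "- F \<in> ?C" if "F \<in> ?C" for F using that by (simp add: poly_ring_def in_keys_iff)
  have add: "F + G \<in> ?C" and mult: "F * G \<in> ?C" if "F \<in> ?C" "G \<in> ?C" for F G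
    using a_closed[OF that] m_closed[OF that] by simp_all
  have diff: "F - G \<in> ?C" if "F \<in> ?C" "G \<in> ?C" for F G
    using add[OF that(1) um[OF that(2)]] by simp
  show ?thesis
    unfolding sym_relations_def
  proof (safe)
    fix X Y assume XY: "X \<in> carrier (coker \<phi> m)" "Y \<in> carrier (coker \<phi> m)"
    then show "pvar (X \<oplus>\<^bsub>coker \<phi> m\<^esub> Y) - pvar X - pvar Y \<in> ?C"
      by (intro diff v) (auto simp: carrier_coker coker_add)
    show "pvar (c \<odot>\<^bsub>coker \<phi> m\<^esub> X) - pconst c * pvar X \<in> ?C" for c
      using XY by (intro diff v mult c) (auto simp: carrier_coker coker_smult)
  qed
qed

lemma ideal_sym_ideal: "ideal (sym_ideal (coker \<phi> m)) (poly_ring (carrier (coker \<phi> m)))"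
  unfolding sym_ideal_def by (rule ring.genideal_ideal[OF ring_poly_ring sym_relations_subset])

lemma sym_relations_in_ideal: "sym_relations (coker \<phi> m) \<subseteq> sym_ideal (coker \<phi> m)"
  unfolding sym_ideal_def by (rule ring.genideal_self[OF ring_poly_ring sym_relations_subset])

lemma psubst_closed:
  assumes "\<And>v. b v \<in> carrier (poly_ring V)"
  shows "psubst b F \<in> carrier (poly_ring V)"
proof -
  interpret cring "poly_ring V" by (rule cring_poly_ring)
  have C: "x + y \<in> carrier (poly_ring V)" "x * y \<in> carrier (poly_ring V)"
    if "x \<in> carrier (poly_ring V)" "y \<in> carrier (poly_ring V)" for x y
    using a_closed[OF that] m_closed[OF that] by simp_all
  have 1: "1 \<in> carrier (poly_ring V)" using one_closed by simp
  have pw: "x ^ n \<in> carrier (poly_ring V)" if "x \<in> carrier (poly_ring V)" for x and n :: nat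
    by (induction n) (simp_all add: 1 C that)
  have "finite A \<Longrightarrow> (\<Prod>v\<in>A. b v ^ lookup t v) \<in> carrier (poly_ring V)" for t and A :: "'a set"
    by (induction A rule: finite_induct) (simp_all add: 1 C pw assms)
  then have ev: "eval_monom b t \<in> carrier (poly_ring V)" for t by (simp add: eval_monom_def)
  have c: "pconst c \<in> carrier (poly_ring V)" for c by (simp add: poly_ring_def pconst_def)
  show ?thesis
    by (induction F rule: mpol_induct) (simp_all add: psubst_add psubst_single C ev c)
qed

text \<open>
  The symmetric algebra of the cokernel is \<open>S\<close> modulo the linear forms given by the columns: sending
  the variable of a class to the linear form of a representative inverts the map from \<open>S\<close> modulo
  these forms.
\<close>

lemma psubst_in_sym_ideal_iff:
  fixes \<phi> :: "nat \<Rightarrow> 'a::comm_ring_1 ^ 'n" and m :: nat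
  defines "b \<equiv> \<lambda>j. pvar (coker_class \<phi> m (axis j 1))"
  shows "psubst b G \<in> sym_ideal (coker \<phi> m) \<longleftrightarrow> G \<in> rel_ideal \<phi> m"
proof
  let ?M = "coker \<phi> m" let ?N = "sym_ideal (coker \<phi> m)"
  let ?C = "carrier (poly_ring (carrier ?M))"
  note D = ideal_poly_ringD[OF ideal_sym_ideal[of \<phi> m]]
  have bC: "psubst b F \<in> ?C" for F
    unfolding b_def by (rule psubst_closed) (simp add: poly_ring_def pvar_def)
  have radd: "pvar (coker_class \<phi> m (v + w)) - pvar (coker_class \<phi> m v) - pvar (coker_class \<phi> m w) \<in> ?N" for v w
    by (intro subsetD[OF sym_relations_in_ideal[of \<phi> m, unfolded sym_relations_def]] UnI1 CollectI
        exI[of _ "coker_class \<phi> m v"] exI[of _ "coker_class \<phi> m w"]) (simp add: coker_add)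
  have rscale: "pvar (coker_class \<phi> m (c *s v)) - pconst c * pvar (coker_class \<phi> m v) \<in> ?N" for c v
    by (intro subsetD[OF sym_relations_in_ideal[of \<phi> m, unfolded sym_relations_def]] UnI2 CollectI
        exI[of _ c] exI[of _ "coker_class \<phi> m v"]) (simp add: coker_smult)
  have r0: "pvar (coker_class \<phi> m 0) \<in> ?N" using rscale[of 0 0] by simp
  have lin: "pvar (coker_class \<phi> m (\<Sum>j\<in>A. v $ j *s axis j 1)) -
      (\<Sum>j\<in>A. pconst (v $ j) * pvar (coker_class \<phi> m (axis j 1))) \<in> ?N" if "finite A" for A v
    using that
  proof induction
    case empty
    then show ?case by (simp add: r0)
  next
    case (insert j A)
    let ?s = "\<Sum>j\<in>A. v $ j *s axis j 1"
    have "(pvar (coker_class \<phi> m (v $ j *s axis j 1 + ?s)) - pvar (coker_class \<phi> m (v $ j *s axis j 1))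
       - pvar (coker_class \<phi> m ?s)) +
      (pvar (coker_class \<phi> m (v $ j *s axis j 1)) - pconst (v $ j) * pvar (coker_class \<phi> m (axis j 1))) +
      (pvar (coker_class \<phi> m ?s) - (\<Sum>j\<in>A. pconst (v $ j) * pvar (coker_class \<phi> m (axis j 1)))) \<in> ?N"
      by (intro D(3) radd rscale insert)
    then show ?case using insert by (simp add: algebra_simps)
  qed
  show "psubst b G \<in> ?N" if "G \<in> rel_ideal \<phi> m"
    using that unfolding rel_ideal_def
  proof (induction rule: idl.span_induct_alt)
    case base
    then show ?case by (simp add: D)
  next
    case (step r x y)
    then obtain i where i: "i \<in> {1..m}" "x = dotT (\<phi> i)" by blast
    have "\<phi> i = (\<Sum>j\<in>UNIV. \<phi> i $ j *s axis j 1)"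
      by (simp add: vec_eq_iff axis_def if_distrib sum.delta cong: if_cong)
    with lin[of UNIV "\<phi> i"] have "pvar (coker_class \<phi> m (\<phi> i)) - psubst b x \<in> ?N"
      by (simp add: i dotT_def psubst_sum psubst_mult b_def mult.commute)
    moreover have "coker_class \<phi> m (\<phi> i) = coker_class \<phi> m 0"
      using i by (simp add: coker_class_eq_iff colspan_base)
    ultimately have "pvar (coker_class \<phi> m 0) - psubst b x \<in> ?N" by simp
    from D(6)[OF r0 this] have "psubst b x \<in> ?N" by simp
    then show ?case using step bC by (simp add: psubst_add psubst_mult D)
  qed
  (* the inverse map, from a choice of representatives *)
  define rep where "rep X = (SOME v. X = coker_class \<phi> m v)" for X
  have rep: "coker_class \<phi> m (rep X) = X" if "X \<in> carrier ?M" for X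
    using that someI_ex[of "\<lambda>v. X = coker_class \<phi> m v"] by (auto simp: carrier_coker rep_def)
  define lift where "lift = psubst (\<lambda>X. dotT (rep X))"
  let ?P = "{F \<in> ?C. lift F \<in> rel_ideal \<phi> m}"
  interpret ring "poly_ring (carrier ?M)" by (rule ring_poly_ring)
  have "ideal ?P (poly_ring (carrier ?M))"
  proof (rule idealI_poly_ring)
    show "x + y \<in> ?P" if "x \<in> ?P" "y \<in> ?P" for x y
      using that a_closed[of x y] by (simp add: lift_def psubst_add idl.subspace_add)
    show "r * x \<in> ?P" if "r \<in> ?C" "x \<in> ?P" for r x
      using that m_closed[of r x] by (simp add: lift_def psubst_mult idl.subspace_scale)
    show "0 \<in> ?P" using zero_closed by (simp add: lift_def idl.subspace_0)
  qed simp
  moreover have "sym_relations ?M \<subseteq> ?P"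
  proof
    fix F assume F: "F \<in> sym_relations ?M"
    then consider (add) x y where "F = pvar (x \<oplus>\<^bsub>?M\<^esub> y) - pvar x - pvar y" "x \<in> carrier ?M" "y \<in> carrier ?M"
      | (smult) c x where "F = pvar (c \<odot>\<^bsub>?M\<^esub> x) - pconst c * pvar x" "x \<in> carrier ?M"
      unfolding sym_relations_def by blast
    then have "lift F \<in> rel_ideal \<phi> m"
    proof cases
      case add
      have "coker_class \<phi> m (rep (x \<oplus>\<^bsub>?M\<^esub> y)) = coker_class \<phi> m (rep x + rep y)"
        using add rep[of x] rep[of y] coker_add[of \<phi> m "rep x" "rep y"] rep[of "x \<oplus>\<^bsub>?M\<^esub> y"] by simp
      then have "dotT (rep (x \<oplus>\<^bsub>?M\<^esub> y) - (rep x + rep y)) \<in> rel_ideal \<phi> m"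
        by (intro dotT_colspan) (simp add: coker_class_eq_iff)
      then show ?thesis by (simp add: add lift_def psubst_diff psubst_add dotT_diff dotT_add diff_diff_eq)
    next
      case smult
      have "coker_class \<phi> m (rep (c \<odot>\<^bsub>?M\<^esub> x)) = coker_class \<phi> m (c *s rep x)"
        using smult rep[of x] coker_smult[where c = c and v = "rep x" and \<phi> = \<phi> and m = m] rep[of "c \<odot>\<^bsub>?M\<^esub> x"] by simp
      then have "dotT (rep (c \<odot>\<^bsub>?M\<^esub> x) - c *s rep x) \<in> rel_ideal \<phi> m"
        by (intro dotT_colspan) (simp add: coker_class_eq_iff)
      then show ?thesis by (simp add: smult lift_def psubst_diff psubst_mult dotT_diff dotT_scale)
    qed
    then show "F \<in> ?P" using sym_relations_subset F by blast
  qed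
  ultimately have sub: "?N \<subseteq> ?P" unfolding sym_ideal_def by (rule genideal_minimal)
  assume "psubst b G \<in> ?N"
  then have "lift (psubst b G) \<in> rel_ideal \<phi> m" using sub by blast
  then have "psubst (\<lambda>j. dotT (rep (coker_class \<phi> m (axis j 1)))) G \<in> rel_ideal \<phi> m"
    by (simp add: lift_def b_def psubst_psubst)
  moreover have "psubst (\<lambda>j. dotT (rep (coker_class \<phi> m (axis j 1)))) G - psubst pvar G \<in> rel_ideal \<phi> m"
  proof (rule subspace_psubst_diff[OF subspace_rel_ideal])
    fix j
    have "dotT (rep (coker_class \<phi> m (axis j 1)) - axis j 1) \<in> rel_ideal \<phi> m"
      by (intro dotT_colspan) (simp add: rep flip: coker_class_eq_iff)
    then show "dotT (rep (coker_class \<phi> m (axis j 1))) - pvar j \<in> rel_ideal \<phi> m"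
      by (simp add: dotT_diff dotT_axis)
  qed
  ultimately have "psubst (\<lambda>j. dotT (rep (coker_class \<phi> m (axis j 1)))) G -
    (psubst (\<lambda>j. dotT (rep (coker_class \<phi> m (axis j 1)))) G - psubst pvar G) \<in> rel_ideal \<phi> m"
    by (rule idl.subspace_diff[OF subspace_rel_ideal])
  then show "G \<in> rel_ideal \<phi> m" by simp
qed

text \<open>
  The torsion of the symmetric algebra, pulled back along the previous isomorphism.
\<close>

lemma reesK_iff:
  fixes \<phi> :: "nat \<Rightarrow> 'a::idom ^ 'n"
  shows "F \<in> reesK \<phi> m \<longleftrightarrow> (\<exists>c. c \<noteq> 0 \<and> pconst c * F \<in> rel_ideal \<phi> m)"
proof -
  let ?M = "coker \<phi> m" let ?N = "sym_ideal (coker \<phi> m)"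
  let ?A = "poly_ring (carrier ?M)" let ?C = "carrier (poly_ring (carrier ?M))"
  define b :: "'n \<Rightarrow> (('a^'n) set, 'a) mpol" where "b = (\<lambda>j. pvar (coker_class \<phi> m (axis j 1)))"
  have N: "ideal ?N ?A" by (rule ideal_sym_ideal)
  note D = ideal_poly_ringD[OF N]
  interpret A: cring ?A by (rule cring_poly_ring)
  define T where "T = {F \<in> ?C. \<exists>c. c \<noteq> 0 \<and> pconst c * F \<in> ?N}"
  have cC: "pconst c \<in> ?C" for c by (simp add: poly_ring_def pconst_def)
  have T: "ideal T ?A"
  proof (rule idealI_poly_ring)
    show "0 \<in> T" using A.zero_closed D(2) by (auto simp: T_def intro!: exI[of _ 1])
    fix x y assume "x \<in> T" "y \<in> T"
    then obtain c d where *: "x \<in> ?C" "y \<in> ?C" "c \<noteq> 0" "d \<noteq> 0" "pconst c * x \<in> ?N" "pconst d * y \<in> ?N"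
      by (auto simp: T_def)
    have "pconst d * (pconst c * x) + pconst c * (pconst d * y) \<in> ?N" by (intro D cC *)
    then have "pconst (c * d) * (x + y) \<in> ?N"
      by (simp add: pconst_mult distrib_left) (simp only: ac_simps)
    then show "x + y \<in> T" using * A.a_closed[of x y] by (auto simp: T_def intro!: exI[of _ "c * d"])
  next
    fix r x :: "(('a^'n) set, 'a) mpol" assume r: "r \<in> ?C" and "x \<in> T"
    then obtain c where *: "x \<in> ?C" "c \<noteq> 0" "pconst c * x \<in> ?N" by (auto simp: T_def)
    have "pconst c * (r * x) \<in> ?N"
      using D(4)[OF r *(3)] by (simp only: ac_simps)
    then show "r * x \<in> T" using * r A.m_closed[of r x] by (auto simp: T_def)
  qed (auto simp: T_def)
  have NT: "?N \<subseteq> T" using D(1) by (auto simp: T_def intro!: exI[of _ 1])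
  have hom: "(+>\<^bsub>?A\<^esub>) ?N \<in> ring_hom ?A (?A Quot ?N)" by (rule ideal.rcos_ring_hom[OF N])
  have tors: "sym_torsion ?M = (+>\<^bsub>?A\<^esub>) ?N ` T"
  proof -
    have carr: "carrier (Sym ?M) = (+>\<^bsub>?A\<^esub>) ?N ` ?C"
      by (auto simp: Sym_def FactRing_def A_RCOSETS_def')
    have "sym_class ?M (pconst c) \<otimes>\<^bsub>Sym ?M\<^esub> (?N +>\<^bsub>?A\<^esub> F) = \<zero>\<^bsub>Sym ?M\<^esub> \<longleftrightarrow> pconst c * F \<in> ?N"
      if "F \<in> ?C" for c F
    proof -
      have "sym_class ?M (pconst c) \<otimes>\<^bsub>Sym ?M\<^esub> (?N +>\<^bsub>?A\<^esub> F) = ?N +>\<^bsub>?A\<^esub> (pconst c * F)"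
        unfolding sym_class_def Sym_def using ring_hom_mult[OF hom cC that, of c] by simp
      moreover have "\<zero>\<^bsub>Sym ?M\<^esub> = ?N +>\<^bsub>?A\<^esub> 0"
        unfolding Sym_def using ring_hom_zero[OF hom A.ring_axioms ideal.quotient_is_ring[OF N]] by simp
      ultimately show ?thesis by (simp add: rcos_poly_ring_eq_iff[OF N])
    qed
    then show ?thesis unfolding sym_torsion_def carr T_def by blast
  qed
  have tI: "ideal (sym_torsion ?M) (Sym ?M)"
    unfolding tors Sym_def by (rule A.ring_ideal_imp_quot_ideal[OF N T])
  have bC: "psubst b F \<in> ?C" for F
    unfolding b_def by (rule psubst_closed) (simp add: poly_ring_def pvar_def)
  have cl: "sym_class ?M (psubst b F) \<in> carrier (Sym ?M)"
    using bC by (auto simp: sym_class_def Sym_def FactRing_def A_RCOSETS_def')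
  have "F \<in> reesK \<phi> m \<longleftrightarrow> sym_torsion ?M +>\<^bsub>Sym ?M\<^esub> sym_class ?M (psubst b F) = sym_torsion ?M"
    by (simp add: reesK_def a_kernel_def' rees_map_def Rees_def FactRing_def b_def)
  also have "\<dots> \<longleftrightarrow> sym_class ?M (psubst b F) \<in> sym_torsion ?M"
  proof -
    interpret t: ideal "sym_torsion ?M" "Sym ?M" by (rule tI)
    show ?thesis using t.a_rcos_self[OF cl] t.a_rcos_const by blast
  qed
  also have "\<dots> \<longleftrightarrow> psubst b F \<in> T"
  proof
    assume "sym_class ?M (psubst b F) \<in> sym_torsion ?M"
    then obtain G where G: "G \<in> T" "?N +>\<^bsub>?A\<^esub> psubst b F = ?N +>\<^bsub>?A\<^esub> G"
      by (auto simp: tors sym_class_def)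
    then have "psubst b F - G \<in> T" using NT by (auto simp: rcos_poly_ring_eq_iff[OF N])
    from ideal_poly_ringD(3)[OF T this G(1)] show "psubst b F \<in> T" by simp
  qed (auto simp: tors sym_class_def)
  also have "\<dots> \<longleftrightarrow> (\<exists>c. c \<noteq> 0 \<and> psubst b (pconst c * F) \<in> ?N)"
    using bC by (simp add: T_def psubst_mult)
  also have "\<dots> \<longleftrightarrow> (\<exists>c. c \<noteq> 0 \<and> pconst c * F \<in> rel_ideal \<phi> m)"
    unfolding b_def psubst_in_sym_ideal_iff ..
  finally show ?thesis .
qed

section \<open>Splitting the resolution over the ideal\<close>

lemma row_times_add_right: "row_times u (v + w) = row_times u v + row_times u w"
  and row_times_add_left: "row_times (u + v) w = row_times u w + row_times v w"
  and row_times_diff_right: "row_times u (v - w) = row_times u v - row_times u w"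
  and row_times_diff_left: "row_times (u - v) w = row_times u w - row_times v w"
  and row_times_0_right [simp]: "row_times u 0 = 0"
  and row_times_0_left [simp]: "row_times 0 v = 0"
  by (simp_all add: row_times_def distrib_left distrib_right left_diff_distrib right_diff_distrib
      sum.distrib sum_subtractf)

lemma row_times_scale_right: "row_times u (c *s v) = c * row_times u v"
  unfolding row_times_def sum_distrib_left
  by (rule sum.cong) (simp_all only: vector_smult_component mult.left_commute)

lemma row_times_commute: "row_times u v = row_times v u"
  unfolding row_times_def by (simp only: mult.commute)

lemma row_times_scale_left: "row_times (c *s u) v = c * row_times u v"
  using row_times_scale_right[of v c u] by (simp only: row_times_commute)

lemma row_times_sum_right: "row_times u (\<Sum>i\<in>A. v i) = (\<Sum>i\<in>A. row_times u (v i))"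
  by (induction A rule: infinite_finite_induct) (simp_all add: row_times_add_right)

lemma row_times_sum_left: "row_times (\<Sum>i\<in>A. u i) v = (\<Sum>i\<in>A. row_times (u i) v)"
  by (induction A rule: infinite_finite_induct) (simp_all add: row_times_add_left)

lemma row_times_axis [simp]: "row_times u (axis j 1) = u $ j"
proof -
  have "row_times u (axis j 1) = (\<Sum>k\<in>UNIV. if k = j then u $ j else 0)"
    unfolding row_times_def by (rule sum.cong) (auto simp: axis_def)
  then show ?thesis by simp
qed

lemma row_times_axis_left [simp]: "row_times (axis j 1) u = u $ j"
  using row_times_axis[of u j] by (simp only: row_times_commute)

lemma sum_axis: "(\<Sum>j\<in>UNIV. v $ j *s axis j 1) = (v :: 'a::comm_ring_1 ^ 'n)"
  by (simp add: vec_eq_iff axis_def if_distrib sum.delta cong: if_cong)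

lemma linear_functional_eq_row_times:
  fixes T :: "'a::comm_ring_1 ^ 'n \<Rightarrow> 'a"
  assumes add: "\<And>v w. T (v + w) = T v + T w" and scale: "\<And>c v. T (c *s v) = c * T v"
  shows "T v = row_times (\<chi> j. T (axis j 1)) v"
proof -
  have 0: "T 0 = 0" using add[of 0 0] by simp
  have sum: "T (\<Sum>j\<in>A. w j) = (\<Sum>j\<in>A. T (w j))" for A and w :: "'n \<Rightarrow> 'a ^ 'n"
    by (induction A rule: infinite_finite_induct) (simp_all add: 0 add)
  have "T v = (\<Sum>j\<in>UNIV. v $ j * T (axis j 1))"
    by (subst (1) sum_axis[of v, symmetric]) (simp only: sum scale)
  then show ?thesis by (simp only: row_times_def vec_lambda_beta mult.commute)
qed

lemma ideal_of_entries:
  fixes f :: "'a::comm_ring_1 ^ 'n"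
  assumes "c \<in> idl.span (range (($) f))"
  obtains w where "c = row_times f w"
proof -
  from assms have "\<exists>w. c = row_times f w"
  proof (induction rule: idl.span_induct_alt)
    case base
    show ?case by (rule exI[of _ 0]) simp
  next
    case (step a x y)
    then obtain w j where "y = row_times f w" "x = f $ j" by blast
    then have "a * x + y = row_times f (a *s axis j 1 + w)"
      by (simp add: row_times_add_right row_times_scale_right)
    then show ?case by blast
  qed
  with that show ?thesis by blast
qed

text \<open>
  Inverting an element \<open>c = f \<bullet> w\<close> of the ideal makes its inclusion into \<open>R\<close> an isomorphism, so the
  resolution splits there.  The splitting becomes explicit and free of denominators by expanding
  \<open>c u - (f \<bullet> u) w\<close>, which \<open>f\<close> annihilates, in the columns.
\<close>

lemma splitting:
  fixes f :: "'a::comm_ring_1 ^ 'n"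
  assumes inj: "\<forall>c. (\<Sum>i=1..N. c i *s \<phi> i) = 0 \<longrightarrow> (\<forall>i\<in>{1..N}. c i = 0)"
    and exact: "colspan \<phi> N = {v. row_times f v = 0}"
    and c: "c \<in> idl.span (range (($) f))"
  obtains \<beta> where
    "\<And>i l. i \<in> {1..N} \<Longrightarrow> l \<in> {1..N} \<Longrightarrow> row_times (\<beta> i) (\<phi> l) = (if i = l then c else 0)"
proof -
  obtain w where w: "c = row_times f w" by (rule ideal_of_entries[OF c])
  have "\<exists>b. c *s axis j 1 - f $ j *s w = (\<Sum>i=1..N. b i *s \<phi> i)" for j
  proof -
    have "c *s axis j 1 - f $ j *s w \<in> colspan \<phi> N"
      unfolding exact by (simp add: row_times_diff_right row_times_scale_right flip: w)
    then show ?thesis unfolding colspan_def by blast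
  qed
  then obtain B where B: "\<And>j. c *s axis j 1 - f $ j *s w = (\<Sum>i=1..N. B j i *s \<phi> i)" by metis
  define \<beta> where "\<beta> = (\<lambda>i. \<chi> j. B j i)"
  have expand: "c *s u - row_times f u *s w = (\<Sum>i=1..N. row_times (\<beta> i) u *s \<phi> i)" for u
  proof -
    have T: "T u = row_times (\<chi> j. T (axis j 1)) u"
      if "T = (\<lambda>u. (c *s u - row_times f u *s w) $ k)" for T k
      by (rule linear_functional_eq_row_times)
        (simp_all add: that row_times_add_right row_times_scale_right algebra_simps)
    have "(c *s u - row_times f u *s w) $ k = (\<Sum>i=1..N. row_times (\<beta> i) u *s \<phi> i) $ k" for k
    proof -
      have "(c *s u - row_times f u *s w) $ k =
          row_times (\<chi> j. (c *s axis j 1 - f $ j *s w) $ k) u"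
        using T[OF refl, of k] by simp
      also have "\<dots> = (\<Sum>j\<in>UNIV. \<Sum>i=1..N. B j i * \<phi> i $ k * u $ j)"
        by (simp add: B row_times_def sum_distrib_right)
      also have "\<dots> = (\<Sum>i=1..N. \<Sum>j\<in>UNIV. B j i * u $ j * \<phi> i $ k)"
        by (subst sum.swap) (simp only: mult.assoc mult.commute[of "_ $ k"])
      also have "\<dots> = (\<Sum>i=1..N. row_times (\<beta> i) u *s \<phi> i) $ k"
        by (simp add: \<beta>_def row_times_def sum_distrib_right)
      finally show ?thesis .
    qed
    then show ?thesis unfolding vec_eq_iff by blast
  qed
  have "row_times (\<beta> i) (\<phi> l) = (if i = l then c else 0)" if il: "i \<in> {1..N}" "l \<in> {1..N}" for i l
  proof -
    have "row_times f (\<phi> l) = 0" using colspan_base[OF il(2), of \<phi>] exact by blast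
    then have "(\<Sum>i=1..N. row_times (\<beta> i) (\<phi> l) *s \<phi> i) = c *s \<phi> l" using expand[of "\<phi> l"] by simp
    also have "\<dots> = (\<Sum>i=1..N. (if i = l then c else 0) *s \<phi> i)"
      using il(2) by (simp add: if_distrib[of "\<lambda>a. a *s _"] sum.delta cong: if_cong)
    finally have "(\<Sum>i=1..N. (row_times (\<beta> i) (\<phi> l) - (if i = l then c else 0)) *s \<phi> i) = 0"
      by (simp only: vector_sub_rdistrib sum_subtractf) simp
    then show ?thesis using inj il(1) by fastforce
  qed
  with that show ?thesis by blast
qed

text \<open>
  If a multiple of \<open>v\<close> is a combination of columns, then \<open>f \<bullet> v = 0\<close>, so \<open>v\<close> is one too; comparing the
  two combinations shows that only the first \<open>m\<close> columns occur.
\<close>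

lemma coker_torsionfree:
  fixes f :: "'a::idom ^ 'n"
  assumes inj: "\<forall>c. (\<Sum>i=1..N. c i *s \<phi> i) = 0 \<longrightarrow> (\<forall>i\<in>{1..N}. c i = 0)"
    and exact: "colspan \<phi> N = {v. row_times f v = 0}"
    and m: "m \<le> N" and c: "c \<noteq> 0" "c *s v \<in> colspan \<phi> m"
  shows "v \<in> colspan \<phi> m"
proof -
  have pad: "(\<Sum>i=1..m. b i *s \<phi> i) = (\<Sum>i=1..N. (if i \<le> m then b i else 0) *s \<phi> i)" for b
    by (rule sum.mono_neutral_cong_left) (use m in auto)
  obtain b where b: "c *s v = (\<Sum>i=1..m. b i *s \<phi> i)" using c(2) by (auto simp: colspan_def)
  have "c *s v \<in> colspan \<phi> N" unfolding b pad by (auto simp: colspan_def)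
  then have "c * row_times f v = 0" using exact by (simp add: row_times_scale_right)
  then have "v \<in> colspan \<phi> N" using c(1) exact by simp
  then obtain a where a: "v = (\<Sum>i=1..N. a i *s \<phi> i)" by (auto simp: colspan_def)
  have "(\<Sum>i=1..N. (c * a i - (if i \<le> m then b i else 0)) *s \<phi> i) = 0"
    using b unfolding pad by (subst (asm) a) (simp add: smult_sum_right vector_smult_assoc vector_sub_rdistrib sum_subtractf)
  then have "\<forall>i\<in>{1..N}. c * a i - (if i \<le> m then b i else 0) = 0"
    by (rule inj[THEN spec[where x = "\<lambda>i. c * a i - (if i \<le> m then b i else 0)"], THEN mp])
  then have "a i = 0" if "i \<in> {1..N}" "\<not> i \<le> m" for i using that c(1) by fastforce
  then have "v = (\<Sum>i=1..m. a i *s \<phi> i)"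
    unfolding a by (intro sum.mono_neutral_right) (use m in auto)
  then show ?thesis by (auto simp: colspan_def)
qed

section \<open>The double dual in coordinates\<close>

abbreviation "coker_dual \<phi> m \<equiv> dual_module (poly_ring UNIV) (coker \<phi> m)"

text \<open>
  The functional that a row \<open>w\<close> induces on the cokernel, meaningful if \<open>w\<close> annihilates the columns.
  The choice of a representative makes it additive in \<open>w\<close> for all rows.
\<close>

definition row_functional :: "(nat \<Rightarrow> ('v, 'k::comm_ring_1) mpol ^ 'n) \<Rightarrow> nat \<Rightarrow> ('v, 'k) mpol ^ 'n \<Rightarrow>
    (('v, 'k) mpol ^ 'n) set \<Rightarrow> ('v, 'k) mpol" where
  "row_functional \<phi> m w =
     (\<lambda>X\<in>carrier (coker \<phi> m). row_times w (SOME v. X = coker_class \<phi> m v))"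

lemma dual_module_simps [simp]:
  "carrier (dual_module A M) = linear_maps A M (self_module A)"
  "\<psi> \<oplus>\<^bsub>dual_module A M\<^esub> \<eta> = (\<lambda>x\<in>carrier M. \<psi> x \<oplus>\<^bsub>A\<^esub> \<eta> x)"
  "c \<odot>\<^bsub>dual_module A M\<^esub> \<psi> = (\<lambda>x\<in>carrier M. c \<otimes>\<^bsub>A\<^esub> \<psi> x)"
  by (simp_all add: dual_module_def)

lemma dual_iff: "\<psi> \<in> linear_maps (poly_ring UNIV) M (self_module (poly_ring UNIV)) \<longleftrightarrow>
  \<psi> \<in> extensional (carrier M) \<and>
  (\<forall>x\<in>carrier M. \<forall>y\<in>carrier M. \<psi> (x \<oplus>\<^bsub>M\<^esub> y) = \<psi> x + \<psi> y) \<and>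
  (\<forall>c. \<forall>x\<in>carrier M. \<psi> (c \<odot>\<^bsub>M\<^esub> x) = c * \<psi> x)"
  by (auto simp: linear_maps_def self_module_def ring.defs poly_ring_def PiE_def)

lemma row_functional_add: "row_functional \<phi> m (v + w) =
      row_functional \<phi> m v \<oplus>\<^bsub>coker_dual \<phi> m\<^esub> row_functional \<phi> m w"
  by (auto simp: row_functional_def row_times_add_left)

lemma row_functional_scale: "row_functional \<phi> m (a *s w) =
      a \<odot>\<^bsub>coker_dual \<phi> m\<^esub> row_functional \<phi> m w"
  by (auto simp: row_functional_def row_times_scale_left)

lemma row_functional_apply:
  assumes w: "\<forall>i\<in>{1..m}. row_times w (\<phi> i) = 0"
  shows "row_functional \<phi> m w (coker_class \<phi> m v) = row_times w v"
proof -
  have col: "row_times w h = 0" if "h \<in> colspan \<phi> m" for h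
    using that w by (auto simp: colspan_def row_times_sum_right row_times_scale_right)
  define u where "u = (SOME u. coker_class \<phi> m v = coker_class \<phi> m u)"
  have "coker_class \<phi> m v = coker_class \<phi> m u" unfolding u_def by (rule someI[of _ v]) simp
  then have "row_times w (v - u) = 0" by (intro col) (simp add: coker_class_eq_iff)
  then show ?thesis by (simp add: row_functional_def u_def[symmetric] row_times_diff_right)
qed

lemma row_functional_in_dual:
  assumes w: "\<forall>i\<in>{1..m}. row_times w (\<phi> i) = 0"
  shows "row_functional \<phi> m w \<in> carrier (coker_dual \<phi> m)"
proof -
  have "row_functional \<phi> m w \<in> extensional (carrier (coker \<phi> m))" by (simp add: row_functional_def)
  then show ?thesis
    by (auto simp: dual_iff carrier_coker coker_add coker_smult row_functional_apply[OF w]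
        row_times_add_right row_times_scale_right)
qed

lemma dual_apply:
  assumes "\<psi> \<in> carrier (coker_dual \<phi> m)"
  shows "\<psi> (coker_class \<phi> m v) = row_times (\<chi> j. \<psi> (coker_class \<phi> m (axis j 1))) v"
proof (rule linear_functional_eq_row_times[of "\<lambda>v. \<psi> (coker_class \<phi> m v)"])
  have add: "\<psi> (x \<oplus>\<^bsub>coker \<phi> m\<^esub> y) = \<psi> x + \<psi> y" and scale: "\<psi> (c \<odot>\<^bsub>coker \<phi> m\<^esub> x) = c * \<psi> x"
    if "x \<in> carrier (coker \<phi> m)" "y \<in> carrier (coker \<phi> m)" for c x y
    using assms that unfolding dual_module_simps dual_iff by blast+
  show "\<psi> (coker_class \<phi> m (v + w)) = \<psi> (coker_class \<phi> m v) + \<psi> (coker_class \<phi> m w)" for v w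
    using add[of "coker_class \<phi> m v" "coker_class \<phi> m w"] by (simp only: coker_add coker_class_in_carrier)
  show "\<psi> (coker_class \<phi> m (c *s v)) = c * \<psi> (coker_class \<phi> m v)" for c v
    using scale[of "coker_class \<phi> m v" "coker_class \<phi> m v" c] by (simp only: coker_smult coker_class_in_carrier)
qed

lemma dual_eq_row_functional:
  assumes \<psi>: "\<psi> \<in> carrier (coker_dual \<phi> m)"
  defines "w \<equiv> \<chi> j. \<psi> (coker_class \<phi> m (axis j 1))"
  shows "\<psi> = row_functional \<phi> m w" "\<forall>i\<in>{1..m}. row_times w (\<phi> i) = 0"
proof -
  show w: "\<forall>i\<in>{1..m}. row_times w (\<phi> i) = 0"
  proof
    fix i assume "i \<in> {1..m}"
    then have "coker_class \<phi> m (\<phi> i) = coker_class \<phi> m 0"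
      by (simp add: coker_class_eq_iff colspan_base)
    then show "row_times w (\<phi> i) = 0"
      unfolding w_def by (metis dual_apply[OF \<psi>] row_times_0_right)
  qed
  show "\<psi> = row_functional \<phi> m w"
  proof (rule extensionalityI[of _ "carrier (coker \<phi> m)"])
    fix X assume "X \<in> carrier (coker \<phi> m)"
    then obtain v where v: "X = coker_class \<phi> m v" by (auto simp: carrier_coker)
    show "\<psi> X = row_functional \<phi> m w X"
      unfolding v row_functional_apply[OF w] unfolding w_def by (rule dual_apply[OF \<psi>])
  qed (use \<psi> in \<open>simp_all add: dual_iff row_functional_def\<close>)
qed

text \<open>
  The cokernel \<open>E\<close> of the first \<open>m\<close> columns of a matrix \<open>\<phi>\<close> that resolves the ideal of the entries of
  \<open>f\<close>, with coordinates \<open>\<Theta>\<close> on its double dual.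
\<close>

locale module_with_double_dual =
  fixes f :: "(2, 'k::field) mpol ^ 'n" and \<phi> :: "nat \<Rightarrow> (2, 'k) mpol ^ 'n" and N m s :: nat
    and \<sigma> :: "nat \<Rightarrow> nat"
    and \<Theta> :: "((((2, 'k) mpol ^ 'n) set \<Rightarrow> (2, 'k) mpol) \<Rightarrow> (2, 'k) mpol) \<Rightarrow> nat \<Rightarrow> (2, 'k) mpol"
  assumes inj: "\<forall>c. (\<Sum>i=1..N. c i *s \<phi> i) = 0 \<longrightarrow> (\<forall>i\<in>{1..N}. c i = 0)"
    and exact: "colspan \<phi> N = {v. row_times f v = 0}"
    and m_le: "m \<le> N"
    and iso: "graded_iso (poly_ring UNIV) (double_dual \<phi> m) (double_dual_grading \<phi> m)
           (free_module s) (shift_grading s \<sigma>) \<Theta>"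
begin

abbreviation "\<xi> \<equiv> xi_row \<phi> m \<Theta>"

definition bidual :: "(2, 'k) mpol ^ 'n \<Rightarrow> ((((2, 'k) mpol ^ 'n) set \<Rightarrow> (2, 'k) mpol) \<Rightarrow> (2, 'k) mpol)" where
  "bidual v = bidual_map (poly_ring UNIV) (coker \<phi> m) (coker_class \<phi> m v)"

lemma bidual_apply:
  "\<psi> \<in> carrier (coker_dual \<phi> m) \<Longrightarrow> bidual v \<psi> = \<psi> (coker_class \<phi> m v)"
  by (simp add: bidual_def bidual_map_def)

lemma double_dual_iff: "\<Lambda> \<in> carrier (double_dual \<phi> m) \<longleftrightarrow>
   \<Lambda> \<in> extensional (carrier (coker_dual \<phi> m)) \<and>
   (\<forall>\<psi>\<in>carrier (coker_dual \<phi> m).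
     \<forall>\<eta>\<in>carrier (coker_dual \<phi> m).
       \<Lambda> (\<psi> \<oplus>\<^bsub>coker_dual \<phi> m\<^esub> \<eta>) = \<Lambda> \<psi> + \<Lambda> \<eta>) \<and>
   (\<forall>c. \<forall>\<psi>\<in>carrier (coker_dual \<phi> m).
       \<Lambda> (c \<odot>\<^bsub>coker_dual \<phi> m\<^esub> \<psi>) = c * \<Lambda> \<psi>)"
  unfolding double_dual_def by (subst dual_module_simps(1), subst dual_iff) (rule refl)

lemma dual_closed:
  assumes "\<psi> \<in> carrier (coker_dual \<phi> m)"
    "\<eta> \<in> carrier (coker_dual \<phi> m)"
  shows "\<psi> \<oplus>\<^bsub>coker_dual \<phi> m\<^esub> \<eta> \<in> carrier (coker_dual \<phi> m)"
    "c \<odot>\<^bsub>coker_dual \<phi> m\<^esub> \<psi> \<in> carrier (coker_dual \<phi> m)"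
proof -
  define v w where "v = (\<chi> j. \<psi> (coker_class \<phi> m (axis j 1)))" and "w = (\<chi> j. \<eta> (coker_class \<phi> m (axis j 1)))"
  note v = dual_eq_row_functional[OF assms(1), folded v_def]
    and w = dual_eq_row_functional[OF assms(2), folded w_def]
  show "\<psi> \<oplus>\<^bsub>coker_dual \<phi> m\<^esub> \<eta> \<in> carrier (coker_dual \<phi> m)"
    unfolding v(1) w(1) row_functional_add[symmetric]
    by (rule row_functional_in_dual) (simp add: row_times_add_left v(2) w(2))
  show "c \<odot>\<^bsub>coker_dual \<phi> m\<^esub> \<psi> \<in> carrier (coker_dual \<phi> m)"
    unfolding v(1) row_functional_scale[symmetric]
    by (rule row_functional_in_dual) (simp add: row_times_scale_left v(2)[rule_format])
qed

lemma bidual_in_double_dual: "bidual v \<in> carrier (double_dual \<phi> m)"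
proof -
  have "bidual v \<in> extensional (carrier (coker_dual \<phi> m))"
    by (simp add: bidual_def bidual_map_def)
  then show ?thesis
    unfolding double_dual_iff
    by (intro conjI ballI allI) (simp_all only: bidual_apply dual_closed, simp_all)
qed

lemma \<Theta>_linear:
  assumes "\<Lambda> \<in> carrier (double_dual \<phi> m)" "\<Lambda>' \<in> carrier (double_dual \<phi> m)" "l \<in> {1..s}"
  shows "\<Theta> (\<Lambda> \<oplus>\<^bsub>double_dual \<phi> m\<^esub> \<Lambda>') l = \<Theta> \<Lambda> l + \<Theta> \<Lambda>' l"
    "\<Theta> (c \<odot>\<^bsub>double_dual \<phi> m\<^esub> \<Lambda>) l = c * \<Theta> \<Lambda> l"
proof -
  have "\<Theta> \<in> linear_maps (poly_ring UNIV) (double_dual \<phi> m) (free_module s)"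
    using iso by (simp add: graded_iso_def)
  then show "\<Theta> (\<Lambda> \<oplus>\<^bsub>double_dual \<phi> m\<^esub> \<Lambda>') l = \<Theta> \<Lambda> l + \<Theta> \<Lambda>' l"
    "\<Theta> (c \<odot>\<^bsub>double_dual \<phi> m\<^esub> \<Lambda>) l = c * \<Theta> \<Lambda> l"
    using assms by (simp_all add: linear_maps_def free_module_def)
qed

lemma \<Theta>_bidual: "l \<in> {1..s} \<Longrightarrow> \<Theta> (bidual v) l = row_times (\<xi> l) v"
proof -
  assume l: "l \<in> {1..s}"
  have add: "bidual (v + w) = bidual v \<oplus>\<^bsub>double_dual \<phi> m\<^esub> bidual w" for v w
    unfolding double_dual_def dual_module_simps
    by (rule ext) (auto simp: bidual_def bidual_map_def dual_iff simp flip: coker_add)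
  have scale: "bidual (c *s v) = c \<odot>\<^bsub>double_dual \<phi> m\<^esub> bidual v" for c v
    unfolding double_dual_def dual_module_simps
    by (rule ext) (auto simp: bidual_def bidual_map_def dual_iff simp flip: coker_smult)
  have "\<Theta> (bidual v) l = row_times (\<chi> j. \<Theta> (bidual (axis j 1)) l) v"
    by (rule linear_functional_eq_row_times[of "\<lambda>v. \<Theta> (bidual v) l"])
      (simp_all only: add scale \<Theta>_linear(1)[OF bidual_in_double_dual bidual_in_double_dual l]
        \<Theta>_linear(2)[OF bidual_in_double_dual bidual_in_double_dual l])
  then show ?thesis by (simp add: xi_row_def bidual_def)
qed

lemma \<Theta>_eqI:
  assumes "\<Lambda> \<in> carrier (double_dual \<phi> m)" "\<Lambda>' \<in> carrier (double_dual \<phi> m)"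
    and "\<And>l. l \<in> {1..s} \<Longrightarrow> \<Theta> \<Lambda> l = \<Theta> \<Lambda>' l"
  shows "\<Lambda> = \<Lambda>'"
proof -
  have bij: "bij_betw \<Theta> (carrier (double_dual \<phi> m)) (carrier (free_module s))"
    using iso by (simp add: graded_iso_def)
  then have "\<Theta> \<Lambda> \<in> {1..s} \<rightarrow>\<^sub>E UNIV" "\<Theta> \<Lambda>' \<in> {1..s} \<rightarrow>\<^sub>E UNIV"
    using assms(1,2) by (auto dest!: bij_betwE simp: free_module_def)
  then have "\<Theta> \<Lambda> = \<Theta> \<Lambda>'"
    by (intro extensionalityI[of _ "{1..s}"] assms(3)) (auto simp: PiE_def)
  then show ?thesis using bij assms by (auto simp: bij_betw_def inj_on_def)
qed

text \<open>
  The classes of the basis vectors have degree zero, and \<open>\<Theta>\<close> preserves degrees.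
\<close>

lemma \<xi>_forms: "l \<in> {1..s} \<Longrightarrow> \<xi> l $ j \<in> forms (int (\<sigma> l))"
proof -
  assume l: "l \<in> {1..s}"
  have "axis j (1 :: (2,'k) mpol) \<in> vec_grading 0" by (simp add: vec_grading_def axis_def)
  then have "coker_class \<phi> m (axis j 1) \<in> coker_grading \<phi> m 0"
    by (simp add: coker_grading_def quot_grading_def coker_class_def)
  then have "bidual (axis j 1) \<in> double_dual_grading \<phi> m 0"
    using bidual_in_double_dual[of "axis j 1"]
    by (fastforce simp: double_dual_grading_def dual_grading_def double_dual_def bidual_def bidual_map_def)
  then have "\<Theta> (bidual (axis j 1)) \<in> shift_grading s \<sigma> 0"
    using iso by (auto simp: graded_iso_def)
  then have "\<Theta> (bidual (axis j 1)) l \<in> forms (int (\<sigma> l))"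
    using l by (simp add: shift_grading_def)
  then show ?thesis using \<Theta>_bidual[OF l, of "axis j 1"] by simp
qed

text \<open>
  A vector on which all functionals of \<open>E\<close> vanish is killed by \<open>c - \<Sum>\<^sub>i \<phi>\<^sub>i \<beta>\<^sub>i\<close>, the projection given
  by the splitting, because its rows are such functionals.  Hence a multiple of the vector, and
  then the vector itself, is a combination of the columns.
\<close>

lemma kernel_\<xi>:
  assumes c: "c \<in> idl.span (range (($) f))" "c \<noteq> 0"
  shows "(\<forall>l\<in>{1..s}. row_times (\<xi> l) v = 0) \<longleftrightarrow> v \<in> colspan \<phi> m"
proof
  assume "v \<in> colspan \<phi> m"
  then have "coker_class \<phi> m v = coker_class \<phi> m 0" by (simp add: coker_class_eq_iff)
  then have "bidual v = bidual 0" by (simp add: bidual_def)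
  then show "\<forall>l\<in>{1..s}. row_times (\<xi> l) v = 0" by (metis \<Theta>_bidual row_times_0_right)
next
  assume 0: "\<forall>l\<in>{1..s}. row_times (\<xi> l) v = 0"
  have "bidual v = bidual 0"
    by (rule \<Theta>_eqI) (use 0 in \<open>simp_all add: bidual_in_double_dual \<Theta>_bidual\<close>)
  then have ann: "row_times w v = 0" if "\<forall>i\<in>{1..m}. row_times w (\<phi> i) = 0" for w
    using bidual_apply[OF row_functional_in_dual[OF that], of v]
      bidual_apply[OF row_functional_in_dual[OF that], of 0]
    by (simp add: row_functional_apply[OF that])
  obtain \<beta> where \<beta>: "\<And>i l. i \<in> {1..N} \<Longrightarrow> l \<in> {1..N} \<Longrightarrow> row_times (\<beta> i) (\<phi> l) = (if i = l then c else 0)"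
    using splitting[OF inj exact c(1)] by blast
  have "(c *s v - (\<Sum>i=1..m. row_times (\<beta> i) v *s \<phi> i)) $ j = 0" for j
  proof -
    define w where "w = c *s axis j 1 - (\<Sum>i=1..m. \<phi> i $ j *s \<beta> i)"
    have w: "row_times w u = (c *s u - (\<Sum>i=1..m. row_times (\<beta> i) u *s \<phi> i)) $ j" for u
      by (simp add: w_def row_times_diff_left row_times_scale_left row_times_sum_left mult.commute)
    have "\<forall>l\<in>{1..m}. row_times w (\<phi> l) = 0"
    proof
      fix l assume l: "l \<in> {1..m}"
      have "(\<Sum>i=1..m. row_times (\<beta> i) (\<phi> l) *s \<phi> i) = (\<Sum>i=1..m. (if i = l then c else 0) *s \<phi> i)"
        by (rule sum.cong) (use l m_le \<beta> in auto)
      also have "\<dots> = c *s \<phi> l"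
        using l by (simp add: if_distrib[of "\<lambda>a. a *s _"] sum.delta cong: if_cong)
      finally show "row_times w (\<phi> l) = 0" by (simp add: w)
    qed
    from ann[OF this] show ?thesis by (simp add: w)
  qed
  then have "c *s v = (\<Sum>i=1..m. row_times (\<beta> i) v *s \<phi> i)" by (simp add: vec_eq_iff)
  then have "c *s v \<in> colspan \<phi> m" by (auto simp: colspan_def)
  then show "v \<in> colspan \<phi> m" by (rule coker_torsionfree[OF inj exact m_le c(2)])
qed

text \<open>
  The ideal multiplies the double dual into the module.  For \<open>\<Lambda>\<close> in the double dual, composition
  with the projection of the splitting extends \<open>c \<Lambda>\<close> from the functionals of \<open>E\<close> to all rows, where it
  is the evaluation at a vector.
\<close>

lemma ideal_times_double_dual:
  assumes c: "c \<in> idl.span (range (($) f))" and l: "l \<in> {1..s}"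
  obtains \<eta> where "\<And>l'. l' \<in> {1..s} \<Longrightarrow> row_times (\<xi> l') \<eta> = (if l' = l then c else 0)"
proof -
  obtain \<beta> where \<beta>: "\<And>i l. i \<in> {1..N} \<Longrightarrow> l \<in> {1..N} \<Longrightarrow> row_times (\<beta> i) (\<phi> l) = (if i = l then c else 0)"
    using splitting[OF inj exact c] by blast
  define u where "u = (\<lambda>i\<in>{1..s}. if i = l then 1 else (0 :: (2,'k) mpol))"
  have bij: "bij_betw \<Theta> (carrier (double_dual \<phi> m)) (carrier (free_module s))"
    using iso by (simp add: graded_iso_def)
  have "u \<in> carrier (free_module s)" by (simp add: u_def free_module_def)
  then obtain \<Lambda> where \<Lambda>: "\<Lambda> \<in> carrier (double_dual \<phi> m)" "\<Theta> \<Lambda> = u"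
    using bij by (metis (no_types, lifting) bij_betw_def imageE)
  define Q where "Q w = c *s w - (\<Sum>i=1..m. row_times w (\<phi> i) *s \<beta> i)" for w
  have Q: "\<forall>j\<in>{1..m}. row_times (Q w) (\<phi> j) = 0" for w
  proof
    fix j assume j: "j \<in> {1..m}"
    have "(\<Sum>i=1..m. row_times w (\<phi> i) * row_times (\<beta> i) (\<phi> j)) =
        (\<Sum>i=1..m. if i = j then row_times w (\<phi> j) * c else 0)"
      by (rule sum.cong) (use j m_le \<beta> in auto)
    also have "\<dots> = c * row_times w (\<phi> j)" using j by (simp add: mult.commute)
    finally show "row_times (Q w) (\<phi> j) = 0"
      by (simp add: Q_def row_times_diff_left row_times_scale_left row_times_sum_left)
  qed
  define T where "T w = \<Lambda> (row_functional \<phi> m (Q w))" for w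
  have Qadd: "Q (v + w) = Q v + Q w" for v w
    by (simp add: Q_def row_times_add_left vector_add_ldistrib vector_sadd_rdistrib sum.distrib)
  have Qscale: "Q (a *s w) = a *s Q w" for a w
    by (simp add: Q_def row_times_scale_left vector_ssub_ldistrib smult_sum_right vector_smult_assoc mult.commute)
  note rQ = row_functional_in_dual[OF Q]
  define \<eta> where "\<eta> = (\<chi> j. T (axis j 1))"
  have T: "T w = row_times \<eta> w" for w
    unfolding \<eta>_def
    by (rule linear_functional_eq_row_times)
      (use \<Lambda>(1) rQ in \<open>simp_all only: T_def Qadd Qscale row_functional_add row_functional_scale double_dual_iff\<close>)
  have "bidual \<eta> = c \<odot>\<^bsub>double_dual \<phi> m\<^esub> \<Lambda>"
  proof (rule extensionalityI[of _ "carrier (coker_dual \<phi> m)"])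
    fix \<psi> assume \<psi>: "\<psi> \<in> carrier (coker_dual \<phi> m)"
    define w where "w = (\<chi> j. \<psi> (coker_class \<phi> m (axis j 1)))"
    note w = dual_eq_row_functional[OF \<psi>, folded w_def]
    have "Q w = c *s w" using w(2) by (simp add: Q_def)
    then have "c * \<Lambda> \<psi> = T w"
      using \<Lambda>(1) \<psi> w(1) by (simp only: T_def row_functional_scale double_dual_iff)
    also have "\<dots> = \<psi> (coker_class \<phi> m \<eta>)"
      unfolding T dual_apply[OF \<psi>, folded w_def] by (rule row_times_commute)
    finally show "bidual \<eta> \<psi> = (c \<odot>\<^bsub>double_dual \<phi> m\<^esub> \<Lambda>) \<psi>"
      using \<psi> by (simp only: bidual_apply) (simp add: double_dual_def)
  qed (simp_all add: bidual_def bidual_map_def double_dual_def)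
  then have "row_times (\<xi> l') \<eta> = (if l' = l then c else 0)" if l': "l' \<in> {1..s}" for l'
    using \<Theta>_bidual[OF l', of \<eta>] \<Theta>_linear(2)[OF \<Lambda>(1) \<Lambda>(1) l', of c] l' by (auto simp: \<Lambda>(2) u_def split: if_splits)
  then show ?thesis using that by blast
qed

end

section \<open>Homogeneous substitutions and divisibility by variables\<close>

lemma hforms_eval_monom:
  assumes b: "\<And>v. b v \<in> hforms \<tau> (- int (\<sigma> v)) 1"
  shows "eval_monom b t \<in> hforms \<tau> (- int (wt \<sigma> t)) (mdeg t)"
proof -
  have pow: "b v ^ n \<in> hforms \<tau> (- int (n * \<sigma> v)) n" for v n
  proof (induction n)
    case 0
    have "pconst 1 \<in> hforms \<tau> 0 0" by (rule hforms_pconst) simp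
    then show ?case by simp
  next
    case (Suc n)
    show ?case unfolding power_Suc by (rule hforms_mult'[OF b Suc]) simp_all
  qed
  have "finite A \<Longrightarrow> (\<Prod>v\<in>A. b v ^ lookup t v) \<in>
    hforms \<tau> (- int (\<Sum>v\<in>A. lookup t v * \<sigma> v)) (\<Sum>v\<in>A. lookup t v)" for A
  proof (induction A rule: finite_induct)
    case empty
    have "pconst 1 \<in> hforms \<tau> 0 0" by (rule hforms_pconst) simp
    then show ?case by simp
  next
    case (insert v A)
    show ?case
      unfolding prod.insert[OF insert.hyps]
      by (rule hforms_mult'[OF pow insert.IH]) (use insert.hyps in simp_all)
  qed
  then show ?thesis by (simp add: eval_monom_def wt_def mdeg_def)
qed

lemma hforms_psubst:
  assumes b: "\<And>v. b v \<in> hforms \<tau> (- int (\<sigma> v)) 1" and F: "F \<in> hforms \<sigma> a n"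
  shows "psubst b F \<in> hforms \<tau> a n"
  unfolding psubst_alt
proof (rule hforms_sum)
  fix t assume "t \<in> keys F"
  then have "lookup F t \<in> forms (a + int (wt \<sigma> t))" "mdeg t = n" using F by (auto simp: hforms_def)
  then have "pconst (lookup F t) * eval_monom b t \<in>
      hforms \<tau> (a + int (wt \<sigma> t) + (- int (wt \<sigma> t))) (0 + mdeg t)"
    by (intro hforms_mult hforms_pconst hforms_eval_monom b)
  then show "pconst (lookup F t) * eval_monom b t \<in> hforms \<tau> a n"
    using \<open>mdeg t = n\<close> by simp
qed

lemma eval_monom_scaled: "eval_monom (\<lambda>v. pconst c * b v) t = pconst (c ^ mdeg t) * eval_monom b t"
  by (simp add: eval_monom_def power_mult_distrib prod.distrib mdeg_def pconst_power flip: power_sum)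

lemma psubst_scaled_pvar:
  assumes "\<And>t. t \<in> keys F \<Longrightarrow> mdeg t = n"
  shows "psubst (\<lambda>v. pconst c * pvar v) F = pconst (c ^ n) * F"
proof -
  have "psubst (\<lambda>v. pconst c * pvar v) F = (\<Sum>t\<in>keys F. pconst (c ^ n) * (pconst (lookup F t) * eval_monom pvar t))"
    unfolding psubst_alt
    by (rule sum.cong[OF refl]) (simp add: eval_monom_scaled assms mult.left_commute)
  also have "\<dots> = pconst (c ^ n) * psubst pvar F" by (simp only: psubst_alt sum_distrib_left)
  finally show ?thesis by simp
qed

lemma psubst_scaled_hform:
  "F \<in> hforms \<sigma> a n \<Longrightarrow> psubst (\<lambda>v. pconst c * pvar v) F = pconst (c ^ n) * F"
  by (rule psubst_scaled_pvar) (simp add: hforms_def)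

lemma pconst_mult_eq_0:
  fixes F :: "('v, 'a::idom) mpol"
  assumes "pconst c * F = 0" "c \<noteq> 0"
  shows "F = 0"
proof (rule poly_mapping_eqI)
  fix t
  have "c * lookup F t = 0" using assms(1) by (metis lookup_pconst_mult lookup_zero)
  then show "lookup F t = lookup 0 t" using assms(2) by simp
qed

lemma pvar_power_neq_0 [simp]: "pvar x ^ n \<noteq> (0 :: ('v, 'a::comm_ring_1) mpol)"
  unfolding pvar_power by (metis lookup_single_eq lookup_zero zero_neq_one)

lemma pvar_neq_0 [simp]: "pvar x \<noteq> (0 :: ('v, 'a::comm_ring_1) mpol)"
  using pvar_power_neq_0[of x 1] by simp

lemma lookup_pvar_power_mult: "lookup (pvar v ^ n * F) (single v n + t) = lookup F t"
proof (induction F rule: mpol_induct)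
  case (monom u c)
  then show ?case by (simp add: pvar_power mult_single lookup_single when_def)
qed (simp add: distrib_left lookup_add)

lemma lookup_pvar_power_mult_neq_0:
  assumes "lookup (pvar v ^ n * F) t \<noteq> 0"
  obtains u where "t = single v n + u"
proof -
  have "t \<in> keys (single (single v n) 1 * F)" using assms by (simp add: in_keys_iff pvar_power)
  then show ?thesis using that keys_mult by fastforce
qed

lemma pvar_power_dvd:
  fixes F :: "('v, 'a::comm_ring_1) mpol"
  assumes "\<And>t. t \<in> keys F \<Longrightarrow> n \<le> lookup t v"
  obtains G where "F = pvar v ^ n * G"
proof -
  have "pvar v ^ n dvd single t (lookup F t)" if "t \<in> keys F" for t
  proof -
    have "t = single v n + (t - single v n)"
      using assms[OF that] by (intro poly_mapping_eqI) (auto simp: lookup_add lookup_minus lookup_single when_def)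
    then have "single t (lookup F t) = pvar v ^ n * single (t - single v n) (lookup F t)"
      by (simp add: pvar_power mult_single)
    then show ?thesis by (rule dvdI)
  qed
  then have "pvar v ^ n dvd (\<Sum>t\<in>keys F. single t (lookup F t))" by (intro dvd_sum)
  then show ?thesis using that by (auto simp: sum_terms elim: dvdE)
qed

text \<open>
  Powers of two variables form a regular sequence.
\<close>

lemma pvar_powers_coprime:
  fixes F G :: "('v, 'a::comm_ring_1) mpol"
  assumes xy: "x \<noteq> y" and eq: "pvar x ^ n * F = pvar y ^ k * G"
  obtains H where "F = pvar y ^ k * H"
proof (rule pvar_power_dvd)
  fix t assume "t \<in> keys F"
  then have "lookup (pvar x ^ n * F) (single x n + t) \<noteq> 0"
    by (simp add: lookup_pvar_power_mult in_keys_iff)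
  then obtain u where "single x n + t = single y k + u"
    unfolding eq by (rule lookup_pvar_power_mult_neq_0)
  then have "lookup (single x n + t) y = lookup (single y k + u) y" by simp
  then show "k \<le> lookup t y" using xy by (simp add: lookup_add lookup_single)
qed (use that in blast)

lemma pvar_powers_coprime_coefficientwise:
  fixes F G :: "('w, ('v, 'a::comm_ring_1) mpol) mpol"
  assumes xy: "x \<noteq> y" and eq: "pconst (pvar x ^ n) * F = pconst (pvar y ^ k) * G"
  obtains H where "F = pconst (pvar y ^ k) * H"
proof -
  have "\<exists>h. lookup F t = pvar y ^ k * h" for t
  proof -
    have "pvar x ^ n * lookup F t = pvar y ^ k * lookup G t"
      using arg_cong[OF eq, of "\<lambda>H. lookup H t"] by (simp add: lookup_pconst_mult)
    then show ?thesis using pvar_powers_coprime[OF xy] by metis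
  qed
  then obtain h where h: "\<And>t. lookup F t = pvar y ^ k * h t" by metis
  have "F = (\<Sum>t\<in>keys F. single t (pvar y ^ k * h t))"
    using sum_terms[of F] by (simp flip: h)
  also have "\<dots> = pconst (pvar y ^ k) * (\<Sum>t\<in>keys F. single t (h t))"
    by (simp add: sum_distrib_left pconst_def mult_single)
  finally show ?thesis by (rule that)
qed

text \<open>
  A monomial of degree at least \<open>2 K - 1\<close> in two variables is divisible by the \<open>K\<close>-th power of one of
  them.
\<close>

lemma high_degree_form_in_power_ideal:
  fixes F :: "(2, 'k::field) mpol"
  assumes F: "F \<in> forms a" and a: "a \<ge> 2 * int K - 1" and xy: "x \<noteq> y"
  obtains G H where "F = pvar x ^ K * G - pvar y ^ K * H"
proof -
  define A where "A = (\<Sum>t | t \<in> keys F \<and> K \<le> lookup t x. single t (lookup F t))"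
  define B where "B = (\<Sum>t | t \<in> keys F \<and> \<not> K \<le> lookup t x. single t (lookup F t))"
  have FAB: "F = A + B"
    unfolding A_def B_def
    by (subst (1) sum_terms[of F, symmetric]) (subst sum.union_disjoint[symmetric], auto intro: sum.cong)
  have "K \<le> lookup t x" if "t \<in> keys A" for t
  proof -
    have "keys A \<subseteq> (\<Union>t\<in>{t \<in> keys F. K \<le> lookup t x}. keys (single t (lookup F t)))"
      unfolding A_def by (rule keys_sum)
    then show ?thesis using that by (auto split: if_splits)
  qed
  then obtain G where G: "A = pvar x ^ K * G" by (rule pvar_power_dvd)
  have "K \<le> lookup t y" if "t \<in> keys B" for t
  proof -
    have "keys B \<subseteq> (\<Union>t\<in>{t \<in> keys F. \<not> K \<le> lookup t x}. keys (single t (lookup F t)))"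
      unfolding B_def by (rule keys_sum)
    then have t: "t \<in> keys F" "\<not> K \<le> lookup t x" using that by (auto split: if_splits)
    then have "int (lookup t x + lookup t y) = a"
      using F mdeg_2[OF xy, of t] by (auto simp: forms_def)
    then show ?thesis using a t(2) by linarith
  qed
  then obtain H where H: "B = pvar y ^ K * H" by (rule pvar_power_dvd)
  have "F = pvar x ^ K * G - pvar y ^ K * (- H)" using FAB G H by simp
  then show ?thesis by (rule that)
qed

lemma subspace_reesK [simp]: "idl.subspace (reesK \<phi> m)" for \<phi> :: "nat \<Rightarrow> 'a::idom ^ 'n"
proof (rule idl.subspaceI)
  note I = subspace_rel_ideal[of \<phi> m]
  show "0 \<in> reesK \<phi> m" unfolding reesK_iff by (rule exI[of _ 1]) (simp add: idl.subspace_0[OF I])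
  fix F G assume "F \<in> reesK \<phi> m" "G \<in> reesK \<phi> m"
  then obtain c d where *: "c \<noteq> 0" "d \<noteq> 0" "pconst c * F \<in> rel_ideal \<phi> m" "pconst d * G \<in> rel_ideal \<phi> m"
    by (auto simp: reesK_iff)
  have "pconst d * (pconst c * F) + pconst c * (pconst d * G) \<in> rel_ideal \<phi> m"
    by (intro idl.subspace_add[OF I] idl.subspace_scale[OF I] *)
  also have "pconst d * (pconst c * F) + pconst c * (pconst d * G) = pconst (c * d) * (F + G)"
    by (simp add: pconst_mult distrib_left ac_simps)
  finally show "F + G \<in> reesK \<phi> m" unfolding reesK_iff using *(1,2) by (intro exI[of _ "c * d"]) simp
next
  note I = subspace_rel_ideal[of \<phi> m]
  fix H F assume "F \<in> reesK \<phi> m"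
  then obtain c where *: "c \<noteq> 0" "pconst c * F \<in> rel_ideal \<phi> m" by (auto simp: reesK_iff)
  have "H * (pconst c * F) \<in> rel_ideal \<phi> m" by (intro idl.subspace_scale[OF I] *)
  then show "H * F \<in> reesK \<phi> m" unfolding reesK_iff using *(1) by (auto simp: mult.left_commute)
qed

section \<open>The Rees algebra inside the symmetric algebra of the double dual\<close>

text \<open>
  The module \<open>E\<close> in coordinates.  The rows \<open>\<xi>\<close> embed it into \<open>F = \<Oplus>\<^sub>l R(\<sigma> l)\<close> with basis \<open>t\<^sub>1, \<dots>, t\<^sub>s\<close>;
  \<open>\<eta> x l\<close> is a preimage of \<open>x\<^sup>K t\<^sub>l\<close>, so that both \<open>x\<^sub>0\<^sup>K\<close> and \<open>x\<^sub>1\<^sup>K\<close> multiply \<open>F\<close> into \<open>E\<close>; and \<open>\<beta> x\<close>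
  is a functional on \<open>E\<close> with value \<open>x\<^sup>K\<close> at the next column.
\<close>

locale module_in_free_module =
  fixes \<phi> \<xi> :: "nat \<Rightarrow> (2, 'k::field) mpol ^ 'n" and \<delta> \<sigma> :: "nat \<Rightarrow> nat" and m s K :: nat
    and \<eta> :: "2 \<Rightarrow> nat \<Rightarrow> (2, 'k) mpol ^ 'n" and \<beta> :: "2 \<Rightarrow> (2, 'k) mpol ^ 'n"
  assumes \<xi>_forms: "\<And>l j. l \<in> {1..s} \<Longrightarrow> \<xi> l $ j \<in> forms (int (\<sigma> l))"
    and kernel_\<xi>: "\<And>v. (\<forall>l\<in>{1..s}. row_times (\<xi> l) v = 0) \<longleftrightarrow> v \<in> colspan \<phi> m"
    and \<phi>_forms: "\<And>i. i \<in> {1..m+1} \<Longrightarrow> \<phi> i \<in> vec_grading (int (\<delta> i))"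
    and \<delta>_le: "\<And>i. i \<in> {1..m} \<Longrightarrow> \<delta> i \<le> \<delta> m"
    and \<delta>_mono: "\<delta> m \<le> \<delta> (m + 1)"
    and \<eta>: "\<And>x l l'. l \<in> {1..s} \<Longrightarrow> l' \<in> {1..s} \<Longrightarrow>
      row_times (\<xi> l') (\<eta> x l) = (if l' = l then pvar x ^ K else 0)"
    and \<beta>: "\<And>x i. i \<in> {1..m} \<Longrightarrow> row_times (\<beta> x) (\<phi> i) = 0"
      "\<And>x. row_times (\<beta> x) (\<phi> (m + 1)) = pvar x ^ K"
begin

text \<open>
  The element of \<open>F\<close> with coordinates \<open>u\<close>, as a linear form.
\<close>

definition tform :: "(nat \<Rightarrow> (2, 'k) mpol) \<Rightarrow> (nat, (2, 'k) mpol) mpol" where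
  "tform u = (\<Sum>l=1..s. pconst (u l) * pvar l)"

definition \<psi> :: "('n, (2, 'k) mpol) mpol \<Rightarrow> (nat, (2, 'k) mpol) mpol" where
  "\<psi> = psubst (\<lambda>j. tform (\<lambda>l. \<xi> l $ j))"

definition \<gamma> :: "(nat, (2, 'k) mpol) mpol" where
  "\<gamma> = tform (\<lambda>l. row_times (\<xi> l) (\<phi> (m + 1)))"

text \<open>
  Variables are indexed by all natural numbers; those of the symmetric algebra of \<open>F\<close> are
  \<open>t\<^sub>1, \<dots>, t\<^sub>s\<close>.
\<close>

definition P :: "(nat, (2, 'k) mpol) mpol set" where
  "P = carrier (poly_ring {1..s})"

lemma P_iff: "F \<in> P \<longleftrightarrow> (\<forall>t\<in>keys F. keys t \<subseteq> {1..s})"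
  by (simp add: P_def poly_ring_def)

lemma P_closed: "F \<in> P \<Longrightarrow> G \<in> P \<Longrightarrow> F + G \<in> P" "F \<in> P \<Longrightarrow> G \<in> P \<Longrightarrow> F * G \<in> P"
  "pconst c \<in> P" "0 \<in> P" "1 \<in> P" "l \<in> {1..s} \<Longrightarrow> pvar l \<in> P"
proof -
  interpret ring "poly_ring {1..s}" by (rule ring_poly_ring)
  show "F \<in> P \<Longrightarrow> G \<in> P \<Longrightarrow> F + G \<in> P" "F \<in> P \<Longrightarrow> G \<in> P \<Longrightarrow> F * G \<in> P"
    using a_closed[of F G] m_closed[of F G] by (simp_all add: P_def)
  show "pconst c \<in> P" "0 \<in> P" "1 \<in> P" "l \<in> {1..s} \<Longrightarrow> pvar l \<in> P"
    by (simp_all add: P_iff pconst_def pvar_def)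
qed

lemma P_sum: "(\<And>x. x \<in> A \<Longrightarrow> f x \<in> P) \<Longrightarrow> sum f A \<in> P"
  by (induction A rule: infinite_finite_induct) (simp_all add: P_closed)

lemma tform_in_P: "tform u \<in> P"
  unfolding tform_def by (rule P_sum) (simp add: P_closed)

lemma bicomp_in_P: "F \<in> P \<Longrightarrow> bicomp \<sigma> a b F \<in> P"
proof -
  have "lookup F t \<noteq> 0" if "lookup (bicomp \<sigma> a b F) t \<noteq> 0" for t
    using that by (auto simp: lookup_bicomp split: if_splits)
  then have "keys (bicomp \<sigma> a b F) \<subseteq> keys F" by (simp add: subset_iff in_keys_iff)
  then show "F \<in> P \<Longrightarrow> bicomp \<sigma> a b F \<in> P" unfolding P_iff by blast
qed

lemma tform_cong: "(\<And>l. l \<in> {1..s} \<Longrightarrow> u l = v l) \<Longrightarrow> tform u = tform v"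
  unfolding tform_def by (rule sum.cong) simp_all

lemma tform_unit: "l \<in> {1..s} \<Longrightarrow> tform (\<lambda>l'. if l' = l then c else 0) = pconst c * pvar l"
  by (simp add: tform_def if_distrib[of pconst] if_distrib[of "\<lambda>a. a * _"] sum.delta cong: if_cong)

lemma tform_hforms: "(\<And>l. l \<in> {1..s} \<Longrightarrow> u l \<in> forms (a + int (\<sigma> l))) \<Longrightarrow> tform u \<in> hforms \<sigma> a 1"
  unfolding tform_def
  by (intro hforms_sum hforms_mult'[OF hforms_pconst hforms_pvar[OF refl]]) auto

lemma \<psi>_simps [simp]: "\<psi> (F + G) = \<psi> F + \<psi> G" "\<psi> (F - G) = \<psi> F - \<psi> G" "\<psi> (F * G) = \<psi> F * \<psi> G"
  "\<psi> (pconst c) = pconst c" "\<psi> 0 = 0" "\<psi> 1 = 1" "\<psi> (- F) = - \<psi> F"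
  by (simp_all add: \<psi>_def psubst_add psubst_diff psubst_mult psubst_uminus)

lemma \<psi>_sum: "\<psi> (sum f A) = (\<Sum>x\<in>A. \<psi> (f x))"
  by (simp add: \<psi>_def psubst_sum)

lemma \<psi>_pvar: "\<psi> (pvar j) = tform (\<lambda>l. \<xi> l $ j)"
  by (simp add: \<psi>_def)

lemma \<psi>_dotT: "\<psi> (dotT v) = tform (\<lambda>l. row_times (\<xi> l) v)"
proof -
  have "\<psi> (dotT v) = (\<Sum>j\<in>UNIV. \<Sum>l=1..s. pconst (\<xi> l $ j * v $ j) * pvar l)"
    by (simp only: dotT_def \<psi>_sum \<psi>_simps \<psi>_pvar tform_def sum_distrib_right sum_distrib_left pconst_mult mult_ac)
  also have "\<dots> = (\<Sum>l=1..s. \<Sum>j\<in>UNIV. pconst (\<xi> l $ j * v $ j) * pvar l)" by (rule sum.swap)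
  also have "\<dots> = tform (\<lambda>l. row_times (\<xi> l) v)"
    by (simp add: tform_def row_times_def pconst_sum sum_distrib_right)
  finally show ?thesis .
qed

lemma \<psi>_hforms: "F \<in> biforms a b \<Longrightarrow> \<psi> F \<in> hforms \<sigma> a b"
  unfolding \<psi>_def biforms_eq_hforms
proof (rule hforms_psubst)
  show "tform (\<lambda>l. \<xi> l $ j) \<in> hforms \<sigma> (- int 0) 1" for j
    by (rule tform_hforms) (simp add: \<xi>_forms)
qed

lemma \<psi>_bicomp: "\<psi> (bicomp (\<lambda>_. 0) a b F) = bicomp \<sigma> a b (\<psi> F)"
  by (rule bicomp_commute[of \<psi>, symmetric]) (simp_all add: \<psi>_hforms flip: biforms_eq_hforms)

lemma \<psi>_column: "i \<in> {1..m} \<Longrightarrow> \<psi> (dotT (\<phi> i)) = 0"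
proof -
  assume "i \<in> {1..m}"
  then have "\<forall>l\<in>{1..s}. row_times (\<xi> l) (\<phi> i) = 0" unfolding kernel_\<xi> by (rule colspan_base)
  then have "tform (\<lambda>l. row_times (\<xi> l) (\<phi> i)) = tform (\<lambda>l. 0)" by (intro tform_cong) simp
  then show ?thesis by (simp add: \<psi>_dotT) (simp add: tform_def)
qed

lemma \<psi>_new_column: "\<psi> (dotT (\<phi> (m + 1))) = \<gamma>"
  by (simp add: \<psi>_dotT \<gamma>_def)

lemma \<gamma>_hforms: "\<gamma> \<in> hforms \<sigma> (int (\<delta> (m + 1))) 1"
  unfolding \<gamma>_def
proof (rule tform_hforms)
  fix l assume l: "l \<in> {1..s}"
  have "\<phi> (m + 1) $ j \<in> forms (int (\<delta> (m + 1)))" for j using \<phi>_forms[of "m + 1"] by (simp add: vec_grading_def)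
  then show "row_times (\<xi> l) (\<phi> (m + 1)) \<in> forms (int (\<delta> (m + 1)) + int (\<sigma> l))"
    unfolding row_times_def by (intro forms_sum forms_mult'[OF \<xi>_forms[OF l]]) simp_all
qed

lemma \<psi>_rel_ideal:
  assumes "F \<in> rel_ideal \<phi> m"
  shows "\<psi> F = 0"
  using assms unfolding rel_ideal_def
  by (induction rule: idl.span_induct_alt) (auto simp: \<psi>_column)

text \<open>
  Sending \<open>t\<^sub>l\<close> to the linear form of \<open>\<eta> x l\<close> inverts \<open>\<psi>\<close> up to the scalar \<open>x\<^sup>K\<close> on each variable and up
  to the linear forms of the columns.  On a homogeneous polynomial the scalars combine to a power
  of \<open>x\<close>.
\<close>

lemma \<psi>_eq_0_iff: "\<psi> F = 0 \<longleftrightarrow> F \<in> reesK \<phi> m"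
proof
  assume "F \<in> reesK \<phi> m"
  then obtain c where c: "c \<noteq> 0" "pconst c * F \<in> rel_ideal \<phi> m" by (auto simp: reesK_iff)
  have "pconst c * \<psi> F = 0" using \<psi>_rel_ideal[OF c(2)] by simp
  then show "\<psi> F = 0" by (rule pconst_mult_eq_0[OF _ c(1)])
next
  assume 0: "\<psi> F = 0"
  have hom: "F \<in> reesK \<phi> m" if F: "F \<in> hforms (\<lambda>_. 0) a b" "\<psi> F = 0" for F a b
  proof -
    define c :: "(2, 'k) mpol" where "c = pvar 1 ^ K"
    define \<kappa> where "\<kappa> = psubst (\<lambda>l. dotT (\<eta> 1 l))"
    have "psubst (\<lambda>j. \<kappa> (tform (\<lambda>l. \<xi> l $ j))) F - psubst (\<lambda>j. pconst c * pvar j) F \<in> rel_ideal \<phi> m"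
    proof (rule subspace_psubst_diff[OF subspace_rel_ideal])
      fix j
      define v where "v = (\<Sum>l=1..s. \<xi> l $ j *s \<eta> 1 l) - c *s axis j 1"
      have "row_times (\<xi> l') v = 0" if l': "l' \<in> {1..s}" for l'
      proof -
        have "(\<Sum>l=1..s. \<xi> l $ j * row_times (\<xi> l') (\<eta> 1 l)) = (\<Sum>l=1..s. if l = l' then \<xi> l' $ j * c else 0)"
          by (rule sum.cong) (use l' in \<open>auto simp: \<eta> c_def\<close>)
        also have "\<dots> = c * \<xi> l' $ j" using l' by (simp add: mult.commute)
        finally show ?thesis
          by (simp add: v_def row_times_diff_right row_times_sum_right row_times_scale_right)
      qed
      then have "v \<in> colspan \<phi> m" by (simp flip: kernel_\<xi>)
      then have "dotT v \<in> rel_ideal \<phi> m" by (rule dotT_colspan)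
      then show "\<kappa> (tform (\<lambda>l. \<xi> l $ j)) - pconst c * pvar j \<in> rel_ideal \<phi> m"
        by (simp add: v_def dotT_diff dotT_sum dotT_scale dotT_axis \<kappa>_def tform_def psubst_sum psubst_mult)
    qed
    moreover have "psubst (\<lambda>j. \<kappa> (tform (\<lambda>l. \<xi> l $ j))) F = \<kappa> (\<psi> F)"
      by (simp add: \<kappa>_def \<psi>_def psubst_psubst)
    moreover have "\<kappa> (\<psi> F) = 0" using F(2) by (simp add: \<kappa>_def)
    ultimately have "- (pconst (c ^ b) * F) \<in> rel_ideal \<phi> m"
      by (simp add: psubst_scaled_hform[OF F(1)])
    from idl.subspace_neg[OF subspace_rel_ideal this] show ?thesis
      unfolding reesK_iff by (intro exI[of _ "c ^ b"]) (simp add: c_def)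
  qed
  show "F \<in> reesK \<phi> m"
  proof (rule bicomp_closed)
    show "bicomp (\<lambda>_. 0) a b F \<in> reesK \<phi> m" for a b
      by (rule hom[OF bicomp_hforms]) (simp add: \<psi>_bicomp 0)
  qed (simp_all add: idl.subspace_0 idl.subspace_add)
qed

section \<open>The ideal generated by the new column is primitive\<close>

text \<open>
  Coefficients of an expression of \<open>x\<^sup>2\<^sup>K\<close> as a combination of the coordinates of \<open>\<gamma>\<close>.
\<close>

definition content_coeff :: "2 \<Rightarrow> nat \<Rightarrow> (2, 'k) mpol" where
  "content_coeff x l = row_times (\<beta> x) (\<eta> x l)"

text \<open>
  The vectors \<open>x\<^sup>K \<phi>\<^sub>m\<^sub>+\<^sub>1\<close> and \<open>\<Sum>\<^sub>l \<gamma>\<^sub>l \<eta>\<^sub>l\<close> have the same image in \<open>F\<close>, so they differ by a combination of the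
  first \<open>m\<close> columns, which \<open>\<beta>\<close> kills.
\<close>

lemma content_\<gamma>:
  "(\<Sum>l=1..s. row_times (\<xi> l) (\<phi> (m + 1)) * content_coeff x l) = pvar x ^ (2 * K)"
proof -
  let ?c = "pvar x ^ K :: (2, 'k) mpol" and ?g = "\<lambda>l. row_times (\<xi> l) (\<phi> (m + 1))"
  define w where "w = ?c *s \<phi> (m + 1) - (\<Sum>l=1..s. ?g l *s \<eta> x l)"
  have "row_times (\<xi> l') w = 0" if l': "l' \<in> {1..s}" for l'
  proof -
    have "(\<Sum>l=1..s. ?g l * row_times (\<xi> l') (\<eta> x l)) = (\<Sum>l=1..s. if l = l' then ?g l' * ?c else 0)"
      by (rule sum.cong) (use l' in \<open>auto simp: \<eta>\<close>)
    also have "\<dots> = ?c * ?g l'" using l' by (simp add: mult.commute)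
    finally show ?thesis
      by (simp add: w_def row_times_diff_right row_times_sum_right row_times_scale_right)
  qed
  then have "w \<in> colspan \<phi> m" by (simp flip: kernel_\<xi>)
  then obtain a where "w = (\<Sum>i=1..m. a i *s \<phi> i)" by (auto simp: colspan_def)
  then have "row_times (\<beta> x) w = 0"
    by (simp add: row_times_sum_right row_times_scale_right \<beta>)
  then have "?c * ?c - (\<Sum>l=1..s. ?g l * content_coeff x l) = 0"
    by (simp add: w_def row_times_diff_right row_times_sum_right row_times_scale_right content_coeff_def \<beta>(2)[simplified])
  then show ?thesis by (simp add: mult_2 power_add)
qed

lemma \<gamma>_neq_0: "\<gamma> \<noteq> 0"
proof
  assume "\<gamma> = 0"
  have "psubst (\<lambda>l. pconst (content_coeff 1 l)) \<gamma> = (pconst (pvar 1 ^ (2 * K)) :: (nat, (2, 'k) mpol) mpol)"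
    unfolding content_\<gamma>[symmetric] by (simp add: \<gamma>_def tform_def psubst_sum psubst_mult pconst_sum pconst_mult)
  then have "pconst (pvar 1 ^ (2 * K)) = (pconst 0 :: (nat, (2, 'k) mpol) mpol)"
    using \<open>\<gamma> = 0\<close> by simp
  then show False by (simp only: pconst_inj pvar_power_neq_0)
qed

text \<open>
  With \<open>x\<^sup>2\<^sup>K = \<Sum>\<^sub>l c\<^sub>l \<gamma>\<^sub>l\<close>, the substitution \<open>t\<^sub>l \<mapsto> x\<^sup>2\<^sup>K t\<^sub>l - c\<^sub>l \<gamma>\<close> kills \<open>\<gamma>\<close>, hence \<open>y\<close>; modulo \<open>\<gamma>\<close> it
  agrees with scaling the variables by \<open>x\<^sup>2\<^sup>K\<close>.
\<close>

lemma \<gamma>_dvd_scaled: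
  assumes c: "c \<noteq> 0" "pconst c * y = \<gamma> * u"
  shows "\<gamma> dvd psubst (\<lambda>l. pconst (pvar x ^ (2 * K)) * pvar l) y"
proof -
  let ?C = "pconst (pvar x ^ (2 * K)) :: (nat, (2, 'k) mpol) mpol"
  define b where "b = (\<lambda>l. ?C * pvar l - pconst (content_coeff x l) * \<gamma>)"
  have "psubst b \<gamma> = ?C * \<gamma> - pconst (\<Sum>l=1..s. row_times (\<xi> l) (\<phi> (m + 1)) * content_coeff x l) * \<gamma>"
  proof -
    have "psubst b \<gamma> = (\<Sum>l=1..s. ?C * (pconst (row_times (\<xi> l) (\<phi> (m + 1))) * pvar l) -
        pconst (row_times (\<xi> l) (\<phi> (m + 1)) * content_coeff x l) * \<gamma>)"
      unfolding \<gamma>_def[unfolded tform_def] psubst_sum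
      by (rule sum.cong) (simp_all add: psubst_mult b_def \<gamma>_def tform_def pconst_mult right_diff_distrib mult_ac)
    then show ?thesis
      by (simp add: sum_subtractf pconst_sum flip: sum_distrib_left sum_distrib_right)
        (simp add: \<gamma>_def tform_def)
  qed
  then have "psubst b \<gamma> = 0" unfolding content_\<gamma> by simp
  then have "pconst c * psubst b y = 0"
    using arg_cong[OF c(2), of "psubst b"] by (simp add: psubst_mult)
  then have 0: "psubst b y = 0" by (rule pconst_mult_eq_0[OF _ c(1)])
  have J: "idl.subspace {z. \<gamma> dvd z}" by (rule idl.subspaceI) auto
  have "psubst (\<lambda>l. ?C * pvar l) y - psubst b y \<in> {z. \<gamma> dvd z}"
    by (rule subspace_psubst_diff[OF J]) (simp add: b_def)
  then show ?thesis by (simp add: 0)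
qed

text \<open>
  On a homogeneous component of \<open>y\<close> the scaling is multiplication by a power of \<open>x\<close>.  So \<open>\<gamma>\<close> divides
  the products of the component with powers of both variables, and these powers are coprime.
\<close>

lemma \<gamma>_dvd_of_multiple:
  assumes c: "c \<noteq> 0" "pconst c * y = \<gamma> * u"
  shows "\<gamma> dvd y"
proof -
  have part: "\<gamma> dvd pconst (pvar x ^ (2 * K * b)) * bicomp \<sigma> a b y" for x a b
  proof -
    let ?S = "psubst (\<lambda>l. pconst (pvar x ^ (2 * K)) * pvar l)
      :: (nat, (2, 'k) mpol) mpol \<Rightarrow> (nat, (2, 'k) mpol) mpol"
    obtain v where v: "?S y = \<gamma> * v" using \<gamma>_dvd_scaled[OF c] by (blast elim: dvdE)
    have hom: "?S F \<in> hforms \<sigma> (a + int (2 * K) * int b) b" if F: "F \<in> hforms \<sigma> a b" for F a b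
      unfolding psubst_scaled_hform[OF F]
      by (rule hforms_mult'[OF hforms_pconst F])
        (use forms_pvar_power[of x "2 * K * b"] in \<open>simp_all add: power_mult[symmetric]\<close>)
    have "bicomp \<sigma> (a + int (2 * K) * int b) b (?S y) = ?S (bicomp \<sigma> a b y)"
      by (rule bicomp_commute_shift[OF psubst_add hom])
    also have "\<dots> = pconst (pvar x ^ (2 * K * b)) * bicomp \<sigma> a b y"
      unfolding psubst_scaled_hform[OF bicomp_hforms] by (simp add: power_mult)
    finally show ?thesis unfolding v bicomp_mult[OF \<gamma>_hforms] by (metis dvd_0_right dvd_triv_left)
  qed
  have "\<gamma> dvd bicomp \<sigma> a b y" for a b
  proof -
    let ?y = "bicomp \<sigma> a b y" and ?X = "\<lambda>x. pconst (pvar x ^ (2 * K * b)) :: (nat, (2, 'k) mpol) mpol"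
    obtain u1 u2 where u: "?X 1 * ?y = \<gamma> * u1" "?X 2 * ?y = \<gamma> * u2"
      using part[of 1 b a] part[of 2 b a] by (blast elim: dvdE)
    have "\<gamma> * (?X 2 * u1) = ?X 2 * (\<gamma> * u1)" by (simp only: mult.left_commute)
    also have "\<dots> = ?X 1 * (\<gamma> * u2)" unfolding u[symmetric] by (simp only: mult.left_commute)
    also have "\<dots> = \<gamma> * (?X 1 * u2)" by (simp only: mult.left_commute)
    finally have eq: "?X 2 * u1 = ?X 1 * u2" using \<gamma>_neq_0 by simp
    have "(2 :: 2) \<noteq> 1" by simp
    from pvar_powers_coprime_coefficientwise[OF this eq] obtain u where "u1 = ?X 1 * u" .
    then have "?X 1 * ?y = ?X 1 * (\<gamma> * u)" by (simp only: u mult.left_commute)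
    then have "?X 1 * (?y - \<gamma> * u) = 0" by (simp only: right_diff_distrib) simp
    then have "?y - \<gamma> * u = 0" by (rule pconst_mult_eq_0) simp
    then show ?thesis by simp
  qed
  then show ?thesis
    using bicomp_closed[of \<sigma> y "{z. \<gamma> dvd z}"] by simp
qed

text \<open>
  The elements \<open>x\<^sup>K t\<^sub>l\<close> come from the linear forms of the \<open>\<eta> x l\<close>.
\<close>

lemma scaled_in_range:
  assumes "u \<in> P"
  obtains N U where "\<psi> U = pconst (pvar x ^ N) * u"
proof -
  have "keys u \<subseteq> {t. keys t \<subseteq> {1..s}}" using assms by (auto simp: P_iff)
  then have "\<exists>N U. \<psi> U = pconst (pvar x ^ N) * u"
  proof (induction u rule: mpol_induct_on)
    case zero
    show ?case by (rule exI[of _ 0], rule exI[of _ 0]) simp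
  next
    case (add F G)
    then obtain N U M W where *: "\<psi> U = pconst (pvar x ^ N) * F" "\<psi> W = pconst (pvar x ^ M) * G" by blast
    have "\<psi> (pconst (pvar x ^ M) * U + pconst (pvar x ^ N) * W) = pconst (pvar x ^ (N + M)) * (F + G)"
      by (simp only: \<psi>_simps * power_add pconst_mult distrib_left distrib_right mult_ac)
    then show ?case by blast
  next
    case (monom t c)
    let ?C = "pconst (pvar x ^ K) :: (nat, (2, 'k) mpol) mpol"
    have "\<psi> (pconst c * psubst (\<lambda>l. dotT (\<eta> x l)) (single t 1)) =
        pconst c * eval_monom (\<lambda>l. tform (\<lambda>l'. row_times (\<xi> l') (\<eta> x l))) t"
      by (simp add: \<psi>_def psubst_psubst psubst_mult) (simp add: psubst_single flip: \<psi>_dotT \<psi>_def)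
    also have "eval_monom (\<lambda>l. tform (\<lambda>l'. row_times (\<xi> l') (\<eta> x l))) t = eval_monom (\<lambda>l. ?C * pvar l) t"
      unfolding eval_monom_def
    proof (rule prod.cong)
      fix l assume "l \<in> keys t"
      then have l: "l \<in> {1..s}" using monom by blast
      have "tform (\<lambda>l'. row_times (\<xi> l') (\<eta> x l)) = tform (\<lambda>l'. if l' = l then pvar x ^ K else 0)"
        by (rule tform_cong) (simp add: \<eta>[OF l])
      then show "tform (\<lambda>l'. row_times (\<xi> l') (\<eta> x l)) ^ lookup t l = (?C * pvar l) ^ lookup t l"
        by (simp only: tform_unit[OF l])
    qed simp
    also have "pconst c * \<dots> = pconst ((pvar x ^ K) ^ mdeg t) * single t c"
      unfolding eval_monom_scaled single_eq_pconst_eval[of t c] by (simp only: mult.left_commute)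
    finally show ?case unfolding power_mult[symmetric] by blast
  qed
  with that show ?thesis by blast
qed

text \<open>
  From left to right this is primitivity of \<open>\<gamma>\<close>.  From right to left, a multiple \<open>\<gamma> u\<close> becomes the image
  of a multiple of \<open>g\<^sub>m\<^sub>+\<^sub>1\<close> after multiplication by a power of \<open>x\<close> that carries \<open>u\<close> into the image of
  \<open>\<psi>\<close>.
\<close>

lemma reesK_Suc_iff: "F \<in> reesK \<phi> (m + 1) \<longleftrightarrow> (\<exists>u\<in>P. \<psi> F = \<gamma> * u)"
proof
  assume "F \<in> reesK \<phi> (m + 1)"
  then obtain c where c: "c \<noteq> 0" "pconst c * F \<in> rel_ideal \<phi> (m + 1)" by (auto simp: reesK_iff)
  have "\<gamma> dvd \<psi> G" if "G \<in> rel_ideal \<phi> (m + 1)" for G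
    using that unfolding rel_ideal_def
  proof (induction rule: idl.span_induct_alt)
    case (step r x y)
    then obtain i where "i \<in> {1..m+1}" "x = dotT (\<phi> i)" by blast
    then have "\<gamma> dvd \<psi> x"
      using \<psi>_column[of i] \<psi>_new_column by (cases "i = m + 1") auto
    then show ?case using step by simp
  qed simp
  from this[OF c(2)] obtain u where "pconst c * \<psi> F = \<gamma> * u" by (auto elim: dvdE)
  from \<gamma>_dvd_of_multiple[OF c(1) this] obtain v where v: "\<psi> F = \<gamma> * v" by (blast elim: dvdE)
  (* the cofactor may involve variables beyond t_s, which can be set to zero *)
  define \<pi> where "\<pi> = psubst (\<lambda>l. if l \<in> {1..s} then pvar l else (0 :: (nat, (2, 'k) mpol) mpol))"
  have \<pi>_tform: "\<pi> (tform w) = tform w" for w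
    unfolding \<pi>_def tform_def psubst_sum by (rule sum.cong) (simp_all add: psubst_mult)
  have "\<psi> F = \<pi> (\<psi> F)"
    unfolding \<psi>_def \<pi>_def psubst_psubst unfolding \<pi>_def[symmetric] \<pi>_tform ..
  also have "\<pi> (\<psi> F) = \<pi> \<gamma> * \<pi> v" by (simp only: v \<pi>_def psubst_mult)
  also have "\<pi> \<gamma> = \<gamma>" unfolding \<gamma>_def by (rule \<pi>_tform)
  finally have "\<psi> F = \<gamma> * \<pi> v" .
  moreover have "\<pi> v \<in> P" unfolding \<pi>_def P_def by (rule psubst_closed) (use P_closed in \<open>simp add: P_def\<close>)
  ultimately show "\<exists>u\<in>P. \<psi> F = \<gamma> * u" by blast
next
  assume "\<exists>u\<in>P. \<psi> F = \<gamma> * u"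
  then obtain u where u: "u \<in> P" "\<psi> F = \<gamma> * u" by blast
  obtain N U where U: "\<psi> U = pconst (pvar 1 ^ N) * u" by (rule scaled_in_range[OF u(1)])
  have "\<psi> (pconst (pvar 1 ^ N) * F - dotT (\<phi> (m + 1)) * U) = 0"
    unfolding \<psi>_simps \<psi>_new_column u(2) U by (simp add: mult.left_commute)
  then obtain c where c: "c \<noteq> 0" "pconst c * (pconst (pvar 1 ^ N) * F - dotT (\<phi> (m + 1)) * U) \<in> rel_ideal \<phi> m"
    unfolding \<psi>_eq_0_iff reesK_iff by blast
  have sub: "rel_ideal \<phi> m \<subseteq> rel_ideal \<phi> (m + 1)"
    unfolding rel_ideal_def by (rule idl.span_mono) auto
  have "dotT (\<phi> (m + 1)) \<in> rel_ideal \<phi> (m + 1)" unfolding rel_ideal_def by (intro idl.span_base) auto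
  then have "(pconst c * U) * dotT (\<phi> (m + 1)) \<in> rel_ideal \<phi> (m + 1)"
    by (intro idl.subspace_scale subspace_rel_ideal)
  from idl.subspace_add[OF subspace_rel_ideal subsetD[OF sub c(2)] this]
  have "pconst (c * pvar 1 ^ N) * F \<in> rel_ideal \<phi> (m + 1)"
    by (simp add: right_diff_distrib pconst_mult mult_ac)
  then show "F \<in> reesK \<phi> (m + 1)" unfolding reesK_iff using c(1) by (intro exI[of _ "c * pvar 1 ^ N"]) simp
qed

section \<open>The Rees algebra in high degrees\<close>

definition vcomp :: "int \<Rightarrow> (2, 'k) mpol ^ 'n \<Rightarrow> (2, 'k) mpol ^ 'n" where
  "vcomp a v = (\<chi> j. hcomp a (v $ j))"

lemma vcomp_grading: "vcomp a v \<in> vec_grading a"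
  by (simp add: vcomp_def vec_grading_def hcomp_forms)

lemma row_times_vcomp:
  assumes "\<And>j. u $ j \<in> forms b"
  shows "row_times u (vcomp a v) = hcomp (a + b) (row_times u v)"
  unfolding row_times_def hcomp_sum vcomp_def
  by (rule sum.cong) (simp_all add: hcomp_mult[OF assms])

text \<open>
  This is the vanishing of the first local cohomology of \<open>E\<close>, which embeds into the second local
  cohomology of \<open>\<Oplus>\<^sub>i R(-\<delta> i)\<close>.  By hand: both \<open>x\<^sub>0\<^sup>K u\<close> and \<open>x\<^sub>1\<^sup>K u\<close> lift to \<open>R\<^sup>n\<close>.  The two lifts are
  compatible up to a combination of the columns, whose coefficients have degree at least \<open>2 K - 1\<close>
  and are therefore absorbed by the two powers.
\<close>

lemma high_degree_in_module:
  assumes u: "\<And>l. l \<in> {1..s} \<Longrightarrow> u l \<in> forms (b + int (\<sigma> l))" and b: "b \<ge> int (\<delta> m) - 1"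
  obtains v where "v \<in> vec_grading b" "\<And>l. l \<in> {1..s} \<Longrightarrow> row_times (\<xi> l) v = u l"
proof -
  let ?X = "\<lambda>x. pvar x ^ K :: (2, 'k) mpol"
  (* the two lifts *)
  define w where "w x = vcomp (b + int K) (\<Sum>l=1..s. u l *s \<eta> x l)" for x
  have w: "row_times (\<xi> l') (w x) = ?X x * u l'" if l': "l' \<in> {1..s}" for l' x
  proof -
    have "row_times (\<xi> l') (\<Sum>l=1..s. u l *s \<eta> x l) = (\<Sum>l=1..s. if l = l' then u l' * ?X x else 0)"
      unfolding row_times_sum_right row_times_scale_right
      by (rule sum.cong) (use l' in \<open>auto simp: \<eta>\<close>)
    also have "\<dots> = ?X x * u l'" using l' by (simp add: mult.commute)
    finally have "row_times (\<xi> l') (w x) = hcomp (b + int K + int (\<sigma> l')) (?X x * u l')"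
      unfolding w_def row_times_vcomp[OF \<xi>_forms[OF l']] by simp
    moreover have "?X x * u l' \<in> forms (b + int K + int (\<sigma> l'))"
      by (rule forms_mult'[OF forms_pvar_power u[OF l']]) simp
    ultimately show ?thesis using hcomp_of_form by metis
  qed
  have "?X 2 *s w 1 - ?X 1 *s w 2 \<in> colspan \<phi> m"
    unfolding kernel_\<xi>[symmetric] by (simp add: row_times_diff_right row_times_scale_right w mult.left_commute)
  then obtain a' where a': "?X 2 *s w 1 - ?X 1 *s w 2 = (\<Sum>i=1..m. a' i *s \<phi> i)"
    by (auto simp: colspan_def)
  (* their coefficients may be taken homogeneous *)
  define a where "a i = hcomp (b + 2 * int K - int (\<delta> i)) (a' i)" for i
  have a: "?X 2 *s w 1 - ?X 1 *s w 2 = (\<Sum>i=1..m. a i *s \<phi> i)"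
  proof -
    have "(?X 2 *s w 1 - ?X 1 *s w 2) $ j = (\<Sum>i=1..m. a i *s \<phi> i) $ j" for j
    proof -
      have wj: "w x $ j \<in> forms (b + int K)" for x
        using vcomp_grading by (simp add: w_def vec_grading_def)
      have "?X y * w x $ j \<in> forms (b + 2 * int K)" for x y
        by (rule forms_mult'[OF forms_pvar_power wj]) simp
      then have "(?X 2 *s w 1 - ?X 1 *s w 2) $ j \<in> forms (b + 2 * int K)"
        by (simp add: forms_diff)
      then have "(?X 2 *s w 1 - ?X 1 *s w 2) $ j = hcomp (b + 2 * int K) ((?X 2 *s w 1 - ?X 1 *s w 2) $ j)"
        by (metis hcomp_of_form)
      also have "\<dots> = (\<Sum>i=1..m. hcomp (b + 2 * int K) (\<phi> i $ j * a' i))"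
        unfolding a' by (simp add: hcomp_sum mult.commute)
      also have "\<dots> = (\<Sum>i=1..m. a i * \<phi> i $ j)"
      proof (rule sum.cong)
        fix i assume "i \<in> {1..m}"
        then have "\<phi> i $ j \<in> forms (int (\<delta> i))" using \<phi>_forms[of i] by (simp add: vec_grading_def)
        from hcomp_mult[OF this] show "hcomp (b + 2 * int K) (\<phi> i $ j * a' i) = a i * \<phi> i $ j"
          unfolding a_def by (simp only: mult.commute)
      qed simp
      finally show ?thesis by simp
    qed
    then show ?thesis unfolding vec_eq_iff by blast
  qed
  have "\<exists>p q. a i = ?X 2 * p - ?X 1 * q" if "i \<in> {1..m}" for i
    by (rule high_degree_form_in_power_ideal[of "a i" "b + 2 * int K - int (\<delta> i)" K 2 1])
      (use \<delta>_le[OF that] b in \<open>auto simp: a_def hcomp_forms\<close>)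
  then obtain p q where pq: "\<And>i. i \<in> {1..m} \<Longrightarrow> a i = ?X 2 * p i - ?X 1 * q i" by metis
  define v1 v2 where "v1 = w 1 - (\<Sum>i=1..m. p i *s \<phi> i)" and "v2 = w 2 - (\<Sum>i=1..m. q i *s \<phi> i)"
  have "(\<Sum>i=1..m. a i *s \<phi> i) = ?X 2 *s (\<Sum>i=1..m. p i *s \<phi> i) - ?X 1 *s (\<Sum>i=1..m. q i *s \<phi> i)"
    unfolding smult_sum_right sum_subtractf[symmetric]
    by (rule sum.cong) (simp_all add: pq vector_sub_rdistrib vector_smult_assoc)
  then have "?X 2 *s w 1 - ?X 1 *s w 2 = ?X 2 *s (\<Sum>i=1..m. p i *s \<phi> i) - ?X 1 *s (\<Sum>i=1..m. q i *s \<phi> i)"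
    by (simp only: a)
  then have "?X 2 *s v1 = ?X 1 *s v2"
    unfolding v1_def v2_def vector_ssub_ldistrib by (simp add: algebra_simps)
  then have "?X 2 * v1 $ j = ?X 1 * v2 $ j" for j by (metis vector_smult_component)
  then have "\<exists>h. v1 $ j = ?X 1 * h" for j by (rule pvar_powers_coprime[of 2 1, rotated]) auto
  then obtain h where h: "\<And>j. v1 $ j = ?X 1 * h j" by metis
  define v where "v = (\<chi> j. h j)"
  have v1: "v1 = ?X 1 *s v" by (simp add: vec_eq_iff v_def h)
  have rv: "row_times (\<xi> l) v = u l" if l: "l \<in> {1..s}" for l
  proof -
    have "(\<Sum>i=1..m. p i *s \<phi> i) \<in> colspan \<phi> m" by (auto simp: colspan_def)
    then have "row_times (\<xi> l) v1 = ?X 1 * u l"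
      using l unfolding kernel_\<xi>[symmetric] by (simp add: v1_def row_times_diff_right w)
    then show ?thesis by (simp add: v1 row_times_scale_right)
  qed
  have "row_times (\<xi> l) (vcomp b v) = u l" if l: "l \<in> {1..s}" for l
    unfolding row_times_vcomp[OF \<xi>_forms[OF l]] rv[OF l] using hcomp_of_form[OF u[OF l]] by simp
  then show ?thesis using that vcomp_grading by blast
qed

text \<open>
  One variable \<open>t\<^sub>l\<close> at a time, with its scalar coefficient, is written in terms of the generators of
  the module; the remaining factor keeps the \<open>x\<close>-degree.
\<close>

lemma high_degree_in_range:
  assumes a: "a \<ge> int (\<delta> m) - 1" and y: "y \<in> P" "y \<in> hforms \<sigma> a b"
  obtains F where "F \<in> biforms a b" "\<psi> F = y"
proof -
  have "\<exists>F\<in>biforms a b. \<psi> F = y"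
    using y
  proof (induction b arbitrary: y)
    case 0
    have "y = pconst (lookup y 0)"
      by (rule poly_mapping_eqI)
        (use 0 in \<open>auto simp: hforms_iff_lookup pconst_def lookup_single when_def\<close>)
    moreover have "lookup y 0 \<in> forms a" using 0 by (auto simp: hforms_iff_lookup dest: spec[of _ 0])
    ultimately show ?case
      unfolding biforms_eq_hforms by (metis \<psi>_simps(4) hforms_pconst)
  next
    case (Suc b)
    have "keys y \<subseteq> {t. keys t \<subseteq> {1..s} \<and> mdeg t = Suc b \<and> lookup y t \<in> forms (a + int (wt \<sigma> t))}"
      using Suc.prems by (auto simp: P_iff hforms_def)
    then show ?case
    proof (induction y rule: mpol_induct_on)
      case zero
      show ?case by (rule bexI[of _ 0]) (simp_all add: biforms_eq_hforms)
    next
      case (add F G)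
      then show ?case by (metis \<psi>_simps(1) biforms_eq_hforms hforms_add)
    next
      case (monom t c)
      then have t: "keys t \<subseteq> {1..s}" "mdeg t = Suc b" "c \<in> forms (a + int (wt \<sigma> t))" by auto
      have "keys t \<noteq> {}" using t(2) by (metis mdeg_def sum.empty Zero_not_Suc)
      then obtain l where "l \<in> keys t" by blast
      then obtain t' where t': "t = single l 1 + t'" "keys t' \<subseteq> keys t" by (rule split_off_variable)
      have l: "l \<in> {1..s}" using t(1) \<open>l \<in> keys t\<close> by blast
      have deg: "wt \<sigma> t = \<sigma> l + wt \<sigma> t'" "mdeg t' = b" using t(2) by (simp_all add: t'(1) wt_add mdeg_add)
      obtain v where v: "v \<in> vec_grading (a + int (wt \<sigma> t'))"
        "\<And>l'. l' \<in> {1..s} \<Longrightarrow> row_times (\<xi> l') v = (if l' = l then c else 0)"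
        by (rule high_degree_in_module[of "\<lambda>l'. if l' = l then c else 0" "a + int (wt \<sigma> t')"])
          (use a t(3) in \<open>auto simp: deg algebra_simps\<close>)
      have "tform (\<lambda>l'. row_times (\<xi> l') v) = pconst c * pvar l"
        unfolding tform_unit[OF l, symmetric] by (rule tform_cong) (rule v(2))
      then have \<psi>v: "\<psi> (dotT v) = pconst c * pvar l" by (simp add: \<psi>_dotT)
      have "\<exists>F\<in>biforms a b. \<psi> F = single t' (v $ j)" for j
      proof (rule Suc.IH)
        show "single t' (v $ j) \<in> P" using t'(2) t(1) by (auto simp: P_iff)
        show "single t' (v $ j) \<in> hforms \<sigma> a b"
          using v(1) deg(2) by (intro hforms_single) (simp_all add: vec_grading_def)
      qed
      then obtain F where F: "\<And>j. F j \<in> biforms a b" "\<And>j. \<psi> (F j) = single t' (v $ j)" by metis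
      have "\<psi> (\<Sum>j\<in>UNIV. pvar j * F j) = (\<Sum>j\<in>UNIV. \<psi> (pvar j) * (pconst (v $ j) * single t' 1))"
        by (simp add: \<psi>_sum F pconst_def mult_single)
      also have "\<dots> = \<psi> (dotT v) * single t' 1"
        by (simp add: dotT_def \<psi>_sum sum_distrib_right mult.assoc)
      also have "\<dots> = single t c"
        by (simp add: \<psi>v t'(1) pconst_def pvar_def mult_single)
      finally have "\<psi> (\<Sum>j\<in>UNIV. pvar j * F j) = single t c" .
      moreover have "(\<Sum>j\<in>UNIV. pvar j * F j) \<in> biforms a (Suc b)"
        using F(1) unfolding biforms_eq_hforms
        by (intro hforms_sum hforms_mult'[OF hforms_pvar[OF refl]]) auto
      ultimately show ?case by blast
    qed
  qed
  with that show ?thesis by blast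
qed

end

section \<open>Constant coefficients\<close>

interpretation kv: vector_space
  "\<lambda>(c :: 'k::field) (F :: ('w, ('v, 'k) mpol) mpol). pconst (pconst c) * F"
  by unfold_locales (simp_all add: distrib_left distrib_right pconst_add pconst_mult mult.assoc)

lemma single_eq_0_iff [simp]: "single t c = 0 \<longleftrightarrow> c = 0"
  by (metis lookup_single_eq lookup_zero single_zero)

lemma lookup_mult_zero: "lookup (F * G) 0 = lookup F 0 * lookup G 0"
  for F G :: "('v, 'a::comm_ring_1) mpol"
proof (induction F rule: mpol_induct)
  case (monom t c)
  show ?case
  proof (induction G rule: mpol_induct)
    case (monom u d)
    have "t + u = 0 \<longleftrightarrow> t = 0 \<and> u = 0"
      by (metis add_is_0 add.right_neutral mdeg_add mdeg_eq_0_iff)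
    then show ?case by (auto simp: mult_single lookup_single when_def)
  qed (simp add: distrib_left lookup_add)
qed (simp add: distrib_right lookup_add)

lemma lookup_single_mult:
  fixes F :: "('v, 'a::comm_ring_1) mpol"
  shows "lookup (single v c * F) (v + w) = c * lookup F w"
proof (induction F rule: mpol_induct)
  case (monom u d)
  then show ?case by (simp add: mult_single lookup_single when_def)
qed (simp add: distrib_left lookup_add)

lemma lookup_single_mult_neq_0:
  assumes "lookup (single v c * F) t \<noteq> 0"
  obtains w where "t = v + w"
proof -
  have "t \<in> keys (single v c * F)" using assms by (simp add: in_keys_iff)
  then show ?thesis using that keys_mult[of "single v c" F] by (fastforce split: if_splits)
qed

lemma bicomp_eq_0_of_neg: "a < 0 \<Longrightarrow> bicomp (\<lambda>_. 0) a b F = 0"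
proof -
  assume "a < 0"
  then have "hcomp a G = 0" for G :: "('b, 'c) mpol" by (metis forms_neg hcomp_forms)
  then show ?thesis by (intro poly_mapping_eqI) (simp add: lookup_bicomp)
qed

lemma genideal_Quot:
  assumes N: "idl.subspace N"
  shows "Idl\<^bsub>poly_ring UNIV Quot N\<^esub> ((\<lambda>F. N +>\<^bsub>poly_ring UNIV\<^esub> F) ` A) =
    (\<lambda>F. N +>\<^bsub>poly_ring UNIV\<^esub> F) ` idl.span (A \<union> N)"
proof -
  interpret ring "poly_ring UNIV" by (rule ring_poly_ring)
  have N': "ideal N (poly_ring UNIV)" using N by (simp add: ideal_poly_ring_iff)
  interpret N: ideal N "poly_ring UNIV" by (rule N')
  interpret Q: ring "poly_ring UNIV Quot N" by (rule N.quotient_is_ring)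
  let ?im = "\<lambda>F. N +>\<^bsub>poly_ring UNIV\<^esub> F"
  have carr: "?im ` A' \<subseteq> carrier (poly_ring UNIV Quot N)" for A'
    by (auto simp: FactRing_def A_RCOSETS_def')
  show ?thesis
  proof (rule antisym)
    have "ideal (?im ` idl.span (A \<union> N)) (poly_ring UNIV Quot N)"
      by (rule ring_ideal_imp_quot_ideal[OF N']) (simp add: ideal_poly_ring_iff)
    then show "Idl\<^bsub>poly_ring UNIV Quot N\<^esub> (?im ` A) \<subseteq> ?im ` idl.span (A \<union> N)"
      by (rule Q.genideal_minimal) (auto intro: idl.span_base)
    define J where "J = Idl\<^bsub>poly_ring UNIV Quot N\<^esub> (?im ` A)"
    have J: "ideal J (poly_ring UNIV Quot N)" unfolding J_def by (rule Q.genideal_ideal[OF carr])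
    have "ideal {F \<in> carrier (poly_ring UNIV). ?im F \<in> J} (poly_ring UNIV)"
      by (rule ring_hom_ring.ideal_vimage[OF N.rcos_ring_hom_ring J])
    then have "idl.subspace {F. ?im F \<in> J}" by (simp add: ideal_poly_ring_iff)
    moreover have "A \<subseteq> {F. ?im F \<in> J}"
      using Q.genideal_self[OF carr[of A]] by (auto simp: J_def)
    moreover have "N \<subseteq> {F. ?im F \<in> J}"
    proof
      fix F assume "F \<in> N"
      then have "?im F = \<zero>\<^bsub>poly_ring UNIV Quot N\<^esub>"
        by (simp add: FactRing_def N.a_rcos_const)
      then show "F \<in> {F. ?im F \<in> J}"
        using additive_subgroup.zero_closed[OF ideal.axioms(1)[OF J]] by simp
    qed
    ultimately have "idl.span (A \<union> N) \<subseteq> {F. ?im F \<in> J}" by (intro idl.span_minimal Un_least)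
    then show "?im ` idl.span (A \<union> N) \<subseteq> Idl\<^bsub>poly_ring UNIV Quot N\<^esub> (?im ` A)"
      unfolding J_def by blast
  qed
qed

section \<open>Generators of high degree\<close>

text \<open>
  The variables of negative \<open>x\<close>-degree are \<open>t\<^sub>1, \<dots>, t\<^sub>r\<close>.
\<close>

locale high_degree_generators = module_in_free_module \<phi> \<xi> \<delta> \<sigma> m s K \<eta> \<beta>
  for \<phi> \<xi> :: "nat \<Rightarrow> (2, 'k::field) mpol ^ 'n" and \<delta> \<sigma> :: "nat \<Rightarrow> nat" and m s K :: nat
    and \<eta> :: "2 \<Rightarrow> nat \<Rightarrow> (2, 'k) mpol ^ 'n" and \<beta> :: "2 \<Rightarrow> (2, 'k) mpol ^ 'n" +
  fixes r :: nat
  assumes r: "r \<le> s"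
    and \<sigma>_pos: "\<And>i. i \<in> {1..r} \<Longrightarrow> 0 < \<sigma> i"
    and \<sigma>_zero: "\<And>i. i \<in> {r+1..s} \<Longrightarrow> \<sigma> i = 0"
begin

definition "X = multi_indices s r \<sigma> (\<delta> (m + 1) - \<delta> m)"

lemma X_iff: "\<alpha> \<in> X \<longleftrightarrow> (\<forall>i. i \<notin> {1..r} \<longrightarrow> \<alpha> i = 0) \<and> weight s \<sigma> \<alpha> \<le> \<delta> (m + 1) - \<delta> m"
  unfolding X_def multi_indices_def using r by auto

definition expo :: "(nat \<Rightarrow> nat) \<Rightarrow> (nat \<Rightarrow>\<^sub>0 nat)" where
  "expo \<alpha> = (\<Sum>i=1..s. single i (\<alpha> i))"

lemma lookup_expo: "lookup (expo \<alpha>) i = (if i \<in> {1..s} then \<alpha> i else 0)"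
  unfolding expo_def by (simp add: lookup_sum lookup_single when_def)

lemma expo_keys: "\<alpha> \<in> X \<Longrightarrow> keys (expo \<alpha>) \<subseteq> {1..r}"
  by (auto simp: X_iff in_keys_iff lookup_expo split: if_splits)

lemma expo_inj: "inj_on expo X"
proof (rule inj_onI)
  fix \<alpha> \<beta> assume *: "\<alpha> \<in> X" "\<beta> \<in> X" "expo \<alpha> = expo \<beta>"
  have "\<alpha> i = \<beta> i" for i
  proof (cases "i \<in> {1..s}")
    case True
    then show ?thesis using arg_cong[OF *(3), of "\<lambda>t. lookup t i"] by (simp add: lookup_expo)
  next
    case False
    then have "i \<notin> {1..r}" using r by auto
    then show ?thesis using *(1,2) by (simp add: X_iff)
  qed
  then show "\<alpha> = \<beta>" by (rule ext)
qed

lemma expo_lookup: "keys t \<subseteq> {1..s} \<Longrightarrow> expo (lookup t) = t"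
  by (rule poly_mapping_eqI) (auto simp: lookup_expo in_keys_iff subset_iff)

lemma lookup_in_X:
  assumes "keys t \<subseteq> {1..r}" "wt \<sigma> t \<le> \<delta> (m + 1) - \<delta> m"
  shows "lookup t \<in> X"
proof -
  have "weight s \<sigma> (lookup t) = wt \<sigma> t"
    unfolding weight_def using assms(1) r by (subst wt_superset[of "{1..s}"]) auto
  moreover have "lookup t i = 0" if "i \<notin> {1..r}" for i
    using that assms(1) by (auto simp: in_keys_iff)
  ultimately show ?thesis using assms(2) by (simp add: X_iff)
qed

definition tmon :: "(nat \<Rightarrow> nat) \<Rightarrow> (nat, (2, 'k) mpol) mpol" where
  "tmon \<alpha> = single (expo \<alpha>) 1"

lemma tmon_inj: "inj_on tmon X"
proof (rule inj_onI)
  fix \<alpha> \<beta> assume *: "\<alpha> \<in> X" "\<beta> \<in> X" "tmon \<alpha> = tmon \<beta>"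
  then have "expo \<alpha> = expo \<beta>" unfolding tmon_def
    by (metis lookup_single_eq lookup_single_not_eq zero_neq_one)
  then show "\<alpha> = \<beta>" using expo_inj *(1,2) by (auto dest: inj_onD)
qed

definition "\<K> = reesK \<phi> (m + 1)"

abbreviation "\<K>\<^sub>0 \<equiv> reesK \<phi> m"

lemma \<K>_iff: "F \<in> \<K> \<longleftrightarrow> (\<exists>u\<in>P. \<psi> F = \<gamma> * u)"
  unfolding \<K>_def by (rule reesK_Suc_iff)

lemma \<K>I: "u \<in> P \<Longrightarrow> \<psi> F = \<gamma> * u \<Longrightarrow> F \<in> \<K>"
  unfolding \<K>_iff by blast

lemma \<K>\<^sub>0_subset: "\<K>\<^sub>0 \<subseteq> \<K>"
proof
  fix F assume "F \<in> \<K>\<^sub>0"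
  then have "\<psi> F = \<gamma> * 0" by (simp add: \<psi>_eq_0_iff)
  then show "F \<in> \<K>" by (rule \<K>I[OF P_closed(4)])
qed

lemma subspace_\<K> [simp]: "idl.subspace \<K>"
  unfolding \<K>_def by (rule subspace_reesK)

lemma \<K>_closed: "F \<in> \<K> \<Longrightarrow> G \<in> \<K> \<Longrightarrow> F + G \<in> \<K>" "F \<in> \<K> \<Longrightarrow> H * F \<in> \<K>" "0 \<in> \<K>"
  and \<K>\<^sub>0_closed: "F \<in> \<K>\<^sub>0 \<Longrightarrow> G \<in> \<K>\<^sub>0 \<Longrightarrow> F + G \<in> \<K>\<^sub>0" "F \<in> \<K>\<^sub>0 \<Longrightarrow> H * F \<in> \<K>\<^sub>0" "0 \<in> \<K>\<^sub>0"
  using idl.subspace_add[OF subspace_reesK] idl.subspace_scale[OF subspace_reesK]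
    idl.subspace_0[OF subspace_reesK] unfolding \<K>_def by blast+

lemma bicomp_\<K>\<^sub>0: "F \<in> \<K>\<^sub>0 \<Longrightarrow> bicomp (\<lambda>_. 0) a b F \<in> \<K>\<^sub>0"
  by (simp add: \<psi>_bicomp flip: \<psi>_eq_0_iff)

text \<open>
  The component of a multiple of \<open>\<gamma>\<close> is \<open>\<gamma>\<close> times a component of the cofactor.  For \<open>b = 0\<close> it vanishes,
  and so does \<open>u\<close>.
\<close>

lemma homogeneous_cofactor:
  assumes "F \<in> \<K>"
  obtains u where "u \<in> P" "u \<in> hforms \<sigma> (a - int (\<delta> (m + 1))) (b - 1)"
    "\<psi> (bicomp (\<lambda>_. 0) a b F) = \<gamma> * u"
proof -
  obtain u where u: "u \<in> P" "\<psi> F = \<gamma> * u" using assms unfolding \<K>_iff by blast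
  let ?u = "bicomp \<sigma> (a - int (\<delta> (m + 1))) (b - 1) u"
  have eq: "\<psi> (bicomp (\<lambda>_. 0) a b F) = (if 1 \<le> b then \<gamma> * ?u else 0)"
    unfolding \<psi>_bicomp u(2) by (rule bicomp_mult[OF \<gamma>_hforms])
  show ?thesis
  proof (cases "1 \<le> b")
    case True
    then show ?thesis using eq that[of ?u] by (simp add: bicomp_in_P u(1) bicomp_hforms)
  next
    case False
    then show ?thesis using eq that[of 0] by (simp add: P_closed)
  qed
qed

lemma bicomp_\<K>: "F \<in> \<K> \<Longrightarrow> bicomp (\<lambda>_. 0) a b F \<in> \<K>"
  by (metis homogeneous_cofactor \<K>I)

text \<open>
  The ideal \<open>S\<^sub>+ \<K>\<^sub>m\<^sub>+\<^sub>1 + \<K>\<^sub>m\<close>: minimal generators of \<open>\<K>\<^sub>m\<^sub>+\<^sub>1 \<R>(E)\<close> correspond to bases of \<open>\<K>\<^sub>m\<^sub>+\<^sub>1\<close> modulo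
  it.
\<close>

definition J :: "('n, (2, 'k) mpol) mpol set" where
  "J = idl.span ({pconst (pvar x) * F |x F. F \<in> \<K>} \<union> {pvar j * F |j F. F \<in> \<K>} \<union> \<K>\<^sub>0)"

lemma J_closed: "F \<in> J \<Longrightarrow> G \<in> J \<Longrightarrow> F + G \<in> J" "F \<in> J \<Longrightarrow> H * F \<in> J" "0 \<in> J"
  unfolding J_def by (auto intro: idl.span_add idl.span_scale idl.span_zero)

lemma kv_subspace_J: "kv.subspace J"
  by (rule kv.subspaceI) (simp_all add: J_closed)

lemma J_base: "F \<in> \<K> \<Longrightarrow> pconst (pvar x) * F \<in> J" "F \<in> \<K> \<Longrightarrow> pvar j * F \<in> J" "F \<in> \<K>\<^sub>0 \<Longrightarrow> F \<in> J"
  unfolding J_def by (rule idl.span_base, blast)+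

text \<open>
  The kernel of the map to \<open>k[t\<^sub>1, \<dots>, t\<^sub>r]\<close> that sends \<open>x\<^sub>0\<close>, \<open>x\<^sub>1\<close> and the other variables to zero.
\<close>

definition Z :: "(nat, (2, 'k) mpol) mpol set" where
  "Z = {u. \<forall>t. keys t \<subseteq> {1..r} \<longrightarrow> lookup (lookup u t) 0 = 0}"

lemma subspace_Z: "idl.subspace Z"
proof (rule idl.subspaceI)
  show "0 \<in> Z" by (simp add: Z_def)
  show add: "u + v \<in> Z" if "u \<in> Z" "v \<in> Z" for u v using that by (simp add: Z_def lookup_add)
  show "w * u \<in> Z" if u: "u \<in> Z" for w u
  proof (induction w rule: mpol_induct)
    case (monom v c)
    have "lookup (lookup (single v c * u) t) 0 = 0" if t: "keys t \<subseteq> {1..r}" for t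
    proof (cases "lookup (single v c * u) t = 0")
      case False
      then obtain w where w: "t = v + w" by (rule lookup_single_mult_neq_0)
      then have "keys w \<subseteq> {1..r}" using t by (simp add: keys_add_nat)
      then show ?thesis using u by (simp add: w lookup_single_mult lookup_mult_zero Z_def)
    qed simp
    then show ?case by (simp add: Z_def)
  next
    case (add F G)
    then show ?case by (simp add: distrib_right Z_def lookup_add)
  qed
qed

lemma Z_scale: "u \<in> Z \<Longrightarrow> w * u \<in> Z" "u \<in> Z \<Longrightarrow> u * w \<in> Z"
  using idl.subspace_scale[OF subspace_Z] by (auto simp: mult.commute)

lemma pconst_in_Z: "lookup c 0 = 0 \<Longrightarrow> pconst c \<in> Z"
  by (simp add: Z_def pconst_def lookup_single when_def)

text \<open>
  A coefficient of \<open>t\<^sub>1, \<dots>, t\<^sub>r\<close> in a generator of the module has positive degree.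
\<close>

lemma generator_in_Z: "\<psi> (pvar j) \<in> Z"
  unfolding \<psi>_pvar tform_def
proof (rule idl.subspace_sum[OF subspace_Z])
  fix l assume l: "l \<in> {1..s}"
  show "pconst (\<xi> l $ j) * pvar l \<in> Z"
  proof (cases "l \<le> r")
    case True
    have "0 \<notin> keys (\<xi> l $ j)"
      using \<xi>_forms[OF l, of j] \<sigma>_pos[of l] True l by (auto simp: forms_def)
    then have "lookup (\<xi> l $ j) 0 = 0" by (simp add: in_keys_iff)
    then show ?thesis by (rule Z_scale(2)[OF pconst_in_Z])
  next
    case False
    then have "pvar l \<in> Z" by (auto simp: Z_def pvar_def lookup_single when_def)
    then show ?thesis by (rule Z_scale)
  qed
qed

lemma \<psi>_J:
  assumes "F \<in> J"
  obtains z where "z \<in> Z" "\<psi> F = \<gamma> * z"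
proof -
  have "\<exists>z\<in>Z. \<psi> F = \<gamma> * z"
    using assms unfolding J_def
  proof (induction rule: idl.span_induct_alt)
    case base
    show ?case by (rule bexI[of _ 0]) (simp_all add: idl.subspace_0[OF subspace_Z])
  next
    case (step w x y)
    have "\<exists>z\<in>Z. \<psi> x = \<gamma> * z"
    proof -
      from step(1) consider (x) i F where "x = pconst (pvar i) * F" "F \<in> \<K>"
        | (T) j F where "x = pvar j * F" "F \<in> \<K>" | (0) "x \<in> \<K>\<^sub>0" by blast
      then show ?thesis
      proof cases
        case x
        then obtain u where "\<psi> F = \<gamma> * u" unfolding \<K>_iff by blast
        then have "\<psi> x = \<gamma> * (pconst (pvar i) * u)" by (simp add: x mult.left_commute)
        moreover have "pconst (pvar i) * u \<in> Z"
          by (rule Z_scale(2), rule pconst_in_Z) (simp add: pvar_def lookup_single when_def)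
        ultimately show ?thesis by blast
      next
        case T
        then obtain u where "\<psi> F = \<gamma> * u" unfolding \<K>_iff by blast
        then have "\<psi> x = \<gamma> * (\<psi> (pvar j) * u)" by (simp add: T mult.left_commute)
        moreover have "\<psi> (pvar j) * u \<in> Z" by (rule Z_scale(2), rule generator_in_Z)
        ultimately show ?thesis by blast
      next
        case 0
        then have "\<psi> x = \<gamma> * 0" by (simp add: \<psi>_eq_0_iff)
        then show ?thesis using idl.subspace_0[OF subspace_Z] by blast
      qed
    qed
    then obtain z z' where "z \<in> Z" "z' \<in> Z" "\<psi> x = \<gamma> * z" "\<psi> y = \<gamma> * z'" using step by blast
    then show ?case
      by (intro bexI[of _ "\<psi> w * z + z'"])
        (auto simp: distrib_left mult.left_commute intro: idl.subspace_add[OF subspace_Z] Z_scale)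
  qed
  with that show ?thesis by blast
qed

text \<open>
  Dividing the image of the sum by \<open>\<gamma>\<close> gives an element of \<open>Z\<close>, whose constant coefficients at the
  monomials \<open>t\<^sup>\<alpha>\<close> vanish.
\<close>

lemma independent_modulo_J:
  assumes h: "\<And>\<alpha>. \<alpha> \<in> Y \<Longrightarrow> \<psi> (h \<alpha>) = \<gamma> * tmon \<alpha>" and Y: "finite Y" "Y \<subseteq> X"
    and sum: "(\<Sum>\<alpha>\<in>Y. pconst (pconst (c \<alpha>)) * h \<alpha>) \<in> J" and \<alpha>: "\<alpha> \<in> Y"
  shows "c \<alpha> = 0"
proof -
  obtain z where z: "z \<in> Z" "\<psi> (\<Sum>\<alpha>\<in>Y. pconst (pconst (c \<alpha>)) * h \<alpha>) = \<gamma> * z"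
    using \<psi>_J[OF sum] by blast
  have "\<psi> (\<Sum>\<alpha>\<in>Y. pconst (pconst (c \<alpha>)) * h \<alpha>) = \<gamma> * (\<Sum>\<alpha>\<in>Y. pconst (pconst (c \<alpha>)) * tmon \<alpha>)"
    by (simp add: \<psi>_sum h sum_distrib_left mult.left_commute)
  then have "z = (\<Sum>\<alpha>\<in>Y. pconst (pconst (c \<alpha>)) * tmon \<alpha>)" using z(2) \<gamma>_neq_0 by simp
  then have "lookup (lookup z (expo \<alpha>)) 0 =
      (\<Sum>\<beta>\<in>Y. lookup (pconst (c \<beta>) * lookup (tmon \<beta>) (expo \<alpha>)) 0)"
    by (simp add: lookup_sum lookup_pconst_mult)
  also have "\<dots> = (\<Sum>\<beta>\<in>Y. if \<beta> = \<alpha> then c \<alpha> else 0)"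
  proof (rule sum.cong)
    fix \<beta> assume "\<beta> \<in> Y"
    then have "expo \<beta> = expo \<alpha> \<longleftrightarrow> \<beta> = \<alpha>" using expo_inj \<alpha> Y(2) by (auto dest: inj_onD)
    then show "lookup (pconst (c \<beta>) * lookup (tmon \<beta>) (expo \<alpha>)) 0 = (if \<beta> = \<alpha> then c \<alpha> else 0)"
      by (auto simp: tmon_def lookup_single when_def lookup_pconst_mult)
  qed simp
  also have "\<dots> = c \<alpha>" using Y(1) \<alpha> by simp
  finally show ?thesis using z(1) expo_keys \<alpha> Y(2) by (auto simp: Z_def)
qed

text \<open>
  Splitting a variable off \<open>c\<close> leaves a multiple of \<open>\<gamma>\<close> of \<open>x\<close>-degree at least \<open>\<delta> m - 1\<close>, which lies in
  the Rees algebra.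
\<close>

lemma positive_degree_multiple:
  assumes c: "c \<in> forms (a + int (wt \<sigma> t))" and pos: "a + int (wt \<sigma> t) > 0"
    and a: "a + int (\<delta> (m + 1)) \<ge> int (\<delta> m)" and t: "keys t \<subseteq> {1..s}"
  obtains F where "F \<in> J" "\<psi> F = \<gamma> * single t c"
proof -
  let ?e = "a + int (wt \<sigma> t)"
  obtain G H where GH: "c = pvar 1 ^ 1 * G - pvar 2 ^ 1 * H"
    by (rule high_degree_form_in_power_ideal[OF c, of 1 1 2]) (use pos in auto)
  define c1 c2 where "c1 = hcomp (?e - 1) G" and "c2 = hcomp (?e - 1) H"
  have "c = hcomp ?e c" using hcomp_of_form[OF c] by simp
  also have "\<dots> = hcomp ?e (pvar 1 * G) - hcomp ?e (pvar 2 * H)"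
    by (subst GH) (simp add: poly_mapping_eq_iff fun_eq_iff lookup_hcomp lookup_minus)
  finally have c12: "c = pvar 1 * c1 - pvar 2 * c2"
    by (simp add: c1_def c2_def hcomp_mult[OF forms_pvar])
  have lift: "\<exists>F\<in>\<K>. \<psi> F = \<gamma> * single t b" if b: "b \<in> forms (?e - 1)" for b
  proof -
    have "single t b \<in> hforms \<sigma> (a - 1) (mdeg t)" by (rule hforms_single) (use b in \<open>simp_all add: algebra_simps\<close>)
    then have "\<gamma> * single t b \<in> hforms \<sigma> (int (\<delta> (m + 1)) + (a - 1)) (1 + mdeg t)"
      by (rule hforms_mult[OF \<gamma>_hforms])
    moreover have st: "single t b \<in> P" using t by (simp add: P_iff)
    then have "\<gamma> * single t b \<in> P" unfolding \<gamma>_def by (intro P_closed tform_in_P)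
    moreover have "int (\<delta> (m + 1)) + (a - 1) \<ge> int (\<delta> m) - 1" using a by simp
    ultimately obtain F where "\<psi> F = \<gamma> * single t b"
      using high_degree_in_range by blast
    then show ?thesis using \<K>I[OF st] by blast
  qed
  obtain F1 F2 where F: "F1 \<in> \<K>" "F2 \<in> \<K>" "\<psi> F1 = \<gamma> * single t c1" "\<psi> F2 = \<gamma> * single t c2"
    using lift[of c1] lift[of c2] hcomp_forms by (metis c1_def c2_def)
  have "pconst (pvar 1) * F1 + (- 1) * (pconst (pvar 2) * F2) \<in> J"
    by (intro J_closed J_base F)
  moreover have "\<psi> (pconst (pvar 1) * F1 + (- 1) * (pconst (pvar 2) * F2)) = \<gamma> * single t c"
  proof -
    have "single t c = pconst (pvar 1) * single t c1 - pconst (pvar 2) * single t c2"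
      by (simp add: c12 pconst_def mult_single single_diff)
    then show ?thesis by (simp add: F right_diff_distrib mult.left_commute)
  qed
  ultimately show ?thesis by (rule that)
qed

text \<open>
  A variable of degree zero is, up to \<open>t\<^sub>1, \<dots>, t\<^sub>r\<close>, an element of the module: take the coefficients of \<open>x\<^sup>K\<close>
  in the coordinates of a preimage of \<open>x\<^sup>K t\<^sub>l\<close>, and use that the rows \<open>\<xi>\<^sub>l\<close> of degree zero are constant.
\<close>

lemma degree_zero_variable:
  assumes l: "l \<in> {r+1..s}"
  obtains v where "v \<in> vec_grading 0"
    "\<And>l'. l' \<in> {r+1..s} \<Longrightarrow> row_times (\<xi> l') v = (if l' = l then 1 else 0)"
proof -
  define k where "k = single (1::2) K"
  define v :: "(2, 'k) mpol ^ 'n" where "v = (\<chi> j. pconst (lookup (\<eta> 1 l $ j) k))"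
  have "row_times (\<xi> l') v = (if l' = l then 1 else 0)" if l': "l' \<in> {r+1..s}" for l'
  proof -
    have const: "\<xi> l' $ j = pconst (lookup (\<xi> l' $ j) 0)" for j
      by (rule forms_zero_pconst) (use \<xi>_forms[of l' j] \<sigma>_zero[OF l'] l' in simp)
    have "row_times (\<xi> l') v = (\<Sum>j\<in>UNIV. pconst (lookup (\<xi> l' $ j) 0 * lookup (\<eta> 1 l $ j) k))"
      unfolding row_times_def v_def
      by (rule sum.cong[OF refl], subst const) (simp add: pconst_mult)
    also have "\<dots> = (\<Sum>j\<in>UNIV. pconst (lookup (pconst (lookup (\<xi> l' $ j) 0) * \<eta> 1 l $ j) k))"
      by (simp only: lookup_pconst_mult)
    also have "\<dots> = pconst (lookup (row_times (\<xi> l') (\<eta> 1 l)) k)"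
      by (simp only: const[symmetric] row_times_def lookup_sum pconst_sum)
    also have "row_times (\<xi> l') (\<eta> 1 l) = (if l' = l then pvar 1 ^ K else 0)"
      using l l' by (intro \<eta>) auto
    also have "pconst (lookup (if l' = l then pvar 1 ^ K else 0) k) = (if l' = l then 1 else (0 :: (2, 'k) mpol))"
      by (simp add: k_def pvar_power)
    finally show ?thesis .
  qed
  moreover have "v \<in> vec_grading 0"
    by (simp add: v_def vec_grading_def pconst_def forms_single)
  ultimately show ?thesis using that by blast
qed

context
  fixes h :: "(nat \<Rightarrow> nat) \<Rightarrow> ('n, (2, 'k) mpol) mpol"
  assumes h: "\<And>\<alpha>. \<alpha> \<in> X \<Longrightarrow> \<psi> (h \<alpha>) = \<gamma> * tmon \<alpha>"
begin

text \<open>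
  One monomial \<open>c t\<^sup>\<alpha>\<close> of \<open>u\<close> at a time.  If \<open>c\<close> has positive degree, a variable \<open>x\<^sub>0\<close> or \<open>x\<^sub>1\<close> splits off.  If \<open>c\<close>
  is a constant and \<open>\<alpha>\<close> is supported in \<open>{1..r}\<close>, the monomial is a multiple of the image of \<open>h \<alpha>\<close>.
  Otherwise a variable of degree zero divides it; exchanging that variable for an element of the
  module leaves terms whose coefficients have positive degree.
\<close>

lemma high_degree_lift:
  assumes a: "a + int (\<delta> (m + 1)) \<ge> int (\<delta> m)" and u: "u \<in> P" "u \<in> hforms \<sigma> a b"
  shows "\<exists>F\<in>kv.span (J \<union> h ` X). \<psi> F = \<gamma> * u"
proof -
  have "keys u \<subseteq> {t. keys t \<subseteq> {1..s} \<and> lookup u t \<in> forms (a + int (wt \<sigma> t))}"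
    using u by (auto simp: P_iff hforms_def)
  then show ?thesis
  proof (induction u rule: mpol_induct_on)
    case zero
    show ?case by (rule bexI[of _ 0]) (simp_all add: kv.span_zero)
  next
    case (add u v)
    then obtain F G where "F \<in> kv.span (J \<union> h ` X)" "G \<in> kv.span (J \<union> h ` X)"
      "\<psi> F = \<gamma> * u" "\<psi> G = \<gamma> * v" by blast
    then show ?case
      by (intro bexI[of _ "F + G"]) (simp_all add: distrib_left kv.span_add)
  next
    case (monom t c)
    then have t: "keys t \<subseteq> {1..s}" and c: "c \<in> forms (a + int (wt \<sigma> t))" by auto
    have JW: "F \<in> kv.span (J \<union> h ` X)" if "F \<in> J" for F using that by (simp add: kv.span_base)
    consider "a + int (wt \<sigma> t) > 0" | "a + int (wt \<sigma> t) < 0" | "a + int (wt \<sigma> t) = 0" "keys t \<subseteq> {1..r}"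
      | l where "a + int (wt \<sigma> t) = 0" "l \<in> keys t" "l \<notin> {1..r}" by fastforce
    then show ?case
    proof cases
      case 1
      show ?thesis by (rule positive_degree_multiple[OF c 1 a t]) (use JW in blast)
    next
      case 2
      then have "c = 0" using c forms_neg by blast
      then show ?thesis by (intro bexI[of _ 0]) (simp_all add: kv.span_zero)
    next
      case 3
      have "c = pconst (lookup c 0)" using c 3 by (intro forms_zero_pconst) simp
      moreover have "lookup t \<in> X" using 3 a by (intro lookup_in_X) auto
      moreover have "single t c = pconst c * tmon (lookup t)"
        by (simp add: tmon_def expo_lookup[OF t] pconst_def mult_single)
      ultimately have "\<psi> (pconst (pconst (lookup c 0)) * h (lookup t)) = \<gamma> * single t c"
        by (simp add: h mult.left_commute)
      moreover have "pconst (pconst (lookup c 0)) * h (lookup t) \<in> kv.span (J \<union> h ` X)"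
        using \<open>lookup t \<in> X\<close> by (intro kv.span_scale kv.span_base) blast
      ultimately show ?thesis by blast
    next
      case (4 l)
      then have l: "l \<in> {r+1..s}" using t by auto
      obtain t' where t': "t = single l 1 + t'" "keys t' \<subseteq> keys t" by (rule split_off_variable[OF 4(2)])
      have t's: "keys t' \<subseteq> {1..s}" using t' t by blast
      have at': "a + int (wt \<sigma> t') = 0" using 4(1) \<sigma>_zero[OF l] by (simp add: t'(1) wt_add)
      have c0: "c \<in> forms 0" using c 4(1) by simp
      obtain v where v: "v \<in> vec_grading 0"
        "\<And>l'. l' \<in> {r+1..s} \<Longrightarrow> row_times (\<xi> l') v = (if l' = l then 1 else 0)"
        using degree_zero_variable[OF l] by blast
      define w where "w i = row_times (\<xi> i) v" for i
      have w: "w i \<in> forms (int (\<sigma> i))" if "i \<in> {1..s}" for i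
        unfolding w_def row_times_def
        by (intro forms_sum forms_mult'[OF \<xi>_forms[OF that]]) (use v(1) in \<open>simp_all add: vec_grading_def\<close>)
      have split: "\<psi> (dotT v) = (\<Sum>i=1..r. pconst (w i) * pvar i) + pvar l"
      proof -
        have "{1..s} = {1..r} \<union> {r+1..s}" using r by auto
        then have "\<psi> (dotT v) = (\<Sum>i=1..r. pconst (w i) * pvar i) + (\<Sum>i=r+1..s. pconst (w i) * pvar i)"
          unfolding \<psi>_dotT tform_def w_def by (simp only:, intro sum.union_disjoint) auto
        also have "(\<Sum>i=r+1..s. pconst (w i) * pvar i) = (\<Sum>i=r+1..s. if i = l then pvar l else 0)"
          by (rule sum.cong) (auto simp: w_def v(2))
        also have "\<dots> = pvar l" using l by simp
        finally show ?thesis .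
      qed
      (* the part that is a multiple of a generator of the module *)
      have "single t' c \<in> hforms \<sigma> a (mdeg t')" by (rule hforms_single) (use c0 at' in simp_all)
      then have "\<gamma> * single t' c \<in> hforms \<sigma> (int (\<delta> (m + 1)) + a) (1 + mdeg t')"
        by (rule hforms_mult[OF \<gamma>_hforms])
      moreover have st: "single t' c \<in> P" using t's by (simp add: P_iff)
      then have "\<gamma> * single t' c \<in> P" unfolding \<gamma>_def by (intro P_closed tform_in_P)
      moreover have "int (\<delta> (m + 1)) + a \<ge> int (\<delta> m) - 1" using a by simp
      ultimately obtain G where G: "\<psi> G = \<gamma> * single t' c"
        using high_degree_in_range by blast
      have "(\<Sum>j\<in>UNIV. pconst (v $ j) * (pvar j * G)) \<in> J"
        unfolding J_def by (intro idl.span_sum) (fold J_def, intro J_closed J_base \<K>I[OF st G])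
      then have "dotT v * G \<in> J" by (simp add: dotT_def sum_distrib_right sum_distrib_left mult_ac)
      moreover have "\<exists>F\<in>J. \<psi> F = \<gamma> * single (single i 1 + t') (w i * c)" if i: "i \<in> {1..r}" for i
      proof (rule positive_degree_multiple[of "w i * c" a "single i 1 + t'"])
        have "w i * c \<in> forms (int (\<sigma> i) + 0)" using i r by (intro forms_mult w c0) auto
        moreover have "int (\<sigma> i) + 0 = a + int (wt \<sigma> (single i 1 + t'))" using at' by (simp add: wt_add)
        ultimately show "w i * c \<in> forms (a + int (wt \<sigma> (single i 1 + t')))" by (simp only:)
        show "a + int (wt \<sigma> (single i 1 + t')) > 0" using at' \<sigma>_pos[OF i] by (simp add: wt_add)
        show "keys (single i 1 + t') \<subseteq> {1..s}" using t's i r by (simp add: keys_add_nat)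
      qed (use a in blast)+
      then obtain F where F: "\<And>i. i \<in> {1..r} \<Longrightarrow> F i \<in> J"
        "\<And>i. i \<in> {1..r} \<Longrightarrow> \<psi> (F i) = \<gamma> * single (single i 1 + t') (w i * c)" by metis
      have "(\<Sum>i=1..r. F i) \<in> J" unfolding J_def by (intro idl.span_sum) (fold J_def, rule F)
      ultimately have "dotT v * G + (- 1) * (\<Sum>i=1..r. F i) \<in> J"
        by (rule J_closed(1)[OF _ J_closed(2)])
      moreover have "\<psi> (dotT v * G + (- 1) * (\<Sum>i=1..r. F i)) = \<gamma> * single t c"
      proof -
        have "\<psi> (\<Sum>i=1..r. F i) = (\<Sum>i=1..r. \<gamma> * single t' c * (pconst (w i) * pvar i))"
          unfolding \<psi>_sum by (rule sum.cong) (simp_all add: F pconst_def pvar_def mult_single mult.assoc add.commute mult.commute)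
        then have "\<psi> (dotT v * G + (- 1) * (\<Sum>i=1..r. F i)) = \<gamma> * single t' c * pvar l"
          unfolding \<psi>_simps split G by (simp add: distrib_left distrib_right sum_distrib_left mult_ac sum_negf)
        also have "\<dots> = \<gamma> * single t c"
          by (simp add: t'(1) pvar_def mult_single mult.assoc add.commute)
        finally show ?thesis .
      qed
      ultimately show ?thesis using JW by blast
    qed
  qed
qed

lemma high_degree_span:
  assumes F: "F \<in> \<K>" "F \<in> biforms a b" and a: "a \<ge> int (\<delta> m)"
  shows "F \<in> kv.span (J \<union> h ` X)"
proof -
  obtain u where u: "u \<in> P" "u \<in> hforms \<sigma> (a - int (\<delta> (m + 1))) (b - 1)"
    "\<psi> (bicomp (\<lambda>_. 0) a b F) = \<gamma> * u"
    using homogeneous_cofactor[OF F(1)] by blast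
  have "bicomp (\<lambda>_. 0) a b F = F" using F(2) unfolding biforms_eq_hforms by (simp add: bicomp_of_hform)
  then have \<psi>F: "\<psi> F = \<gamma> * u" using u(3) by simp
  obtain G where G: "G \<in> kv.span (J \<union> h ` X)" "\<psi> G = \<gamma> * u"
    using high_degree_lift[OF _ u(1,2)] a by auto
  have "F - G \<in> J" using \<psi>F G(2) by (intro J_base) (simp flip: \<psi>_eq_0_iff)
  then have "(F - G) + G \<in> kv.span (J \<union> h ` X)" by (intro kv.span_add G(1)) (simp add: kv.span_base)
  then show ?thesis by simp
qed

lemma h_inj: "inj_on h X"
proof (rule inj_onI)
  fix \<alpha> \<beta> assume *: "\<alpha> \<in> X" "\<beta> \<in> X" "h \<alpha> = h \<beta>"
  then have "\<gamma> * tmon \<alpha> = \<gamma> * tmon \<beta>" using h by metis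
  then have "tmon \<alpha> = tmon \<beta>" using \<gamma>_neq_0 by simp
  then show "\<alpha> = \<beta>" using tmon_inj *(1,2) by (auto dest: inj_onD)
qed

lemma h_notin_J: "\<alpha> \<in> X \<Longrightarrow> h \<alpha> \<notin> J"
  using independent_modulo_J[of "{\<alpha>}" h "\<lambda>_. 1" \<alpha>] h by auto

lemma independent_Un_h:
  assumes B: "kv.independent B" "B \<subseteq> J"
  shows "kv.independent (B \<union> h ` X)"
proof
  assume "kv.dependent (B \<union> h ` X)"
  then obtain S c where S: "finite S" "S \<subseteq> B \<union> h ` X" "\<exists>v\<in>S. c v \<noteq> 0"
    "(\<Sum>v\<in>S. pconst (pconst (c v)) * v) = 0"
    unfolding kv.dependent_explicit by blast
  define Y where "Y = {\<alpha> \<in> X. h \<alpha> \<in> S - B}"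
  have hY: "S - B = h ` Y" using S(2) by (auto simp: Y_def)
  have inj: "inj_on h Y" using h_inj by (rule inj_on_subset) (auto simp: Y_def)
  have fin: "finite Y" using hY S(1) inj by (metis finite_Diff finite_imageD)
  have "S = (S \<inter> B) \<union> (S - B)" by blast
  then have "(\<Sum>v\<in>S \<inter> B. pconst (pconst (c v)) * v) + (\<Sum>v\<in>S - B. pconst (pconst (c v)) * v) = 0"
    using S(1,4) sum.union_disjoint[of "S \<inter> B" "S - B" "\<lambda>v. pconst (pconst (c v)) * v"] by auto
  then have sum: "(\<Sum>v\<in>S \<inter> B. pconst (pconst (c v)) * v) + (\<Sum>\<alpha>\<in>Y. pconst (pconst (c (h \<alpha>))) * h \<alpha>) = 0"
    by (simp add: hY sum.reindex[OF inj])
  have "(\<Sum>v\<in>S \<inter> B. pconst (pconst (c v)) * v) \<in> J"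
    unfolding J_def by (intro idl.span_sum idl.span_scale) (fold J_def, use B(2) in blast)
  then have "(- 1) * (\<Sum>v\<in>S \<inter> B. pconst (pconst (c v)) * v) \<in> J" by (rule J_closed)
  then have "(\<Sum>\<alpha>\<in>Y. pconst (pconst (c (h \<alpha>))) * h \<alpha>) \<in> J"
    using sum by (simp add: add_eq_0_iff)
  then have 0: "c (h \<alpha>) = 0" if "\<alpha> \<in> Y" for \<alpha>
    using independent_modulo_J[of Y h "\<lambda>\<alpha>. c (h \<alpha>)", OF _ fin _ _ that] h by (auto simp: Y_def)
  then have "(\<Sum>v\<in>S \<inter> B. pconst (pconst (c v)) * v) = 0" using sum by simp
  then have inB: "c v = 0" if "v \<in> S \<inter> B" for v
    using S(1) that
    by (intro B(1)[unfolded kv.independent_explicit_finite_subsets, rule_format, of "S \<inter> B" c v]) auto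
  have "c v = 0" if "v \<in> S" for v
  proof (cases "v \<in> B")
    case False
    then have "v \<in> h ` Y" using that unfolding hY[symmetric] by simp
    then show ?thesis using 0 by auto
  qed (use inB that in simp)
  then show False using S(3) by simp
qed

end

text \<open>
  The other terms of \<open>w\<close> have positive degree.  So generation of ideals between \<open>J\<close> and \<open>\<K>\<^sub>m\<^sub>+\<^sub>1\<close> is a
  question of linear algebra modulo \<open>J\<close>.
\<close>

lemma mult_modulo_J:
  assumes F: "F \<in> \<K>"
  shows "w * F - pconst (pconst (lookup (lookup w 0) 0)) * F \<in> J"
proof (induction w rule: mpol_induct2)
  case (monom t u c)
  consider j where "j \<in> keys t" | i where "t = 0" "i \<in> keys u" | "t = 0" "u = 0"
  proof -
    assume *: "\<And>j. j \<in> keys t \<Longrightarrow> thesis" "\<And>i. t = 0 \<Longrightarrow> i \<in> keys u \<Longrightarrow> thesis"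
      "t = 0 \<Longrightarrow> u = 0 \<Longrightarrow> thesis"
    show thesis
    proof (cases "keys t = {}")
      case True
      then have t: "t = 0" by simp
      show thesis
      proof (cases "keys u = {}")
        case True
        then show thesis using *(3) t by simp
      qed (use *(2) t in blast)
    qed (use *(1) in blast)
  qed
  then show ?case
  proof cases
    case 1
    then obtain t' where "t = single j 1 + t'" by (rule split_off_variable)
    moreover from this have "t \<noteq> 0" by (metis 1 keys_zero empty_iff)
    ultimately have "single t (single u c) * F - pconst (pconst (lookup (lookup (single t (single u c)) 0) 0)) * F =
        pvar j * (single t' (single u c) * F)"
      by (simp add: lookup_single when_def pvar_def mult_single flip: mult.assoc)
    then show ?thesis using F by (simp only:) (intro J_base \<K>_closed)
  next
    case 2
    obtain u' where u': "u = single i 1 + u'" by (rule split_off_variable[OF 2(2)])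
    moreover have "u \<noteq> 0" by (metis 2(2) keys_zero empty_iff)
    ultimately have "single t (single u c) * F - pconst (pconst (lookup (lookup (single t (single u c)) 0) 0)) * F =
        pconst (pvar i) * (single t (single u' c) * F)"
      using 2 by (simp add: lookup_single when_def pvar_def pconst_def mult_single flip: mult.assoc)
    then show ?thesis using F by (simp only:) (intro J_base \<K>_closed)
  next
    case 3
    then show ?thesis by (simp add: pconst_def J_closed)
  qed
next
  case (add v w)
  have "(v + w) * F - pconst (pconst (lookup (lookup (v + w) 0) 0)) * F =
    (v * F - pconst (pconst (lookup (lookup v 0) 0)) * F) + (w * F - pconst (pconst (lookup (lookup w 0) 0)) * F)"
    by (simp add: lookup_add pconst_add distrib_right)
  then show ?case using add by (simp only: J_closed)
qed

text \<open>
  Induction on the total degree: a component of an element of \<open>J\<close> is, modulo \<open>\<K>\<^sub>m\<close>, a combination of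
  components of elements of \<open>\<K>\<^sub>m\<^sub>+\<^sub>1\<close> of smaller degree.
\<close>

lemma graded_nakayama:
  assumes G: "\<And>g. g \<in> G \<Longrightarrow> \<exists>a b. g \<in> biforms a b" "G \<subseteq> \<K>"
    and span: "\<And>F. F \<in> \<K> \<Longrightarrow> \<exists>j\<in>J. \<exists>g\<in>kv.span G. F = j + g"
  shows "idl.span (G \<union> \<K>\<^sub>0) = \<K>"
proof
  let ?N = "idl.span (G \<union> \<K>\<^sub>0)"
  show "?N \<subseteq> \<K>" by (rule idl.span_minimal) (use G(2) \<K>\<^sub>0_subset in auto)
  have N: "F + H \<in> ?N" "W * F \<in> ?N" "0 \<in> ?N" if "F \<in> ?N" "H \<in> ?N" for F H W
    using that by (auto intro: idl.span_add idl.span_scale idl.span_zero)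
  have N0: "0 \<in> ?N" by (rule idl.span_zero)
  have bG: "bicomp (\<lambda>_. 0) a b g \<in> ?N" if "g \<in> kv.span G" for a b g
    using that
  proof (induction rule: kv.span_induct_alt)
    case base
    then show ?case using N0 by simp
  next
    case (step c x y)
    obtain a' b' where "x \<in> biforms a' b'" using G(1) step(1) by blast
    then have "bicomp (\<lambda>_. 0) a b x = x \<or> bicomp (\<lambda>_. 0) a b x = 0"
      unfolding biforms_eq_hforms by (simp add: bicomp_of_hform)
    then have x: "bicomp (\<lambda>_. 0) a b x \<in> ?N" using step(1) N0 by (auto intro: idl.span_base)
    have "pconst (pconst c) \<in> hforms (\<lambda>_. 0) 0 0"
      by (intro hforms_pconst) (simp add: pconst_def forms_single)
    from bicomp_mult[OF this] have "bicomp (\<lambda>_. 0) a b (pconst (pconst c) * x) = pconst (pconst c) * bicomp (\<lambda>_. 0) a b x"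
      by simp
    then show ?case using x step(2) by (simp add: bicomp_add N)
  qed
  have main: "\<forall>a b F. F \<in> \<K> \<longrightarrow> a + int b < int n \<longrightarrow> bicomp (\<lambda>_. 0) a b F \<in> ?N" for n
  proof (induction n)
    case 0
    show ?case
    proof (intro allI impI)
      fix a b F assume "a + int b < int 0"
      then have "a < 0" by simp
      then show "bicomp (\<lambda>_. 0) a b F \<in> ?N" using N0 by (simp add: bicomp_eq_0_of_neg)
    qed
  next
    case (Suc n)
    show ?case
    proof (intro allI impI)
      fix a b F assume F: "F \<in> \<K>" and ab: "a + int b < int (Suc n)"
      have IH: "bicomp (\<lambda>_. 0) a' b' H \<in> ?N" if "H \<in> \<K>" "a' + int b' < int n" for a' b' H
        using Suc that by blast
      have bJ: "bicomp (\<lambda>_. 0) a b j \<in> ?N" if "j \<in> J" for j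
        using that unfolding J_def
      proof (induction rule: idl.span_induct_alt)
        case base
        then show ?case using N0 by simp
      next
        case (step w x y)
        have "bicomp (\<lambda>_. 0) a b (w * x) \<in> ?N"
        proof -
          from step(1) consider (x) i H where "x = pconst (pvar i) * H" "H \<in> \<K>"
            | (T) l H where "x = pvar l * H" "H \<in> \<K>" | (0) "x \<in> \<K>\<^sub>0" by blast
          then show ?thesis
          proof cases
            case x
            have "pconst (pvar i) \<in> hforms (\<lambda>_. 0) 1 0" by (intro hforms_pconst forms_pvar)
            from bicomp_mult[OF this, of a b "w * H"]
            have "bicomp (\<lambda>_. 0) a b (w * x) = pconst (pvar i) * bicomp (\<lambda>_. 0) (a - 1) b (w * H)"
              by (simp add: x mult.left_commute)
            moreover have "bicomp (\<lambda>_. 0) (a - 1) b (w * H) \<in> ?N" by (rule IH) (use x ab \<K>_closed in auto)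
            ultimately show ?thesis using N by simp
          next
            case T
            have "pvar l \<in> hforms (\<lambda>_. 0) 0 1" by (intro hforms_pvar) simp
            from bicomp_mult[OF this, of a b "w * H"]
            have "bicomp (\<lambda>_. 0) a b (w * x) = (if 1 \<le> b then pvar l * bicomp (\<lambda>_. 0) a (b - 1) (w * H) else 0)"
              by (simp add: T mult.left_commute)
            moreover have "bicomp (\<lambda>_. 0) a (b - 1) (w * H) \<in> ?N" if "1 \<le> b"
              by (rule IH) (use T ab that \<K>_closed in auto)
            ultimately show ?thesis using N N0 by simp
          next
            case 0
            then have "bicomp (\<lambda>_. 0) a b (w * x) \<in> \<K>\<^sub>0" by (intro bicomp_\<K>\<^sub>0 \<K>\<^sub>0_closed)
            then show ?thesis by (simp add: idl.span_base)
          qed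
        qed
        then show ?case using step(2) by (simp add: bicomp_add N)
      qed
      obtain j g where "j \<in> J" "g \<in> kv.span G" "F = j + g" using span[OF F] by blast
      then show "bicomp (\<lambda>_. 0) a b F \<in> ?N" using bJ bG N by (simp add: bicomp_add)
    qed
  qed
  show "\<K> \<subseteq> ?N"
  proof
    fix F assume F: "F \<in> \<K>"
    show "F \<in> ?N"
    proof (rule bicomp_closed)
      show "bicomp (\<lambda>_. 0) a b F \<in> ?N" for a b
        using main[of "nat (a + int b + 1)"] F by (cases "a + int b \<ge> 0") (auto simp: bicomp_eq_0_of_neg N0)
    qed (use N N0 in auto)
  qed
qed

text \<open>
  A basis of \<open>J\<close> together with the \<open>h \<alpha>\<close> is linearly independent.  It extends by homogeneous elements of
  \<open>x\<close>-degree less than \<open>\<delta> m\<close> to a basis of \<open>\<K>\<^sub>m\<^sub>+\<^sub>1\<close>, since the \<open>h \<alpha>\<close> span the higher degrees modulo \<open>J\<close>.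
  The basis elements outside \<open>J\<close> generate by Nakayama's lemma, and none is redundant: it would be
  a linear combination of the others modulo \<open>J\<close>.
\<close>

theorem minimal_generators_of_high_degree:
  assumes h: "\<And>\<alpha>. \<alpha> \<in> X \<Longrightarrow> \<psi> (h \<alpha>) = \<gamma> * tmon \<alpha>"
    and hform: "\<And>\<alpha>. \<alpha> \<in> X \<Longrightarrow> \<exists>b. h \<alpha> \<in> biforms (int (\<delta> (m + 1)) - int (weight s \<sigma> \<alpha>)) b"
  defines "im \<equiv> \<lambda>F. \<K>\<^sub>0 +>\<^bsub>poly_ring UNIV\<^esub> F"
  shows "\<exists>G. minimal_generating_set (poly_ring UNIV Quot \<K>\<^sub>0) (im ` \<K>) G \<and>
    G \<subseteq> {y. \<exists>a b. y \<in> im ` biforms a b} \<and>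
    {y \<in> G. \<exists>a b. int (\<delta> m) \<le> a \<and> y \<in> im ` biforms a b} = (\<lambda>\<alpha>. im (h \<alpha>)) ` X"
proof -
  have im_eq: "im F = im H \<longleftrightarrow> F - H \<in> \<K>\<^sub>0" for F H
    unfolding im_def by (rule rcos_poly_ring_eq_iff) (simp add: ideal_poly_ring_iff)
  have h\<K>: "h \<alpha> \<in> \<K>" if "\<alpha> \<in> X" for \<alpha>
  proof (rule \<K>I[OF _ h[OF that]])
    have "keys (expo \<alpha>) \<subseteq> {1..s}" by (auto simp: in_keys_iff lookup_expo split: if_splits)
    then show "tmon \<alpha> \<in> P" by (simp add: tmon_def P_iff)
  qed
  have hhigh: "int (\<delta> m) \<le> int (\<delta> (m + 1)) - int (weight s \<sigma> \<alpha>)" if "\<alpha> \<in> X" for \<alpha>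
  proof -
    have "weight s \<sigma> \<alpha> \<le> \<delta> (m + 1) - \<delta> m" using that unfolding X_iff by blast
    then show ?thesis using \<delta>_mono by linarith
  qed
  obtain B0 where B0: "B0 \<subseteq> J" "kv.independent B0" "J \<subseteq> kv.span B0"
    using kv.maximal_independent_subset by blast
  (* homogeneous elements that may serve as further generators *)
  define Low where "Low = {F \<in> \<K>. \<exists>a b. a < int (\<delta> m) \<and> F \<in> biforms a b}"
  obtain B where B: "B0 \<union> h ` X \<subseteq> B" "B \<subseteq> B0 \<union> h ` X \<union> Low" "kv.independent B"
      "B0 \<union> h ` X \<union> Low \<subseteq> kv.span B"
    by (rule kv.maximal_independent_subset_extend[of "B0 \<union> h ` X" "B0 \<union> h ` X \<union> Low"])
      (use independent_Un_h[OF h B0(2,1)] in auto)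
  define G where "G = B - B0"
  have JB: "J \<subseteq> kv.span B" using B0(3) kv.span_mono[of B0 B] B(1) by blast
  have G_cases: "(\<exists>\<alpha>\<in>X. g = h \<alpha>) \<or> g \<in> Low" if "g \<in> G" for g using that B(2) by (auto simp: G_def)
  have G\<K>: "G \<subseteq> \<K>" using G_cases h\<K> by (auto simp: Low_def)
  have Ghom: "\<exists>a b. g \<in> biforms a b" if "g \<in> G" for g
    using G_cases[OF that] hform unfolding Low_def by blast
  have notin: "g \<notin> kv.span (A \<union> J)" if g: "g \<in> G" "A \<subseteq> G - {g}" for g A
  proof
    assume g': "g \<in> kv.span (A \<union> J)"
    have "B0 \<subseteq> B - {g}" using B(1) g by (auto simp: G_def)
    then have "J \<subseteq> kv.span (B - {g})" using B0(3) kv.span_mono by blast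
    moreover have "A \<subseteq> kv.span (B - {g})"
      using g(2) kv.span_superset[of "B - {g}"] by (auto simp: G_def)
    ultimately have "kv.span (A \<union> J) \<subseteq> kv.span (B - {g})"
      by (intro kv.span_minimal) auto
    then show False using g' g(1) B(3) unfolding kv.dependent_def by (auto simp: G_def)
  qed
  have GJ: "g \<notin> J" if "g \<in> G" for g
    using notin[OF that, of "{}"] by (auto intro: kv.span_base)
  have \<K>B: "F \<in> kv.span B" if F: "F \<in> \<K>" for F
  proof (rule bicomp_closed)
    show "bicomp (\<lambda>_. 0) a b F \<in> kv.span B" for a b
    proof (cases "a < int (\<delta> m)")
      case True
      then have "bicomp (\<lambda>_. 0) a b F \<in> Low"
        using bicomp_\<K>[OF F] bicomp_hforms unfolding Low_def biforms_eq_hforms by blast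
      then show ?thesis using B(4) by blast
    next
      case False
      have "bicomp (\<lambda>_. 0) a b F \<in> biforms a b" unfolding biforms_eq_hforms by (rule bicomp_hforms)
      then have "bicomp (\<lambda>_. 0) a b F \<in> kv.span (J \<union> h ` X)"
        using high_degree_span[OF h bicomp_\<K>[OF F]] False by simp
      moreover have "kv.span (J \<union> h ` X) \<subseteq> kv.span B"
        using JB B(4) by (intro kv.span_minimal) auto
      ultimately show ?thesis by blast
    qed
  qed (auto intro: kv.span_zero kv.span_add)
  have gen: "idl.span (G \<union> \<K>\<^sub>0) = \<K>"
  proof (rule graded_nakayama[OF Ghom G\<K>])
    fix F assume "F \<in> \<K>"
    then have "F \<in> kv.span (B0 \<union> G)" using \<K>B B(1) by (simp add: G_def Un_absorb1)
    then obtain j g where jg: "j \<in> kv.span B0" "g \<in> kv.span G" "F = j + g"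
      unfolding kv.span_Un by blast
    moreover have "j \<in> J" using jg(1) kv.span_minimal[OF B0(1) kv_subspace_J] by blast
    ultimately show "\<exists>j\<in>J. \<exists>g\<in>kv.span G. F = j + g" by blast
  qed
  have carr: "im ` A \<subseteq> carrier (poly_ring UNIV Quot \<K>\<^sub>0)" for A
    by (auto simp: im_def FactRing_def A_RCOSETS_def')
  have Idl: "Idl\<^bsub>poly_ring UNIV Quot \<K>\<^sub>0\<^esub> (im ` A) = im ` idl.span (A \<union> \<K>\<^sub>0)" for A
    unfolding im_def by (rule genideal_Quot) simp
  have min: "Idl\<^bsub>poly_ring UNIV Quot \<K>\<^sub>0\<^esub> H \<noteq> im ` \<K>" if H: "H \<subset> im ` G" for H
  proof
    assume eq: "Idl\<^bsub>poly_ring UNIV Quot \<K>\<^sub>0\<^esub> H = im ` \<K>"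
    obtain g where g: "g \<in> G" "im g \<notin> H" using H by blast
    define A where "A = {F \<in> G. im F \<in> H}"
    have HA: "H = im ` A" using H unfolding A_def by blast
    have "im g \<in> im ` \<K>" using g(1) G\<K> by blast
    then have "im g \<in> im ` idl.span (A \<union> \<K>\<^sub>0)" unfolding eq[symmetric] HA Idl .
    then obtain F where F: "F \<in> idl.span (A \<union> \<K>\<^sub>0)" "g - F \<in> \<K>\<^sub>0" by (auto simp: im_eq)
    have "idl.span (A \<union> \<K>\<^sub>0) \<subseteq> kv.span (A \<union> J)"
    proof
      fix F assume "F \<in> idl.span (A \<union> \<K>\<^sub>0)"
      then show "F \<in> kv.span (A \<union> J)"
      proof (induction rule: idl.span_induct_alt)
        case base
        show ?case by (rule kv.span_zero)
      next
        case (step w x y)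
        have "w * x \<in> kv.span (A \<union> J)"
        proof (cases "x \<in> \<K>\<^sub>0")
          case True
          then show ?thesis by (intro kv.span_base UnI2 J_base \<K>\<^sub>0_closed)
        next
          case False
          then have x: "x \<in> A" "x \<in> \<K>" using step(1) G\<K> by (auto simp: A_def)
          let ?c = "lookup (lookup w 0) 0"
          have "(w * x - pconst (pconst ?c) * x) + pconst (pconst ?c) * x \<in> kv.span (A \<union> J)"
            using mult_modulo_J[OF x(2), of w] x(1)
            by (intro kv.span_add kv.span_scale) (auto intro: kv.span_base)
          then show ?thesis by simp
        qed
        then show ?case using step(2) by (rule kv.span_add)
      qed
    qed
    then have "(g - F) + F \<in> kv.span (A \<union> J)"
      using F by (intro kv.span_add) (auto intro: kv.span_base J_base)
    moreover have "A \<subseteq> G - {g}" using g(2) by (auto simp: A_def)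
    ultimately show False using notin[OF g(1)] by simp
  qed
  have high: "{y \<in> im ` G. \<exists>a b. int (\<delta> m) \<le> a \<and> y \<in> im ` biforms a b} = (\<lambda>\<alpha>. im (h \<alpha>)) ` X"
  proof (intro subset_antisym subsetI)
    fix y assume "y \<in> {y \<in> im ` G. \<exists>a b. int (\<delta> m) \<le> a \<and> y \<in> im ` biforms a b}"
    then obtain g F a b where g: "g \<in> G" "y = im g" "int (\<delta> m) \<le> a" "F \<in> biforms a b" "im g = im F"
      by auto
    have "g \<notin> Low"
    proof
      assume "g \<in> Low"
      then obtain a' b' where a': "a' < int (\<delta> m)" "g \<in> biforms a' b'" by (auto simp: Low_def)
      have "bicomp (\<lambda>_. 0) a' b' (g - F) \<in> \<K>\<^sub>0" using g(5) by (intro bicomp_\<K>\<^sub>0) (simp flip: im_eq)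
      moreover have "bicomp (\<lambda>_. 0) a' b' (g - F) = g"
        using a' g(3,4) unfolding biforms_eq_hforms by (simp add: bicomp_diff bicomp_of_hform)
      ultimately show False using GJ[OF g(1)] J_base(3) by simp
    qed
    then show "y \<in> (\<lambda>\<alpha>. im (h \<alpha>)) ` X" using G_cases[OF g(1)] g(2) by blast
  next
    fix y assume "y \<in> (\<lambda>\<alpha>. im (h \<alpha>)) ` X"
    then obtain \<alpha> where \<alpha>: "\<alpha> \<in> X" "y = im (h \<alpha>)" by blast
    have "h \<alpha> \<in> G" using B(1) B0(1) h_notin_J[OF h \<alpha>(1)] \<alpha>(1) by (auto simp: G_def)
    moreover obtain b where "h \<alpha> \<in> biforms (int (\<delta> (m + 1)) - int (weight s \<sigma> \<alpha>)) b"
      using hform[OF \<alpha>(1)] by blast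
    ultimately show "y \<in> {y \<in> im ` G. \<exists>a b. int (\<delta> m) \<le> a \<and> y \<in> im ` biforms a b}"
      using hhigh[OF \<alpha>(1)] \<alpha>(2) by blast
  qed
  show ?thesis
  proof (intro exI conjI)
    show "minimal_generating_set (poly_ring UNIV Quot \<K>\<^sub>0) (im ` \<K>) (im ` G)"
      unfolding minimal_generating_set_def using carr min by (simp add: Idl gen)
    show "im ` G \<subseteq> {y. \<exists>a b. y \<in> im ` biforms a b}" using Ghom by blast
  qed (rule high)
qed

end

section \<open>The recursive construction\<close>

locale recursive_construction = high_degree_generators \<phi> \<xi> \<delta> \<sigma> m s K \<eta> \<beta> r
  for \<phi> \<xi> :: "nat \<Rightarrow> (2, 'k::field) mpol ^ 'n" and \<delta> \<sigma> :: "nat \<Rightarrow> nat" and m s K :: nat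
    and \<eta> :: "2 \<Rightarrow> nat \<Rightarrow> (2, 'k) mpol ^ 'n" and \<beta> :: "2 \<Rightarrow> (2, 'k) mpol ^ 'n" and r :: nat +
  fixes \<rho> :: "nat \<Rightarrow> nat \<Rightarrow> (2, 'k) mpol ^ 'n" and e :: "nat \<Rightarrow> nat \<Rightarrow> nat"
  assumes \<rho>_graded: "\<And>i j. i \<in> {1..s} \<Longrightarrow> j \<in> {1..m+1} \<Longrightarrow> \<rho> i j \<in> vec_grading (int (e i j))"
    and \<rho>_kernel: "\<And>i. i \<in> {1..s} \<Longrightarrow> colspan (\<rho> i) (m + 1) = {v. \<forall>l\<in>{1..s} - {i}. row_times (\<xi> l) v = 0}"
begin

definition p :: "nat \<Rightarrow> nat \<Rightarrow> (2, 'k) mpol" where "p i j = row_times (\<xi> i) (\<rho> i j)"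
definition q :: "nat \<Rightarrow> nat \<Rightarrow> ('n, (2, 'k) mpol) mpol" where "q i j = dotT (\<rho> i j)"

abbreviation "con \<equiv> constructed X s \<sigma> (\<delta> (m + 1)) (m + 1) (\<lambda>i j. e i j + \<sigma> i) p q (dotT (\<phi> (m + 1)))"

lemma p_forms: "i \<in> {1..s} \<Longrightarrow> j \<in> {1..m+1} \<Longrightarrow> p i j \<in> forms (int (e i j + \<sigma> i))"
  unfolding p_def row_times_def
  by (intro forms_sum forms_mult'[OF \<xi>_forms]) (use \<rho>_graded in \<open>auto simp: vec_grading_def\<close>)

lemma dotT_biforms: "v \<in> vec_grading a \<Longrightarrow> dotT v \<in> biforms a 1"
  unfolding dotT_def biforms_eq_hforms
  by (intro hforms_sum hforms_mult'[OF hforms_pvar[OF refl] hforms_pconst]) (auto simp: vec_grading_def)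

text \<open>
  The ideal generated by the \<open>p\<^sub>j\<close> consists of all \<open>c\<close> such that \<open>c t\<^sub>i\<close> lies in the module, hence contains
  all forms of high degree.
\<close>

lemma scalar_decomposition:
  assumes i: "i \<in> {1..s}" and c: "c \<in> forms d" and d: "d \<ge> int (\<delta> m) + int (\<sigma> i)"
  shows "\<exists>a. (\<forall>j\<in>{1..m+1}. a j \<in> forms (d - int (e i j + \<sigma> i))) \<and> c = (\<Sum>j=1..m+1. a j * p i j)"
proof -
  obtain v where v: "v \<in> vec_grading (d - int (\<sigma> i))"
    "\<And>l. l \<in> {1..s} \<Longrightarrow> row_times (\<xi> l) v = (if l = i then c else 0)"
    by (rule high_degree_in_module[of "\<lambda>l. if l = i then c else 0" "d - int (\<sigma> i)"])
      (use c d in auto)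
  have "v \<in> colspan (\<rho> i) (m + 1)" unfolding \<rho>_kernel[OF i] using v(2) by simp
  then obtain b where b: "v = (\<Sum>j=1..m+1. b j *s \<rho> i j)" unfolding colspan_def by blast
  have "c = row_times (\<xi> i) v" using v(2)[OF i] by simp
  also have "\<dots> = (\<Sum>j=1..m+1. p i j * b j)"
    unfolding b row_times_sum_right row_times_scale_right p_def by (simp only: mult.commute)
  finally have "hcomp d c = (\<Sum>j=1..m+1. hcomp d (p i j * b j))" by (simp only: hcomp_sum)
  also have "\<dots> = (\<Sum>j=1..m+1. hcomp (d - int (e i j + \<sigma> i)) (b j) * p i j)"
  proof (rule sum.cong)
    fix j assume "j \<in> {1..m+1}"
    from hcomp_mult[OF p_forms[OF i this], of d "b j"]
    show "hcomp d (p i j * b j) = hcomp (d - int (e i j + \<sigma> i)) (b j) * p i j" by (simp only: mult.commute)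
  qed simp
  also have "hcomp d c = c" using hcomp_of_form[OF c, of d] by simp
  finally show ?thesis
    by (intro exI[of _ "\<lambda>j. hcomp (d - int (e i j + \<sigma> i)) (b j)"]) (simp add: hcomp_forms)
qed

lemma decomposition_exists:
  assumes i: "i \<in> {1..s}" and h: "h \<in> biforms d b" and d: "d \<ge> int (\<delta> m) + int (\<sigma> i)"
  shows "decompositions d b (m + 1) (\<lambda>j. e i j + \<sigma> i) (p i) h \<noteq> {}"
proof -
  have "\<forall>t\<in>keys h. \<exists>a. (\<forall>j\<in>{1..m+1}. a j \<in> forms (d - int (e i j + \<sigma> i))) \<and>
      lookup h t = (\<Sum>j=1..m+1. a j * p i j)"
    using h by (intro ballI scalar_decomposition[OF i _ d]) (simp add: biforms_def)
  from bchoice[OF this] obtain a where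
    "\<forall>t\<in>keys h. (\<forall>j\<in>{1..m+1}. a t j \<in> forms (d - int (e i j + \<sigma> i))) \<and>
      lookup h t = (\<Sum>j=1..m+1. a t j * p i j)" by blast
  then have a: "\<And>t j. t \<in> keys h \<Longrightarrow> j \<in> {1..m+1} \<Longrightarrow> a t j \<in> forms (d - int (e i j + \<sigma> i))"
    "\<And>t. t \<in> keys h \<Longrightarrow> lookup h t = (\<Sum>j=1..m+1. a t j * p i j)" by simp_all
  define A where "A j = (\<Sum>t\<in>keys h. single t (a t j))" for j
  have "(\<Sum>j=1..m+1. A j * pconst (p i j)) = (\<Sum>j=1..m+1. \<Sum>t\<in>keys h. single t (a t j * p i j))"
    unfolding A_def sum_distrib_right pconst_def mult_single by simp
  also have "\<dots> = (\<Sum>t\<in>keys h. \<Sum>j=1..m+1. single t (a t j * p i j))" by (rule sum.swap)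
  also have "\<dots> = (\<Sum>t\<in>keys h. single t (\<Sum>j=1..m+1. a t j * p i j))"
  proof (rule sum.cong)
    fix t :: "'a \<Rightarrow>\<^sub>0 nat"
    have "(\<Sum>j\<in>C. single t (f j)) = single t (\<Sum>j\<in>C. f j)" for f :: "nat \<Rightarrow> (2, 'k) mpol" and C
      by (induction C rule: infinite_finite_induct) (simp_all add: single_add)
    then show "(\<Sum>j=1..m+1. single t (a t j * p i j)) = single t (\<Sum>j=1..m+1. a t j * p i j)" .
  qed simp
  also have "\<dots> = (\<Sum>t\<in>keys h. single t (lookup h t))"
    by (rule sum.cong) (simp_all only: a(2))
  also have "\<dots> = h" by (rule sum_terms)
  finally have "h = (\<Sum>j=1..m+1. A j * pconst (p i j))" ..
  moreover have "A j \<in> biforms (d - int (e i j + \<sigma> i)) b" if "j \<in> {1..m+1}" for j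
    unfolding A_def biforms_eq_hforms
  proof (intro hforms_sum hforms_single)
    fix t assume t: "t \<in> keys h"
    then show "mdeg t = b" using h by (simp add: biforms_def)
    show "a t j \<in> forms (d - int (e i j + \<sigma> i) + int (wt (\<lambda>_. 0) t))" using a(1)[OF t that] by simp
  qed
  ultimately have "A \<in> decompositions d b (m + 1) (\<lambda>j. e i j + \<sigma> i) (p i) h"
    unfolding decompositions_def by blast
  then show ?thesis by blast
qed

lemma weight_decrease:
  assumes "i \<in> {1..s}" "\<alpha> i > 0"
  shows "weight s \<sigma> \<alpha> = weight s \<sigma> (\<alpha>(i := \<alpha> i - 1)) + \<sigma> i"
    "(\<Sum>l=1..s. \<alpha> l) = (\<Sum>l=1..s. (\<alpha>(i := \<alpha> i - 1)) l) + 1"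
    "expo \<alpha> = expo (\<alpha>(i := \<alpha> i - 1)) + single i 1"
proof -
  let ?\<alpha> = "\<alpha>(i := \<alpha> i - 1)"
  have eq: "\<alpha> l = ?\<alpha> l + (if l = i then 1 else 0)" for l using assms(2) by simp
  have "weight s \<sigma> \<alpha> = (\<Sum>l=1..s. ?\<alpha> l * \<sigma> l + (if l = i then \<sigma> i else 0))"
    unfolding weight_def by (rule sum.cong) (use assms(2) in \<open>auto simp: diff_mult_distrib\<close>)
  then show "weight s \<sigma> \<alpha> = weight s \<sigma> ?\<alpha> + \<sigma> i"
    using assms(1) by (simp only: sum.distrib weight_def) simp
  have "(\<Sum>l=1..s. \<alpha> l) = (\<Sum>l=1..s. ?\<alpha> l + (if l = i then 1 else 0))"
    by (rule sum.cong[OF refl eq])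
  then show "(\<Sum>l=1..s. \<alpha> l) = (\<Sum>l=1..s. ?\<alpha> l) + 1"
    using assms(1) by (simp only: sum.distrib) simp
  show "expo \<alpha> = expo ?\<alpha> + single i 1"
    by (rule poly_mapping_eqI) (use assms in \<open>auto simp: lookup_add lookup_expo lookup_single when_def\<close>)
qed

lemma X_downward:
  assumes "\<alpha> \<in> X" "i \<in> {1..s}" "\<alpha> i > 0"
  shows "\<alpha>(i := \<alpha> i - 1) \<in> X"
  using assms(1) weight_decrease(1)[of i \<alpha>, OF assms(2,3)] assms(3) by (auto simp: X_iff)

lemma X_degree_bound:
  assumes "\<alpha> \<in> X" "i \<in> {1..s}" "\<alpha> i > 0"
  shows "int (\<delta> (m + 1)) - int (weight s \<sigma> (\<alpha>(i := \<alpha> i - 1))) \<ge> int (\<delta> m) + int (\<sigma> i)"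
proof -
  have "weight s \<sigma> \<alpha> \<le> \<delta> (m + 1) - \<delta> m" using assms(1) unfolding X_iff by blast
  then show ?thesis using weight_decrease(1)[of i \<alpha>, OF assms(2,3)] \<delta>_mono by linarith
qed

text \<open>
  The columns of \<open>\<rho>\<^sup>i\<close> are annihilated by all rows but the \<open>i\<close>-th, so \<open>\<psi>\<close> maps \<open>q\<^sub>j\<close> to \<open>p\<^sub>j t\<^sub>i\<close>, and passing
  from \<open>\<Sum>\<^sub>j a\<^sub>j p\<^sub>j\<close> to \<open>\<Sum>\<^sub>j a\<^sub>j q\<^sub>j\<close> is multiplication by \<open>t\<^sub>i\<close> in the symmetric algebra of \<open>F\<close>.
\<close>

lemma constructed_properties:
  assumes "con \<alpha> h"
  shows "h \<in> biforms (int (\<delta> (m + 1)) - int (weight s \<sigma> \<alpha>)) ((\<Sum>l=1..s. \<alpha> l) + 1) \<and>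
    \<psi> h = \<gamma> * tmon \<alpha>"
  using assms
proof induction
  case initial
  have "expo (\<lambda>_. 0) = 0" by (simp add: expo_def)
  moreover have "dotT (\<phi> (m + 1)) \<in> biforms (int (\<delta> (m + 1))) 1"
    by (rule dotT_biforms[OF \<phi>_forms]) simp
  ultimately show ?case
    using \<psi>_new_column by (simp add: weight_def tmon_def)
next
  case (step \<alpha> i h a)
  let ?\<alpha> = "\<alpha>(i := \<alpha> i - 1)"
  have a: "\<And>j. j \<in> {1..m+1} \<Longrightarrow>
      a j \<in> biforms (int (\<delta> (m + 1)) - int (weight s \<sigma> ?\<alpha>) - int (e i j + \<sigma> i)) ((\<Sum>l=1..s. ?\<alpha> l) + 1)"
    "h = (\<Sum>j=1..m+1. a j * pconst (p i j))"
    using step(5) unfolding decompositions_def by blast+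
  note dec = weight_decrease[of i \<alpha>, OF step(2,3)]
  have "(\<Sum>j=1..m+1. a j * q i j) \<in> biforms (int (\<delta> (m + 1)) - int (weight s \<sigma> \<alpha>)) ((\<Sum>l=1..s. \<alpha> l) + 1)"
    unfolding biforms_eq_hforms
  proof (rule hforms_sum)
    fix j assume j: "j \<in> {1..m+1}"
    have "q i j \<in> hforms (\<lambda>_. 0) (int (e i j)) 1"
      unfolding q_def biforms_eq_hforms[symmetric] by (rule dotT_biforms[OF \<rho>_graded[OF step(2) j]])
    then show "a j * q i j \<in> hforms (\<lambda>_. 0) (int (\<delta> (m + 1)) - int (weight s \<sigma> \<alpha>)) ((\<Sum>l=1..s. \<alpha> l) + 1)"
      by (rule hforms_mult'[OF a(1)[OF j, unfolded biforms_eq_hforms]]) (simp_all only: dec of_nat_add)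
  qed
  moreover have "\<psi> (\<Sum>j=1..m+1. a j * q i j) = \<gamma> * tmon \<alpha>"
  proof -
    have q: "\<psi> (q i j) = pconst (p i j) * pvar i" if j: "j \<in> {1..m+1}" for j
    proof -
      have "\<rho> i j \<in> colspan (\<rho> i) (m + 1)" using j by (rule colspan_base)
      then have "row_times (\<xi> l) (\<rho> i j) = (if l = i then p i j else 0)" if "l \<in> {1..s}" for l
        using that unfolding \<rho>_kernel[OF step(2)] by (auto simp: p_def)
      then have "\<psi> (q i j) = tform (\<lambda>l. if l = i then p i j else 0)"
        unfolding q_def \<psi>_dotT by (intro tform_cong)
      then show ?thesis by (simp only: tform_unit[OF step(2)])
    qed
    have "\<psi> (\<Sum>j=1..m+1. a j * q i j) = (\<Sum>j=1..m+1. \<psi> (a j) * pconst (p i j) * pvar i)"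
      unfolding \<psi>_sum \<psi>_simps by (rule sum.cong) (simp_all only: q mult.assoc)
    also have "\<dots> = \<psi> h * pvar i"
      unfolding a(2) \<psi>_sum \<psi>_simps by (simp only: sum_distrib_right)
    also have "\<dots> = \<gamma> * (tmon ?\<alpha> * pvar i)" using step.IH by (simp only: mult.assoc)
    also have "tmon ?\<alpha> * pvar i = tmon \<alpha>"
      by (simp only: tmon_def pvar_def mult_single dec(3) mult_1)
    finally show ?thesis .
  qed
  ultimately show ?case ..
qed

lemma construction_step_possible:
  assumes "\<alpha> \<in> X" "i \<in> {1..s}" "\<alpha> i > 0" "con (\<alpha>(i := \<alpha> i - 1)) h"
  shows "decompositions (int (\<delta> (m + 1)) - int (weight s \<sigma> (\<alpha>(i := \<alpha> i - 1))))
     ((\<Sum>l=1..s. (\<alpha>(i := \<alpha> i - 1)) l) + 1) (m + 1) (\<lambda>j. e i j + \<sigma> i) (p i) h \<noteq> {}"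
  using decomposition_exists[OF assms(2) _ X_degree_bound[OF assms(1-3)]] constructed_properties[OF assms(4)]
  by blast

lemma construction_exists:
  assumes "\<alpha> \<in> X"
  shows "\<exists>h. con \<alpha> h"
  using assms
proof (induction "\<Sum>l=1..s. \<alpha> l" arbitrary: \<alpha>)
  case 0
  have "\<alpha> l = 0" for l
  proof (cases "l \<in> {1..s}")
    case False
    then have "l \<notin> {1..r}" using r by auto
    then show ?thesis using 0(2) by (simp add: X_iff)
  qed (use 0(1) in simp)
  then have "\<alpha> = (\<lambda>_. 0)" by (rule ext)
  then show ?case using constructed.initial by blast
next
  case (Suc n)
  then obtain i where i: "i \<in> {1..s}" "\<alpha> i > 0" by (metis Zero_not_Suc gr0I sum.neutral)
  have "n = (\<Sum>l=1..s. (\<alpha>(i := \<alpha> i - 1)) l)" using Suc(2) weight_decrease(2)[of i \<alpha>, OF i] by linarith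
  from Suc(1)[OF this X_downward[OF Suc(3) i]] obtain h where h: "con (\<alpha>(i := \<alpha> i - 1)) h" by blast
  with construction_step_possible[OF Suc(3) i] show ?case
    using constructed.step[OF Suc(3) i h] by blast
qed

lemma sum_X: "\<alpha> \<in> X \<Longrightarrow> (\<Sum>l=1..s. \<alpha> l) = (\<Sum>l=1..r. \<alpha> l)"
  by (rule sum.mono_neutral_right) (use r in \<open>auto simp: X_iff\<close>)

end

theorem corollary3p17:
  fixes f :: "(2, 'k::field) mpol ^ 'n"
    and I :: "(2, 'k) mpol set"
    and \<phi> :: "nat \<Rightarrow> (2, 'k) mpol ^ 'n"
    and d m s r :: nat
    and \<delta> \<sigma> :: "nat \<Rightarrow> nat"
    and \<Theta> :: "((((2, 'k) mpol ^ 'n) set \<Rightarrow> (2, 'k) mpol) \<Rightarrow> (2, 'k) mpol) \<Rightarrow> nat \<Rightarrow> (2, 'k) mpol"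
    and \<xi> :: "nat \<Rightarrow> (2, 'k) mpol ^ 'n"
    and \<rho> :: "nat \<Rightarrow> nat \<Rightarrow> (2, 'k) mpol ^ 'n"
    and e :: "nat \<Rightarrow> nat \<Rightarrow> nat"
    and p :: "nat \<Rightarrow> nat \<Rightarrow> (2, 'k) mpol"
    and q :: "nat \<Rightarrow> nat \<Rightarrow> ('n, (2, 'k) mpol) mpol"
    and g :: "nat \<Rightarrow> ('n, (2, 'k) mpol) mpol"
    and X :: "(nat \<Rightarrow> nat) set"
    and con :: "(nat \<Rightarrow> nat) \<Rightarrow> ('n, (2, 'k) mpol) mpol \<Rightarrow> bool"
    and RE :: "('n, (2, 'k) mpol) mpol set ring"
    and im :: "('n, (2, 'k) mpol) mpol \<Rightarrow> ('n, (2, 'k) mpol) mpol set"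
  assumes f_forms: "\<forall>j. f $ j \<in> forms (int d)"
    and I_height: "ideal_height (poly_ring UNIV) I = 2"
    and f_inj: "inj (($) f)"
    and f_min_gens: "minimal_generating_set (poly_ring UNIV) I (range (($) f))"
    and \<phi>_graded: "\<forall>i\<in>{1..CARD('n) - 1}. \<forall>j. \<phi> i $ j \<in> forms (int (\<delta> i))"
    and \<phi>_inj: "\<forall>c. (\<Sum>i=1..CARD('n) - 1. c i *s \<phi> i) = 0 \<longrightarrow> (\<forall>i\<in>{1..CARD('n) - 1}. c i = 0)"
    and \<phi>_exact: "colspan \<phi> (CARD('n) - 1) = {v. (\<Sum>j\<in>UNIV. f $ j * v $ j) = 0}"
    and \<delta>_pos: "\<forall>i\<in>{1..CARD('n) - 1}. 1 \<le> \<delta> i"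
    and \<delta>_mono: "mono_on {1..CARD('n) - 1} \<delta>"
    and m_bounds: "1 \<le> m" "m + 2 \<le> CARD('n)"
    and s_eq: "s = CARD('n) - m"
    and \<sigma>_antimono: "antimono_on {1..s} \<sigma>"
    and \<Theta>_iso: "graded_iso (poly_ring UNIV) (double_dual \<phi> m) (double_dual_grading \<phi> m)
           (free_module s) (shift_grading s \<sigma>) \<Theta>"
    and r_bounds: "1 \<le> r" "r \<le> s"
    and r_prop: "\<sigma> r > 0" "\<forall>i\<in>{r+1..s}. \<sigma> i = 0"
    and \<xi>_eq: "\<xi> = xi_row \<phi> m \<Theta>"
    and \<rho>_graded: "\<forall>i\<in>{1..s}. \<forall>j\<in>{1..m+1}. \<rho> i j \<in> vec_grading (int (e i j))"
    and \<rho>_kernel: "\<forall>i\<in>{1..s}. colspan (\<rho> i) (m + 1) =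
           {v. \<forall>l\<in>{1..s} - {i}. row_times (\<xi> l) v = 0}"
    and p_eq: "p = (\<lambda>i j. row_times (\<xi> i) (\<rho> i j))"
    and q_eq: "q = (\<lambda>i j. dotT (\<rho> i j))"
    and g_eq: "g = (\<lambda>i. dotT (\<phi> i))"
    and X_eq: "X = multi_indices s r \<sigma> (\<delta> (m + 1) - \<delta> m)"
    and con_eq: "con = constructed X s \<sigma> (\<delta> (m + 1)) (m + 1) (\<lambda>i j. e i j + \<sigma> i) p q (g (m + 1))"
    and RE_eq: "RE = poly_ring UNIV Quot reesK \<phi> m"
    and im_eq: "im = (\<lambda>F. reesK \<phi> m +>\<^bsub>poly_ring UNIV\<^esub> F)"
  shows "(\<forall>\<alpha>\<in>X. \<forall>i\<in>{1..s}. \<alpha> i > 0 \<longrightarrow>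
            (\<forall>h. con (\<alpha>(i := \<alpha> i - 1)) h \<longrightarrow>
               decompositions (int (\<delta> (m + 1)) - int (weight s \<sigma> (\<alpha>(i := \<alpha> i - 1))))
                 ((\<Sum>l=1..s. (\<alpha>(i := \<alpha> i - 1)) l) + 1) (m + 1) (\<lambda>j. e i j + \<sigma> i) (p i) h \<noteq> {})) \<and>
         (\<forall>\<alpha>\<in>X. \<exists>h. con \<alpha> h) \<and>
         (\<forall>\<alpha>\<in>X. \<forall>h. con \<alpha> h \<longrightarrow>
            h \<in> biforms (int (\<delta> (m + 1)) - int (weight s \<sigma> \<alpha>)) ((\<Sum>i=1..r. \<alpha> i) + 1)) \<and>
         (\<forall>\<alpha>\<in>X. \<forall>h h'. con \<alpha> h \<and> con \<alpha> h' \<longrightarrow> im h = im h') \<and>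
         (\<forall>h. (\<forall>\<alpha>\<in>X. con \<alpha> (h \<alpha>)) \<longrightarrow>
            inj_on (\<lambda>\<alpha>. im (h \<alpha>)) X \<and>
            (\<exists>G. minimal_generating_set RE (im ` reesK \<phi> (m + 1)) G \<and>
                 G \<subseteq> {y. \<exists>a b. y \<in> im ` biforms a b} \<and>
                 {y \<in> G. \<exists>a b. int (\<delta> m) \<le> a \<and> y \<in> im ` biforms a b} = (\<lambda>\<alpha>. im (h \<alpha>)) ` X))"
proof -
  let ?N = "CARD('n) - 1"
  have I: "I = idl.span (range (($) f))"
    using f_min_gens by (simp add: minimal_generating_set_def genideal_poly_ring)
  (* a common exponent for both variables *)
  obtain n1 where n1: "pvar 1 ^ n1 \<in> I"
    using variable_power_in_height_two_ideal[OF f_forms I I_height, of 1] by blast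
  obtain n2 where n2: "pvar 2 ^ n2 \<in> I"
    using variable_power_in_height_two_ideal[OF f_forms I I_height, of 2] by blast
  define K where "K = n1 + n2"
  have I': "idl.subspace I" by (simp add: I)
  have power: "pvar x ^ K \<in> idl.span (range (($) f))" for x :: 2
  proof -
    have "pvar 1 ^ K \<in> I" "pvar 2 ^ K \<in> I"
      unfolding K_def power_add
      using idl.subspace_scale[OF I' n1, of "pvar 1 ^ n2"] idl.subspace_scale[OF I' n2, of "pvar 2 ^ n1"]
      by (simp_all add: mult.commute)
    then show ?thesis using exhaust_2[of x] I by auto
  qed
  interpret E: module_with_double_dual f \<phi> ?N m s \<sigma> \<Theta>
  proof
    show "colspan \<phi> ?N = {v. row_times f v = 0}" using \<phi>_exact by (simp add: row_times_def)
  qed (use \<phi>_inj \<Theta>_iso m_bounds in auto)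
  have ex: "\<exists>v. \<forall>l'\<in>{1..s}. row_times (\<xi> l') v = (if l' = l then pvar x ^ K else 0)" if "l \<in> {1..s}" for x l
    using E.ideal_times_double_dual[OF power that, of x] unfolding \<xi>_eq by metis
  define \<eta> where "\<eta> x l = (SOME v. \<forall>l'\<in>{1..s}. row_times (\<xi> l') v = (if l' = l then pvar x ^ K else 0))" for x l
  have \<eta>: "row_times (\<xi> l') (\<eta> x l) = (if l' = l then pvar x ^ K else 0)"
    if "l \<in> {1..s}" "l' \<in> {1..s}" for x l l'
    using someI_ex[OF ex[OF that(1), of x]] that(2) unfolding \<eta>_def by blast
  have "\<exists>\<beta>. (\<forall>i\<in>{1..m}. row_times \<beta> (\<phi> i) = 0) \<and> row_times \<beta> (\<phi> (m + 1)) = pvar x ^ K" for x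
  proof -
    obtain b where "\<And>i l. i \<in> {1..?N} \<Longrightarrow> l \<in> {1..?N} \<Longrightarrow>
        row_times (b i) (\<phi> l) = (if i = l then pvar x ^ K else 0)"
      using splitting[OF E.inj E.exact power] by blast
    then show ?thesis using m_bounds by (intro exI[of _ "b (m + 1)"]) auto
  qed
  then obtain \<beta> where \<beta>: "\<And>x i. i \<in> {1..m} \<Longrightarrow> row_times (\<beta> x) (\<phi> i) = 0"
    "\<And>x. row_times (\<beta> x) (\<phi> (m + 1)) = pvar x ^ K" by metis
  have \<delta>_le: "\<delta> i \<le> \<delta> j" if "1 \<le> i" "i \<le> j" "j \<le> m + 1" for i j
  proof -
    have "i \<in> {1..?N}" "j \<in> {1..?N}" using that m_bounds(2) by auto
    then show ?thesis by (rule mono_onD[OF \<delta>_mono _ _ that(2)])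
  qed
  have \<sigma>_pos: "0 < \<sigma> i" if "i \<in> {1..r}" for i
  proof -
    have "\<sigma> r \<le> \<sigma> i" using \<sigma>_antimono that r_bounds by (auto simp: monotone_on_def)
    then show ?thesis using r_prop(1) by simp
  qed
  interpret C: recursive_construction \<phi> \<xi> \<delta> \<sigma> m s K \<eta> \<beta> r \<rho> e
  proof
    show "\<xi> l $ j \<in> forms (int (\<sigma> l))" if "l \<in> {1..s}" for l j
      unfolding \<xi>_eq by (rule E.\<xi>_forms[OF that])
    show "(\<forall>l\<in>{1..s}. row_times (\<xi> l) v = 0) = (v \<in> colspan \<phi> m)" for v
      unfolding \<xi>_eq by (rule E.kernel_\<xi>[OF power pvar_power_neq_0])
    show "\<phi> i \<in> vec_grading (int (\<delta> i))" if "i \<in> {1..m + 1}" for i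
      using \<phi>_graded that m_bounds by (auto simp: vec_grading_def)
    show "row_times (\<beta> x) (\<phi> (m + 1)) = pvar x ^ K" for x by (rule \<beta>)
    show "colspan (\<rho> i) (m + 1) = {v. \<forall>l\<in>{1..s} - {i}. row_times (\<xi> l) v = 0}" if "i \<in> {1..s}" for i
      using \<rho>_kernel that by blast
    show "\<rho> i j \<in> vec_grading (int (e i j))" if "i \<in> {1..s}" "j \<in> {1..m + 1}" for i j
      using \<rho>_graded that by blast
    show "\<delta> i \<le> \<delta> m" if "i \<in> {1..m}" for i using that by (intro \<delta>_le) auto
    show "\<delta> m \<le> \<delta> (m + 1)" using m_bounds by (intro \<delta>_le) auto
    show "\<sigma> i = 0" if "i \<in> {r + 1..s}" for i using r_prop(2) that by blast
  qed (use \<eta> \<beta> \<sigma>_pos r_bounds in blast)+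
  have X: "X = C.X" unfolding X_eq C.X_def ..
  have "p = C.p" "q = C.q" unfolding p_eq q_eq C.p_def C.q_def by (intro ext, simp)+
  then have con: "con = C.con" unfolding con_eq g_eq X by simp
  have im: "im F = im H \<longleftrightarrow> C.\<psi> F = C.\<psi> H" for F H
  proof -
    have "im F = im H \<longleftrightarrow> F - H \<in> reesK \<phi> m"
      unfolding im_eq by (rule rcos_poly_ring_eq_iff) (simp add: ideal_poly_ring_iff)
    then show ?thesis by (simp flip: C.\<psi>_eq_0_iff)
  qed
  note constr = C.constructed_properties
  show ?thesis
  proof (intro conjI ballI allI impI)
    fix \<alpha> i h assume "\<alpha> \<in> X" "i \<in> {1..s}" "\<alpha> i > 0" "con (\<alpha>(i := \<alpha> i - 1)) h"
    then show "decompositions (int (\<delta> (m + 1)) - int (weight s \<sigma> (\<alpha>(i := \<alpha> i - 1))))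
        ((\<Sum>l=1..s. (\<alpha>(i := \<alpha> i - 1)) l) + 1) (m + 1) (\<lambda>j. e i j + \<sigma> i) (p i) h \<noteq> {}"
      unfolding X con \<open>p = C.p\<close> by (rule C.construction_step_possible)
  next
    fix \<alpha> assume "\<alpha> \<in> X"
    then show "\<exists>h. con \<alpha> h" unfolding X con by (rule C.construction_exists)
  next
    fix \<alpha> h assume "\<alpha> \<in> X" "con \<alpha> h"
    then show "h \<in> biforms (int (\<delta> (m + 1)) - int (weight s \<sigma> \<alpha>)) ((\<Sum>i=1..r. \<alpha> i) + 1)"
      unfolding X con using constr[of \<alpha> h] C.sum_X[of \<alpha>] by simp
  next
    fix \<alpha> h h' assume "con \<alpha> h \<and> con \<alpha> h'"
    then show "im h = im h'" unfolding im con using constr[of \<alpha> h] constr[of \<alpha> h'] by simp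
  next
    fix h assume "\<forall>\<alpha>\<in>X. con \<alpha> (h \<alpha>)"
    then have h: "C.\<psi> (h \<alpha>) = C.\<gamma> * C.tmon \<alpha>"
      "h \<alpha> \<in> biforms (int (\<delta> (m + 1)) - int (weight s \<sigma> \<alpha>)) ((\<Sum>l=1..s. \<alpha> l) + 1)"
      if "\<alpha> \<in> C.X" for \<alpha>
      using constr that unfolding X con by blast+
    show "inj_on (\<lambda>\<alpha>. im (h \<alpha>)) X"
    proof (rule inj_onI)
      fix \<alpha> \<beta> assume *: "\<alpha> \<in> X" "\<beta> \<in> X" "im (h \<alpha>) = im (h \<beta>)"
      then have "C.\<gamma> * C.tmon \<alpha> = C.\<gamma> * C.tmon \<beta>" using h(1) unfolding im X by metis
      then show "\<alpha> = \<beta>" using *(1,2) C.tmon_inj unfolding X by (auto dest: inj_onD simp: C.\<gamma>_neq_0)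
    qed
    show "\<exists>G. minimal_generating_set RE (im ` reesK \<phi> (m + 1)) G \<and>
        G \<subseteq> {y. \<exists>a b. y \<in> im ` biforms a b} \<and>
        {y \<in> G. \<exists>a b. int (\<delta> m) \<le> a \<and> y \<in> im ` biforms a b} = (\<lambda>\<alpha>. im (h \<alpha>)) ` X"
      unfolding RE_eq im_eq X C.\<K>_def[symmetric]
      by (rule C.minimal_generators_of_high_degree) (use h in blast)+
  qed
qed

end
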